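(* The \textsc{Unsplittable Flow} problem (as defined in the context) is W[1]-hard when parameterized by the maximum edge capacity $c$, even when the input graph is restricted to be a path.
   Context: \textsc{Unsplittable Flow} (decision version): an instance $\mathbb{I}$ consists of a simple undirected graph $G=(V,E)$; a capacity function $\gamma:E\to\mathbb{N}$, encoded in unary; a set $\mathcal{T}$ of tasks, each task being a tuple $(s,t,d,w)\in V\times V\times\mathbb{N}\times\mathbb{N}$ with endpoints $s,t$, demand $d$ and profit $w$; a profit target $\tau\in\mathbb{N}$; and an integer length bound $\ell$. For a subset $T'\subseteq\mathcal{T}$, a flow routing assigns to each task $(s,t,d,w)\in T'$ an $s$-$t$ path in $G$ of length at most $\ell$ such that for every edge $e\in E$ the sum of the demands of the tasks in $T'$ whose assigned path uses $e$ is at most $\gamma(e)$. The question is whether there is a subset $T'$ admitting a flow routing whose total profit $\sum_{(s,t,d,w)\in T'} w$ is at least $\tau$. The maximum capacity is $c=\max_{e\in E}\gamma(e)$. *)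

theory Defs
  imports Main
begin

section \<open>Model of computation\<close>

text \<open>
  The machine model is the imperative language WHILE over binary trees
  (N. D. Jones, Computability and Complexity from a Programming Perspective).
  Words and all other finite objects are represented as trees.  An assignment is charged
  the size of the tree it stores, as if the tree were copied in full, so that a run
  of time t only stores trees of size at most t.  With this cost measure
  the model is polynomially equivalent to multi-tape Turing machines, in both directions.
\<close>

datatype tree = Leaf | Node tree tree

fun tsize :: "tree \<Rightarrow> nat" where
  "tsize Leaf = 1"
| "tsize (Node l r) = 1 + tsize l + tsize r"

datatype expr = Var nat | Lit tree | Pr expr expr | Hd expr | Tl expr | Eq expr expr

type_synonym store = "nat \<Rightarrow> tree"

definition tree_of_bool :: "bool \<Rightarrow> tree" where
  "tree_of_bool b = (if b then Node Leaf Leaf else Leaf)"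

fun left :: "tree \<Rightarrow> tree" where
  "left Leaf = Leaf"
| "left (Node l r) = l"

fun right :: "tree \<Rightarrow> tree" where
  "right Leaf = Leaf"
| "right (Node l r) = r"

fun aval :: "expr \<Rightarrow> store \<Rightarrow> tree" where
  "aval (Var i) s = s i"
| "aval (Lit t) s = t"
| "aval (Pr a b) s = Node (aval a s) (aval b s)"
| "aval (Hd a) s = left (aval a s)"
| "aval (Tl a) s = right (aval a s)"
| "aval (Eq a b) s = tree_of_bool (aval a s = aval b s)"

datatype com =
    Assign nat expr
  | Seq com com
  | Cond expr com com
  | While expr com

text \<open>
  \<open>exec p s t s'\<close>: program \<open>p\<close>, started in store \<open>s\<close>, halts after time \<open>t\<close> in store \<open>s'\<close>.
  A test succeeds iff its value is not \<open>Leaf\<close>.  The expressions of a fixed program have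
  constant size, so the time for evaluating them is polynomial in the time already
  spent and the size of the initial store.
\<close>

inductive exec :: "com \<Rightarrow> store \<Rightarrow> nat \<Rightarrow> store \<Rightarrow> bool" where
  Assign: "exec (Assign i a) s (1 + tsize (aval a s)) (s(i := aval a s))"
| Seq: "exec p s t s' \<Longrightarrow> exec q s' u s'' \<Longrightarrow> exec (Seq p q) s (t + u) s''"
| CondTrue: "aval a s \<noteq> Leaf \<Longrightarrow> exec p s t s' \<Longrightarrow> exec (Cond a p q) s (1 + t) s'"
| CondFalse: "aval a s = Leaf \<Longrightarrow> exec q s t s' \<Longrightarrow> exec (Cond a p q) s (1 + t) s'"
| WhileTrue: "aval a s \<noteq> Leaf \<Longrightarrow> exec p s t s' \<Longrightarrow> exec (While a p) s' u s''
    \<Longrightarrow> exec (While a p) s (1 + t + u) s''"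
| WhileFalse: "aval a s = Leaf \<Longrightarrow> exec (While a p) s 1 s"

lemma exec_deterministic:
  "exec p s t s' \<Longrightarrow> exec p s u s'' \<Longrightarrow> t = u \<and> s' = s''"
proof (induction arbitrary: u s'' rule: exec.induct)
  case Assign
  then show ?case by (auto elim: exec.cases)
next
  case Seq
  from Seq.prems show ?case by cases (use Seq.IH in blast)
next
  case CondTrue
  from CondTrue.prems show ?case by cases (use CondTrue in blast)+
next
  case CondFalse
  from CondFalse.prems show ?case by cases (use CondFalse in blast)+
next
  case WhileTrue
  from WhileTrue.prems show ?case by cases (use WhileTrue in blast)+
next
  case WhileFalse
  from WhileFalse.prems show ?case by cases (use WhileFalse in blast)+
qed

text \<open>Input and output are held in variable 0.\<close>

definition runs :: "com \<Rightarrow> tree \<Rightarrow> nat \<Rightarrow> tree \<Rightarrow> bool" where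
  "runs p x t y \<longleftrightarrow> (\<exists>s'. exec p ((\<lambda>_. Leaf)(0 := x)) t s' \<and> s' 0 = y)"

section \<open>Encodings\<close>

fun enc_list :: "('a \<Rightarrow> tree) \<Rightarrow> 'a list \<Rightarrow> tree" where
  "enc_list f [] = Leaf"
| "enc_list f (x # xs) = Node (f x) (enc_list f xs)"

fun enc_unary :: "nat \<Rightarrow> tree" where
  "enc_unary 0 = Leaf"
| "enc_unary (Suc n) = Node Leaf (enc_unary n)"

fun bits :: "nat \<Rightarrow> bool list" where \<comment> \<open>least significant bit first\<close>
  "bits n = (if n = 0 then [] else odd n # bits (n div 2))"

declare bits.simps [simp del]

definition enc_binary :: "nat \<Rightarrow> tree" where
  "enc_binary n = enc_list tree_of_bool (bits n)"

definition enc_int :: "int \<Rightarrow> tree" where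
  "enc_int i = Node (tree_of_bool (i < 0)) (enc_binary (nat \<bar>i\<bar>))"

section \<open>Parameterized problems and fpt-reductions\<close>

type_synonym param_problem = "(tree \<times> nat) set"

definition computable :: "(nat \<Rightarrow> nat) \<Rightarrow> bool" where
  "computable f \<longleftrightarrow> (\<exists>p. \<forall>n. \<exists>t. runs p (enc_unary n) t (enc_unary (f n)))"

definition fpt_reducible :: "param_problem \<Rightarrow> param_problem \<Rightarrow> bool" where
  "fpt_reducible A B \<longleftrightarrow>
    (\<exists>p f g c. computable f \<and> computable g \<and>
      (\<forall>x k. \<exists>t x' k'.
        runs p (Node x (enc_unary k)) t (Node x' (enc_unary k')) \<and>
        t \<le> f k * tsize x ^ c \<and>
        k' \<le> g k \<and>
        ((x, k) \<in> A \<longleftrightarrow> (x', k') \<in> B)))"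

section \<open>Boolean circuits and the W-hierarchy\<close>

text \<open>
  A circuit is listed in a topological order: gate \<open>i\<close> may only refer to gates with a
  smaller index, and the last gate is the output.
\<close>

datatype gate = Input | Neg nat | And "nat list" | Or "nat list"

type_synonym circuit = "gate list"

fun preds :: "gate \<Rightarrow> nat list" where
  "preds Input = []"
| "preds (Neg j) = [j]"
| "preds (And js) = js"
| "preds (Or js) = js"

fun wf_gate :: "gate \<Rightarrow> bool" where
  "wf_gate (And js) = (distinct js \<and> length js \<ge> 2)"
| "wf_gate (Or js) = (distinct js \<and> length js \<ge> 2)"
| "wf_gate _ = True"

definition wf_circuit :: "circuit \<Rightarrow> bool" where
  "wf_circuit C \<longleftrightarrow> C \<noteq> [] \<and>
    (\<forall>i < length C. wf_gate (C ! i) \<and> (\<forall>j \<in> set (preds (C ! i)). j < i))"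

definition inputs :: "circuit \<Rightarrow> nat set" where
  "inputs C = {i. i < length C \<and> C ! i = Input}"

fun gate_value :: "gate \<Rightarrow> bool \<Rightarrow> (nat \<Rightarrow> bool) \<Rightarrow> bool" where
  "gate_value Input b v = b"
| "gate_value (Neg j) b v = (\<not> v j)"
| "gate_value (And js) b v = (\<forall>j \<in> set js. v j)"
| "gate_value (Or js) b v = (\<exists>j \<in> set js. v j)"

text \<open>
  \<open>X\<close> is the set of input gates set to true.  By acyclicity the gate values \<open>v\<close> below
  are uniquely determined on the gates of a well-formed circuit.
\<close>

definition satisfies :: "nat set \<Rightarrow> circuit \<Rightarrow> bool" where
  "satisfies X C \<longleftrightarrow>
    (\<exists>v. (\<forall>i < length C. v i = gate_value (C ! i) (i \<in> X) v) \<and> v (length C - 1))"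

definition input_output_path :: "circuit \<Rightarrow> nat list \<Rightarrow> bool" where
  "input_output_path C p \<longleftrightarrow> p \<noteq> [] \<and> hd p \<in> inputs C \<and> last p = length C - 1 \<and>
    (\<forall>i \<in> set p. i < length C) \<and>
    (\<forall>i. Suc i < length p \<longrightarrow> p ! i \<in> set (preds (C ! (p ! Suc i))))"

definition large :: "gate \<Rightarrow> bool" where
  "large g \<longleftrightarrow> length (preds g) > 2"

definition depth_at_most :: "nat \<Rightarrow> circuit \<Rightarrow> bool" where
  "depth_at_most d C \<longleftrightarrow> (\<forall>p. input_output_path C p \<longrightarrow> length p - 1 \<le> d)"

definition weft_at_most :: "nat \<Rightarrow> circuit \<Rightarrow> bool" where
  "weft_at_most t C \<longleftrightarrow>
    (\<forall>p. input_output_path C p \<longrightarrow> length (filter (\<lambda>i. large (C ! i)) p) \<le> t)"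

text \<open>
  Gate indices are below the number of gates, so writing them in unary changes the
  size of the encoding only polynomially.
\<close>

fun enc_gate :: "gate \<Rightarrow> tree" where
  "enc_gate Input = Node (enc_unary 0) Leaf"
| "enc_gate (Neg j) = Node (enc_unary 1) (enc_unary j)"
| "enc_gate (And js) = Node (enc_unary 2) (enc_list enc_unary js)"
| "enc_gate (Or js) = Node (enc_unary 3) (enc_list enc_unary js)"

definition weighted_circuit_sat :: "nat \<Rightarrow> nat \<Rightarrow> param_problem" where
  "weighted_circuit_sat t d = {(enc_list enc_gate C, k) | C k.
    wf_circuit C \<and> weft_at_most t C \<and> depth_at_most d C \<and>
    (\<exists>X \<subseteq> inputs C. card X = k \<and> satisfies X C)}"

definition W :: "nat \<Rightarrow> param_problem set" where
  "W t = {A. \<exists>d. fpt_reducible A (weighted_circuit_sat t d)}"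

definition W_hard :: "nat \<Rightarrow> param_problem \<Rightarrow> bool" where
  "W_hard t B \<longleftrightarrow> (\<forall>A \<in> W t. fpt_reducible A B)"

section \<open>Unsplittable Flow\<close>

type_synonym ugraph = "nat set \<times> nat set set"

definition simple_graph :: "ugraph \<Rightarrow> bool" where
  "simple_graph = (\<lambda>(V, E). finite V \<and> (\<forall>e \<in> E. \<exists>u \<in> V. \<exists>v \<in> V. u \<noteq> v \<and> e = {u, v}))"

definition path_edges :: "nat list \<Rightarrow> nat set set" where
  "path_edges p = {{p ! i, p ! Suc i} | i. Suc i < length p}"

definition is_path :: "ugraph \<Rightarrow> nat \<Rightarrow> nat \<Rightarrow> nat list \<Rightarrow> bool" where
  "is_path = (\<lambda>(V, E) s t p. p \<noteq> [] \<and> distinct p \<and> set p \<subseteq> V \<and> path_edges p \<subseteq> E \<and>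
    hd p = s \<and> last p = t)"

definition path_graph :: "ugraph \<Rightarrow> bool" where
  "path_graph = (\<lambda>(V, E). \<exists>vs. vs \<noteq> [] \<and> distinct vs \<and> set vs = V \<and> path_edges vs = E)"

type_synonym task = "nat \<times> nat \<times> nat \<times> nat" \<comment> \<open>endpoints, demand, profit\<close>

fun demand :: "task \<Rightarrow> nat" where
  "demand (s, t, d, w) = d"

fun profit :: "task \<Rightarrow> nat" where
  "profit (s, t, d, w) = w"

record uf_instance =
  graph :: ugraph
  capacity :: "nat set \<Rightarrow> nat" \<comment> \<open>only the values on edges matter\<close>
  tasks :: "task set"
  target :: nat
  length_bound :: int

definition valid_instance :: "uf_instance \<Rightarrow> bool" where
  "valid_instance I \<longleftrightarrow> simple_graph (graph I) \<and> finite (tasks I) \<and>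
    (\<forall>(s, t, d, w) \<in> tasks I. s \<in> fst (graph I) \<and> t \<in> fst (graph I))"

definition flow_routing :: "uf_instance \<Rightarrow> task set \<Rightarrow> (task \<Rightarrow> nat list) \<Rightarrow> bool" where
  "flow_routing I T R \<longleftrightarrow>
    (\<forall>(s, t, d, w) \<in> T. is_path (graph I) s t (R (s, t, d, w)) \<and>
      int (length (R (s, t, d, w)) - 1) \<le> length_bound I) \<and>
    (\<forall>e \<in> snd (graph I). (\<Sum>\<theta> \<in> {\<theta> \<in> T. e \<in> path_edges (R \<theta>)}. demand \<theta>) \<le> capacity I e)"

definition yes_instance :: "uf_instance \<Rightarrow> bool" where
  "yes_instance I \<longleftrightarrow>
    (\<exists>T \<subseteq> tasks I. (\<exists>R. flow_routing I T R) \<and> (\<Sum>\<theta> \<in> T. profit \<theta>) \<ge> target I)"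

text \<open>The maximum capacity of an instance without edges is 0.\<close>

definition max_capacity :: "uf_instance \<Rightarrow> nat" where
  "max_capacity I = Max (insert 0 (capacity I ` snd (graph I)))"

text \<open>
  Capacities are in unary, all other numbers in binary.  Sets are encoded by
  listing their elements without repetition in any order, an edge by its endpoints
  in any order, so an instance has several encodings.
\<close>

definition encodes_instance :: "tree \<Rightarrow> uf_instance \<Rightarrow> bool" where
  "encodes_instance x I \<longleftrightarrow>
    (\<exists>vs es ts.
      distinct vs \<and> set vs = fst (graph I) \<and>
      distinct (map (\<lambda>(u, v). {u, v}) es) \<and> (\<lambda>(u, v). {u, v}) ` set es = snd (graph I) \<and>
      distinct ts \<and> set ts = tasks I \<and>
      x = Node (enc_list enc_binary vs)
         (Node (enc_list (\<lambda>(u, v). Node (Node (enc_binary u) (enc_binary v))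
                                         (enc_unary (capacity I {u, v}))) es)
         (Node (enc_list (\<lambda>(s, t, d, w). Node (Node (enc_binary s) (enc_binary t))
                                               (Node (enc_binary d) (enc_binary w))) ts)
         (Node (enc_binary (target I))
               (enc_int (length_bound I))))))"

text \<open>Unsplittable Flow on the graphs of class \<open>\<G>\<close>, parameterized by the maximum capacity.\<close>

definition unsplittable_flow :: "(ugraph \<Rightarrow> bool) \<Rightarrow> param_problem" where
  "unsplittable_flow \<G> = {(x, max_capacity I) | x I.
    valid_instance I \<and> \<G> (graph I) \<and> encodes_instance x I \<and> yes_instance I}"

end

(*
  A circuit of depth D and weft one is a Boolean combination, of size bounded in D, of large gates whose
  inputs depend on at most 2^D circuit inputs each.  Expanding it above the large gates gives polynomially
  many conjunctions of claims about gates that have only small gates below.  The number of violated claims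
  of a conjunction is a multilinear polynomial of degree at most 2^D in the circuit inputs.  It is never
  negative, so a set X of k inputs satisfies the circuit iff one of these polynomials is at most 0 at X.

  Write X as an injective tuple of k values.  Every monomial is a tuple of 2^D variables and is true at X iff
  exactly one tuple of positions in X carries it.  So the value of the polynomial is a sum over the (k+2)^(2^D+1)
  tuples of positions, where two further positions hold the chosen conjunction and a dummy that is always true.

  On a line, each tuple of positions becomes a block of tasks that chooses the values at these positions.
  Profits force all edges to be saturated.  Saturation makes blocks agree on the positions they share, and the
  remaining profit measures the value of the polynomial.  The capacities depend on k and D only.
*)
theory Submission
  imports Defs
begin

section \<open>Polynomial-time functions between encodable types\<close>

text \<open>Two budgets shape the construction. Capacities must not grow with the circuit, so
  whatever grows with it is laid out along the line or put into profits: values become positions,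
  and the unbounded number of claims in a conjunction enters as one weighted sum, which a profit
  goal can measure, instead of as separate constraints. A goal tests a single inequality; this
  suffices because a violation count that is never negative vanishes iff it is at most 0. Blocks
  need a common number of entries, so all monomials are padded to length 2^D, where every level of
  depth doubles the length; one further entry names the chosen conjunction, hence the arity 2^D + 1.

  The running time concerns an actual program, which is never written out: \<open>pt\<close>
  collects the functions with a polynomial-time program, closure rules cover composition, case
  distinction and folds, and the reduction is assembled from these. As \<open>D\<close> is fixed
  before the input is given, recursions on depth unfold into finitely many compositions. Unary
  numbers are affordable because for fixed \<open>D\<close> all profits are polynomial in the
  circuit size and \<open>k\<close>.\<close>

class enc =
  fixes enc :: "'a \<Rightarrow> tree"
  assumes enc_inj: "enc x = enc y \<Longrightarrow> x = y"

text \<open>Injectivity lets the tree comparison \<open>Eq\<close> of the language decide equality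
  of values, see \<open>pt_eq\<close>.\<close>

lemma enc_eq_iff [simp]: "enc x = enc y \<longleftrightarrow> x = y"
  using enc_inj by blast

lemma enc_list_inj:
  assumes "\<And>x y. f x = f y \<Longrightarrow> x = y" and "enc_list f xs = enc_list f ys"
  shows "xs = ys"
  using assms(2)
proof (induction xs arbitrary: ys)
  case Nil
  then show ?case by (cases ys) auto
next
  case (Cons x xs)
  then show ?case using assms(1) by (cases ys) auto
qed

lemma enc_unary_inj: "enc_unary m = enc_unary n \<Longrightarrow> m = n"
proof (induction m arbitrary: n)
  case 0
  then show ?case by (cases n) auto
next
  case (Suc m)
  then show ?case by (cases n) auto
qed

instantiation tree :: enc
begin
definition "enc (t :: tree) = t"
instance by standard (simp add: enc_tree_def)
end

text \<open>Unary, as parameters and capacities are required to be; binary numerals are produced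
  only in the output, by \<open>bits\<close>.\<close>

instantiation nat :: enc
begin
definition "enc (n :: nat) = enc_unary n"
instance by standard (simp add: enc_nat_def enc_unary_inj)
end

instantiation bool :: enc
begin
definition "enc (b :: bool) = tree_of_bool b"
instance by standard (simp add: enc_bool_def tree_of_bool_def split: if_splits)
end

instantiation prod :: (enc, enc) enc
begin
definition "enc p = Node (enc (fst p)) (enc (snd p))"
instance by standard (simp add: enc_prod_def prod_eq_iff)
end

instantiation list :: (enc) enc
begin
definition "enc (xs :: 'a list) = enc_list enc xs"
instance by standard (use enc_list_inj[of enc] in \<open>simp add: enc_list_def\<close>)
end

instantiation gate :: enc
begin
definition "enc (g :: gate) = enc_gate g"
instance
proof
  fix g h :: gate
  assume "enc g = enc h"
  then show "g = h"
    unfolding enc_gate_def using enc_unary_inj enc_list_inj[of enc_unary]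
    by (cases g; cases h) (auto simp: numeral_eq_Suc)
qed
end

lemmas enc_simps = enc_tree_def enc_nat_def enc_bool_def enc_prod_def enc_list_def

lemma enc_Nil [simp]: "enc [] = Leaf"
  and enc_Cons [simp]: "enc (x # xs) = Node (enc x) (enc xs)"
  by (simp_all add: enc_list_def)

section \<open>Tree sizes and polynomially bounded functions\<close>

lemma tsize_pos [simp]: "0 < tsize t"
  by (cases t) auto

lemma tsize_ge_1: "Suc 0 \<le> tsize t"
  by (cases t) auto

text \<open>One constant serves as factor and exponent, so a single existential has to be handled;
  \<open>n + 1\<close> keeps the bound useful at 0.\<close>

definition polybd :: "(nat \<Rightarrow> nat) \<Rightarrow> bool" where
  "polybd f \<longleftrightarrow> (\<exists>c. \<forall>n. f n \<le> c * (n + 1) ^ c)"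

lemma polybdI: "(\<And>n. f n \<le> c * (n + 1) ^ c) \<Longrightarrow> polybd f"
  unfolding polybd_def by blast

lemma polybd_mono: "polybd g \<Longrightarrow> (\<And>n. f n \<le> g n) \<Longrightarrow> polybd f"
  unfolding polybd_def by (meson le_trans)

lemma polybd_const: "polybd (\<lambda>n. c)"
proof (rule polybdI)
  fix n show "c \<le> c * (n + 1) ^ c" by simp
qed

lemma polybd_id: "polybd (\<lambda>n. n)"
  by (rule polybdI[where c = 1]) simp

lemma polybd_add:
  assumes "polybd f" "polybd g"
  shows "polybd (\<lambda>n. f n + g n)"
proof -
  obtain c d where c: "\<And>n. f n \<le> c * (n + 1) ^ c" and d: "\<And>n. g n \<le> d * (n + 1) ^ d"
    using assms unfolding polybd_def by blast
  show ?thesis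
  proof (rule polybdI)
    fix n
    have "f n + g n \<le> c * (n + 1) ^ (c + d) + d * (n + 1) ^ (c + d)"
      using c[of n] d[of n]
      by (meson add_mono le_add1 le_add2 le_trans mult_le_mono2 power_increasing)
    then show "f n + g n \<le> (c + d) * (n + 1) ^ (c + d)"
      by (simp add: algebra_simps)
  qed
qed

lemma polybd_mult:
  assumes "polybd f" "polybd g"
  shows "polybd (\<lambda>n. f n * g n)"
proof -
  obtain c d where c: "\<And>n. f n \<le> c * (n + 1) ^ c" and d: "\<And>n. g n \<le> d * (n + 1) ^ d"
    using assms unfolding polybd_def by blast
  show ?thesis
  proof (rule polybdI)
    fix n
    have "f n * g n \<le> (c * (n + 1) ^ c) * (d * (n + 1) ^ d)"
      by (intro mult_mono c d) auto
    also have "\<dots> = c * d * (n + 1) ^ (c + d)"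
      by (simp add: power_add algebra_simps)
    also have "\<dots> \<le> (c * d + c + d) * (n + 1) ^ (c * d + c + d)"
      by (intro mult_mono power_increasing) auto
    finally show "f n * g n \<le> (c * d + c + d) * (n + 1) ^ (c * d + c + d)" .
  qed
qed

lemma polybd_power: "polybd f \<Longrightarrow> polybd (\<lambda>n. f n ^ k)"
  by (induction k) (auto intro: polybd_const polybd_mult)

lemma polybd_comp:
  assumes "polybd f" "polybd g"
  shows "polybd (\<lambda>n. f (g n))"
proof -
  obtain c where c: "\<And>n. f n \<le> c * (n + 1) ^ c"
    using assms unfolding polybd_def by blast
  have "polybd (\<lambda>n. c * (g n + 1) ^ c)"
    by (intro polybd_mult polybd_power polybd_add polybd_const assms)
  then show ?thesis by (rule polybd_mono) (rule c)
qed

lemmas polybd_intros = polybd_const polybd_id polybd_add polybd_mult polybd_power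

text \<open>
  Programs obey a stack discipline: the program for base \<open>b\<close> reads and writes variable \<open>b\<close>, may
  destroy all variables above \<open>b\<close>, whatever they hold, and preserves the ones below.
\<close>

definition runs_at :: "nat \<Rightarrow> com \<Rightarrow> tree \<Rightarrow> nat \<Rightarrow> tree \<Rightarrow> bool" where
  "runs_at b p x T y \<longleftrightarrow> (\<forall>S. S b = x \<longrightarrow>
     (\<exists>t S'. exec p S t S' \<and> S' b = y \<and> (\<forall>j<b. S' j = S j) \<and> t \<le> T))"

text \<open>Combinators run their parts at the bases \<open>b+1\<close>, \<open>b+2\<close>,
  \<open>b+3\<close>, so a program is demanded for every base; program and bound may depend on
  it.\<close>

definition pt :: "('a::enc \<Rightarrow> 'b::enc) \<Rightarrow> bool" where
  "pt f \<longleftrightarrow> (\<forall>b. \<exists>p B. polybd B \<and> (\<forall>x. runs_at b p (enc x) (B (tsize (enc x))) (enc (f x))))"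

lemma runs_atE:
  assumes "runs_at b p x T y" "S b = x"
  obtains t S' where "exec p S t S'" "S' b = y" "\<And>j. j < b \<Longrightarrow> S' j = S j" "t \<le> T"
  using assms unfolding runs_at_def by blast

text \<open>An assignment is charged the size of what it stores. Every time bound is thereby also a
  bound on the size of the output, which composition needs.\<close>

lemma exec_size: "exec p s t s' \<Longrightarrow> s' j = s j \<or> tsize (s' j) \<le> t"
proof (induction arbitrary: j rule: exec.induct)
  case (Seq p s t s' q u s'')
  from Seq.IH(1)[of j] Seq.IH(2)[of j] show ?case by auto
next
  case (WhileTrue a s p t s' u s'')
  from WhileTrue.IH(1)[of j] WhileTrue.IH(2)[of j] show ?case by auto
qed (auto intro: le_SucI)

lemma runs_at_size:
  assumes "runs_at b p x T y"
  shows "tsize y \<le> tsize x + T"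
proof -
  obtain t S' where "exec p (\<lambda>_. x) t S'" "S' b = y" "t \<le> T"
    using runs_atE[OF assms, of "\<lambda>_. x"] by metis
  then show ?thesis using exec_size[of p "\<lambda>_. x" t S' b] by auto
qed

lemma runs_at_mono: "runs_at b p x T y \<Longrightarrow> T \<le> T' \<Longrightarrow> runs_at b p x T' y"
  unfolding runs_at_def using le_trans by blast

text \<open>A normal form whose bound is visibly monotone and covers both time and output size.
  \<open>polybd\<close> alone gives no monotonicity, yet composition must replace the size of an
  intermediate value by an upper bound for it.\<close>

lemma ptE:
  assumes "pt f"
  obtains p c where "\<And>x. runs_at b p (enc x) (c * (tsize (enc x) + 1) ^ c) (enc (f x))"
    and "\<And>x. tsize (enc (f x)) \<le> c * (tsize (enc x) + 1) ^ c"
proof -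
  obtain p B where B: "polybd B" and r: "\<And>x. runs_at b p (enc x) (B (tsize (enc x))) (enc (f x))"
    using assms unfolding pt_def by blast
  have "polybd (\<lambda>n. n + B n)" by (intro polybd_add polybd_id B)
  then obtain c where c: "\<And>n. n + B n \<le> c * (n + 1) ^ c" unfolding polybd_def by blast
  show thesis
  proof (rule that)
    show "runs_at b p (enc x) (c * (tsize (enc x) + 1) ^ c) (enc (f x))" for x
      using r by (rule runs_at_mono) (use c[of "tsize (enc x)"] in simp)
    show "tsize (enc (f x)) \<le> c * (tsize (enc x) + 1) ^ c" for x
      using runs_at_size[OF r[of x]] c[of "tsize (enc x)"] by simp
  qed
qed

lemma pt_size:
  assumes "pt f"
  obtains B where "polybd B" "\<And>x. tsize (enc (f x)) \<le> B (tsize (enc x))" "mono B"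
proof -
  obtain p c where "\<And>x. tsize (enc (f x)) \<le> c * (tsize (enc x) + 1) ^ c"
    using ptE[OF assms, of 0] by metis
  moreover have "polybd (\<lambda>n. c * (n + 1) ^ c)" by (intro polybd_intros)
  moreover have "mono (\<lambda>n. c * (n + 1) ^ c)" by (intro monoI mult_le_mono2 power_mono) auto
  ultimately show thesis using that by blast
qed

lemma ptI:
  assumes "\<And>b. \<exists>p B. polybd B \<and> (\<forall>x. runs_at b p (enc x) (B (tsize (enc x))) (enc (f x)))"
  shows "pt f"
  using assms unfolding pt_def by blast

section \<open>Assignments, composition, pairs and case distinctions\<close>

lemma runs_at_Assign:
  assumes "\<And>S. S b = x \<Longrightarrow> aval e S = y" "1 + tsize y \<le> T"
  shows "runs_at b (Assign b e) x T y"
  unfolding runs_at_def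
proof (intro allI impI)
  fix S :: store assume "S b = x"
  then have "exec (Assign b e) S (1 + tsize y) (S(b := y))"
    using exec.Assign[of b e S] assms(1)[of S] by simp
  then show "\<exists>t S'. exec (Assign b e) S t S' \<and> S' b = y \<and> (\<forall>j<b. S' j = S j) \<and> t \<le> T"
    using assms(2) by (intro exI[of _ "1 + tsize y"] exI[of _ "S(b := y)"]) auto
qed

lemma pt_expr:
  assumes "\<And>b S x. S b = enc x \<Longrightarrow> aval (e b) S = enc (f x)"
    and "polybd B" "\<And>x. tsize (enc (f x)) \<le> B (tsize (enc x))"
  shows "pt f"
proof (rule ptI)
  fix b
  have "polybd (\<lambda>n. 1 + B n)" by (intro polybd_intros assms)
  moreover have "runs_at b (Assign b (e b)) (enc x) (1 + B (tsize (enc x))) (enc (f x))" for x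
    by (rule runs_at_Assign) (use assms in auto)
  ultimately show "\<exists>p B. polybd B \<and> (\<forall>x. runs_at b p (enc x) (B (tsize (enc x))) (enc (f x)))"
    by blast
qed

text \<open>A change of type is free when both values have the same tree. Numbers are treated as
  lists of leaves, and gates as tagged pairs, in this way.\<close>

lemma pt_coerce: "pt g \<Longrightarrow> (\<And>x. enc (f x) = enc (g x)) \<Longrightarrow> pt f"
  unfolding pt_def by simp

lemma pt_id: "pt (\<lambda>x. x)"
  by (rule pt_expr[where e = Var and B = "\<lambda>n. n"]) (auto intro: polybd_intros)

lemma pt_const: "pt (\<lambda>x. c)"
  by (rule pt_expr[where e = "\<lambda>_. Lit (enc c)" and B = "\<lambda>_. tsize (enc c)"]) (auto intro: polybd_intros)

lemma runs_at_comp: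
  assumes "runs_at b p x T y" "runs_at b q y U z"
  shows "runs_at b (Seq p q) x (T + U) z"
  unfolding runs_at_def
proof (intro allI impI)
  fix S :: store assume "S b = x"
  then obtain t S' where 1: "exec p S t S'" "S' b = y" "\<And>j. j < b \<Longrightarrow> S' j = S j" "t \<le> T"
    using runs_atE[OF assms(1)] by metis
  obtain u S'' where "exec q S' u S''" "S'' b = z" "\<And>j. j < b \<Longrightarrow> S'' j = S' j" "u \<le> U"
    using runs_atE[OF assms(2), of S'] 1(2) by metis
  with 1 show "\<exists>t S'. exec (Seq p q) S t S' \<and> S' b = z \<and> (\<forall>j<b. S' j = S j) \<and> t \<le> T + U"
    by (intro exI[of _ "t + u"] exI[of _ S'']) (auto intro: exec.Seq)
qed

lemma pt_comp:
  assumes "pt f" "pt g"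
  shows "pt (\<lambda>x. f (g x))"
proof (rule ptI)
  fix b
  obtain p B where p: "polybd B" "\<And>x. runs_at b p (enc x) (B (tsize (enc x))) (enc (g x))"
    using assms(2) unfolding pt_def by blast
  obtain G where G: "polybd G" "\<And>x. tsize (enc (g x)) \<le> G (tsize (enc x))"
    using pt_size[OF assms(2)] by metis
  obtain q c where q: "\<And>x. runs_at b q (enc x) (c * (tsize (enc x) + 1) ^ c) (enc (f x))"
    using ptE[OF assms(1)] by metis
  have "runs_at b (Seq p q) (enc x) (B (tsize (enc x)) + c * (G (tsize (enc x)) + 1) ^ c) (enc (f (g x)))" for x
    by (rule runs_at_comp, rule p, rule runs_at_mono, rule q) (auto intro!: power_mono mult_le_mono2 G)
  moreover have "polybd (\<lambda>n. B n + c * (G n + 1) ^ c)" by (intro polybd_intros p G)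
  ultimately show "\<exists>p B. polybd B \<and> (\<forall>x. runs_at b p (enc x) (B (tsize (enc x))) (enc (f (g x))))"
    by (intro exI[of _ "Seq p q"] exI[of _ "\<lambda>n. B n + c * (G n + 1) ^ c"]) blast
qed

text \<open>Variable \<open>b\<close> keeps the input: \<open>p\<close> works at base
  \<open>b+1\<close> and so preserves it for the second copy, while \<open>q\<close> works at
  \<open>b+2\<close> and so preserves the first result.\<close>

lemma runs_at_pair:
  assumes "runs_at (b+1) p x T y" "runs_at (b+2) q x U z"
  shows "runs_at b (Seq (Assign (b+1) (Var b)) (Seq p (Seq (Assign (b+2) (Var b)) (Seq q
    (Assign b (Pr (Var (b+1)) (Var (b+2)))))))) x (4 + 2 * tsize x + T + U + tsize y + tsize z) (Node y z)"
  unfolding runs_at_def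
proof (intro allI impI)
  fix S :: store assume S: "S b = x"
  let ?S1 = "S(b+1 := x)"
  have 1: "exec (Assign (b+1) (Var b)) S (1 + tsize x) ?S1"
    using exec.Assign[of "b+1" "Var b" S] S by simp
  obtain t S2 where 2: "exec p ?S1 t S2" "S2 (b+1) = y" "\<And>j. j < b+1 \<Longrightarrow> S2 j = ?S1 j" "t \<le> T"
    using runs_atE[OF assms(1), of ?S1] by (metis fun_upd_same)
  let ?S3 = "S2(b+2 := x)"
  have 3: "exec (Assign (b+2) (Var b)) S2 (1 + tsize x) ?S3"
    using exec.Assign[of "b+2" "Var b" S2] S 2 by simp
  obtain u S4 where 4: "exec q ?S3 u S4" "S4 (b+2) = z" "\<And>j. j < b+2 \<Longrightarrow> S4 j = ?S3 j" "u \<le> U"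
    using runs_atE[OF assms(2), of ?S3] by (metis fun_upd_same)
  have 5: "exec (Assign b (Pr (Var (b+1)) (Var (b+2)))) S4 (1 + tsize (Node y z)) (S4(b := Node y z))"
    using exec.Assign[of b "Pr (Var (b+1)) (Var (b+2))" S4] 2 4 by simp
  show "\<exists>t S'. exec (Seq (Assign (b+1) (Var b)) (Seq p (Seq (Assign (b+2) (Var b)) (Seq q
    (Assign b (Pr (Var (b+1)) (Var (b+2)))))))) S t S' \<and> S' b = Node y z \<and> (\<forall>j<b. S' j = S j) \<and>
    t \<le> 4 + 2 * tsize x + T + U + tsize y + tsize z"
    by (rule exI, rule exI, rule conjI, (rule exec.Seq 1 2 3 4 5)+) (use 2 4 in auto)
qed

lemma pt_pair:
  assumes "pt f" "pt g"
  shows "pt (\<lambda>x. (f x, g x))"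
proof (rule ptI)
  fix b
  obtain p B where p: "polybd B" "\<And>x. runs_at (b+1) p (enc x) (B (tsize (enc x))) (enc (f x))"
    using assms(1) unfolding pt_def by blast
  obtain q C where q: "polybd C" "\<And>x. runs_at (b+2) q (enc x) (C (tsize (enc x))) (enc (g x))"
    using assms(2) unfolding pt_def by blast
  obtain F where F: "polybd F" "\<And>x. tsize (enc (f x)) \<le> F (tsize (enc x))"
    using pt_size[OF assms(1)] by metis
  obtain G where G: "polybd G" "\<And>x. tsize (enc (g x)) \<le> G (tsize (enc x))"
    using pt_size[OF assms(2)] by metis
  let ?B = "\<lambda>n. 4 + 2 * n + B n + C n + F n + G n"
  have "runs_at b (Seq (Assign (b+1) (Var b)) (Seq p (Seq (Assign (b+2) (Var b)) (Seq q
    (Assign b (Pr (Var (b+1)) (Var (b+2)))))))) (enc x) (?B (tsize (enc x))) (enc (f x, g x))" for x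
    unfolding enc_prod_def fst_conv snd_conv
    by (rule runs_at_mono[OF runs_at_pair[OF p(2) q(2)]]) (use F(2)[of x] G(2)[of x] in linarith)
  moreover have "polybd ?B" by (intro polybd_intros p q F G)
  ultimately show "\<exists>p B. polybd B \<and> (\<forall>x. runs_at b p (enc x) (B (tsize (enc x))) (enc (f x, g x)))"
    by (intro exI conjI allI)
qed

lemma runs_at_if:
  assumes "runs_at (b+1) r x R (tree_of_bool P)"
    and "P \<Longrightarrow> runs_at b p x T y" "\<not> P \<Longrightarrow> runs_at b q x T y"
  shows "runs_at b (Seq (Assign (b+1) (Var b)) (Seq r (Cond (Var (b+1)) p q))) x
     (2 + tsize x + R + T) y"
  unfolding runs_at_def
proof (intro allI impI)
  fix S :: store assume S: "S b = x"
  let ?S1 = "S(b+1 := x)"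
  have 1: "exec (Assign (b+1) (Var b)) S (1 + tsize x) ?S1"
    using exec.Assign[of "b+1" "Var b" S] S by simp
  obtain t S2 where 2: "exec r ?S1 t S2" "S2 (b+1) = tree_of_bool P" "\<And>j. j < b+1 \<Longrightarrow> S2 j = ?S1 j" "t \<le> R"
    using runs_atE[OF assms(1), of ?S1] by (metis fun_upd_same)
  have "\<exists>u S'. exec (Cond (Var (b+1)) p q) S2 (1 + u) S' \<and> S' b = y \<and> (\<forall>j<b. S' j = S j) \<and> u \<le> T"
  proof (cases P)
    case True
    then obtain u S' where "exec p S2 u S'" "S' b = y" "\<And>j. j < b \<Longrightarrow> S' j = S2 j" "u \<le> T"
      using runs_atE[OF assms(2), of S2] 2(3)[of b] S by auto
    moreover have "aval (Var (b+1)) S2 \<noteq> Leaf" using 2 True by (simp add: tree_of_bool_def)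
    ultimately show ?thesis using 2 exec.CondTrue[of "Var (b+1)" S2 p u S' q]
      by (intro exI[of _ u] exI[of _ S']) auto
  next
    case False
    then obtain u S' where "exec q S2 u S'" "S' b = y" "\<And>j. j < b \<Longrightarrow> S' j = S2 j" "u \<le> T"
      using runs_atE[OF assms(3), of S2] 2(3)[of b] S by auto
    moreover have "aval (Var (b+1)) S2 = Leaf" using 2 False by (simp add: tree_of_bool_def)
    ultimately show ?thesis using 2 exec.CondFalse[of "Var (b+1)" S2 q u S' p]
      by (intro exI[of _ u] exI[of _ S']) auto
  qed
  then obtain u S' where 3: "exec (Cond (Var (b+1)) p q) S2 (1 + u) S'" "S' b = y"
    "\<forall>j<b. S' j = S j" "u \<le> T" by blast
  show "\<exists>t S'. exec (Seq (Assign (b+1) (Var b)) (Seq r (Cond (Var (b+1)) p q))) S t S' \<and> S' b = y \<and>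
    (\<forall>j<b. S' j = S j) \<and> t \<le> 2 + tsize x + R + T"
    by (rule exI, rule exI, rule conjI, (rule exec.Seq 1 2 3)+) (use 2 3 in auto)
qed

lemma pt_if:
  assumes "pt P" "pt f" "pt g"
  shows "pt (\<lambda>x. if P x then f x else g x)"
proof (rule ptI)
  fix b
  obtain r R where r: "polybd R" "\<And>x. runs_at (b+1) r (enc x) (R (tsize (enc x))) (enc (P x))"
    using assms(1) unfolding pt_def by blast
  obtain p B where p: "polybd B" "\<And>x. runs_at b p (enc x) (B (tsize (enc x))) (enc (f x))"
    using assms(2) unfolding pt_def by blast
  obtain q C where q: "polybd C" "\<And>x. runs_at b q (enc x) (C (tsize (enc x))) (enc (g x))"
    using assms(3) unfolding pt_def by blast
  let ?B = "\<lambda>n. 2 + n + R n + (B n + C n)"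
  have "runs_at b (Seq (Assign (b+1) (Var b)) (Seq r (Cond (Var (b+1)) p q))) (enc x) (?B (tsize (enc x)))
     (enc (if P x then f x else g x))" for x
    by (rule runs_at_if[OF r(2)[unfolded enc_bool_def]])
      (auto intro: runs_at_mono[OF p(2)] runs_at_mono[OF q(2)])
  moreover have "polybd ?B" by (intro polybd_intros p q r)
  ultimately show "\<exists>p B. polybd B \<and> (\<forall>x. runs_at b p (enc x) (B (tsize (enc x))) (enc (if P x then f x else g x)))"
    by (intro exI conjI allI)
qed

lemma pt_eq:
  assumes "pt f" "pt g"
  shows "pt (\<lambda>x. f x = g x)"
proof -
  have "pt (\<lambda>p :: 'b \<times> 'b. fst p = snd p)"
    by (rule pt_expr[where e = "\<lambda>b. Eq (Hd (Var b)) (Tl (Var b))" and B = "\<lambda>_. 3"])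
      (auto simp: enc_prod_def enc_bool_def tree_of_bool_def intro: polybd_intros)
  from pt_comp[OF this pt_pair[OF assms]] show ?thesis by simp
qed

lemma pt_fst: "pt f \<Longrightarrow> pt (\<lambda>x. fst (f x))"
  by (rule pt_comp[where f = fst], rule pt_expr[where e = "\<lambda>b. Hd (Var b)" and B = "\<lambda>n. n"])
    (auto simp: enc_prod_def intro: polybd_intros)

lemma pt_snd: "pt f \<Longrightarrow> pt (\<lambda>x. snd (f x))"
  by (rule pt_comp[where f = snd], rule pt_expr[where e = "\<lambda>b. Tl (Var b)" and B = "\<lambda>n. n"])
    (auto simp: enc_prod_def intro: polybd_intros)

lemma pt_Cons: "pt f \<Longrightarrow> pt g \<Longrightarrow> pt (\<lambda>x. f x # g x)"
  by (rule pt_coerce[OF pt_pair]) (auto simp: enc_prod_def)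

section \<open>Folds over lists as loops\<close>

lemma enc_tl: "enc (tl xs) = right (enc xs)"
  by (cases xs) auto

lemma tsize_right_le: "tsize (right t) \<le> tsize t"
  by (cases t) auto

lemma pt_tl: "pt f \<Longrightarrow> pt (\<lambda>x. tl (f x))"
  by (rule pt_comp[where f = tl], rule pt_expr[where e = "\<lambda>b. Tl (Var b)" and B = "\<lambda>n. n"])
    (simp_all add: enc_tl tsize_right_le polybd_id)

text \<open>Register layout: \<open>b\<close> holds the accumulator, \<open>b+1\<close> the context,
  \<open>b+2\<close> the rest of the list, and the step program \<open>r\<close> works at base
  \<open>b+3\<close>, so it preserves the other three. The rest of the list is itself the loop test,
  since only the empty list is \<open>Leaf\<close>.\<close>

definition fold_loop :: "nat \<Rightarrow> com \<Rightarrow> com" where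
  "fold_loop b r = While (Var (b+2))
     (Seq (Assign (b+3) (Pr (Var (b+1)) (Pr (Var b) (Hd (Var (b+2))))))
     (Seq r
     (Seq (Assign b (Var (b+3)))
          (Assign (b+2) (Tl (Var (b+2)))))))"

text \<open>Apart from the step, a round costs at most 6 + 5 * M: the test, an argument of size at
  most 3 * M + 2, the new accumulator and the shortened list.\<close>

lemma exec_fold_loop:
  fixes step :: "'x::enc \<Rightarrow> 's::enc \<Rightarrow> 'e::enc \<Rightarrow> 's"
  assumes r: "\<And>a e. runs_at (b+3) r (enc (x, a, e)) (c * (tsize (enc (x, a, e)) + 1) ^ c) (enc (step x a e))"
    and "S b = enc a" "S (b+1) = enc x" "S (b+2) = enc l"
    and "\<And>n. n \<le> length l \<Longrightarrow> tsize (enc (foldl (step x) a (take n l))) \<le> M"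
    and "tsize (enc x) \<le> M" "tsize (enc l) \<le> M"
  shows "\<exists>t S'. exec (fold_loop b r) S t S' \<and> S' b = enc (foldl (step x) a l) \<and> (\<forall>j<b. S' j = S j) \<and>
     t \<le> 1 + length l * (6 + 5 * M + c * (3 * M + 3) ^ c)"
  using assms(2-)
proof (induction l arbitrary: S a)
  case Nil
  then have "exec (fold_loop b r) S 1 S" unfolding fold_loop_def
    by (intro exec.WhileFalse) simp
  with Nil show ?case by (intro exI[of _ 1] exI[of _ S]) auto
next
  case (Cons e l)
  let ?p = "Seq (Assign (b+3) (Pr (Var (b+1)) (Pr (Var b) (Hd (Var (b+2))))))
     (Seq r (Seq (Assign b (Var (b+3))) (Assign (b+2) (Tl (Var (b+2))))))"
  let ?arg = "enc (x, a, e)" and ?a' = "step x a e"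
  have a: "tsize (enc a) \<le> M" using Cons.prems(4)[of 0] by simp
  have a': "tsize (enc ?a') \<le> M" using Cons.prems(4)[of 1] by simp
  have el: "tsize (enc e) + tsize (enc l) < M" using Cons.prems(6) by simp
  have arg: "tsize ?arg \<le> 3 * M + 2"
    using a el Cons.prems(5) by (simp add: enc_prod_def)
  let ?S1 = "S(b+3 := ?arg)"
  have 1: "exec (Assign (b+3) (Pr (Var (b+1)) (Pr (Var b) (Hd (Var (b+2)))))) S (1 + tsize ?arg) ?S1"
    using exec.Assign[of "b+3" "Pr (Var (b+1)) (Pr (Var b) (Hd (Var (b+2))))" S] Cons.prems
    by (simp add: enc_prod_def)
  obtain t S2 where 2: "exec r ?S1 t S2" "S2 (b+3) = enc ?a'" "\<And>j. j < b+3 \<Longrightarrow> S2 j = ?S1 j"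
      "t \<le> c * (tsize ?arg + 1) ^ c"
    using runs_atE[OF r[of a e], of ?S1] by (metis fun_upd_same)
  let ?S3 = "S2(b := enc ?a')"
  have 3: "exec (Assign b (Var (b+3))) S2 (1 + tsize (enc ?a')) ?S3"
    using exec.Assign[of b "Var (b+3)" S2] 2 by simp
  let ?S4 = "?S3(b+2 := enc l)"
  have 4: "exec (Assign (b+2) (Tl (Var (b+2)))) ?S3 (1 + tsize (enc l)) ?S4"
    using exec.Assign[of "b+2" "Tl (Var (b+2))" ?S3] 2(3)[of "b+2"] Cons.prems by simp
  have 5: "exec ?p S ((1 + tsize ?arg) + (t + ((1 + tsize (enc ?a')) + (1 + tsize (enc l))))) ?S4"
    by (rule exec.Seq[OF 1 exec.Seq[OF 2(1) exec.Seq[OF 3 4]]])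
  have "\<exists>u S'. exec (fold_loop b r) ?S4 u S' \<and> S' b = enc (foldl (step x) ?a' l) \<and> (\<forall>j<b. S' j = ?S4 j) \<and>
     u \<le> 1 + length l * (6 + 5 * M + c * (3 * M + 3) ^ c)"
  proof (rule Cons.IH)
    show "tsize (enc (foldl (step x) ?a' (take n l))) \<le> M" if "n \<le> length l" for n
      using Cons.prems(4)[of "Suc n"] that by simp
  qed (use Cons.prems 2 in auto)
  then obtain u S' where 6: "exec (fold_loop b r) ?S4 u S'" "S' b = enc (foldl (step x) ?a' l)"
    "\<forall>j<b. S' j = ?S4 j" "u \<le> 1 + length l * (6 + 5 * M + c * (3 * M + 3) ^ c)" by blast
  have "exec (fold_loop b r) S (1 + ((1 + tsize ?arg) + (t + ((1 + tsize (enc ?a')) + (1 + tsize (enc l))))) + u) S'"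
    unfolding fold_loop_def
    by (rule exec.WhileTrue[OF _ 5]) (use Cons.prems 6(1) in \<open>auto simp: fold_loop_def\<close>)
  moreover have "t \<le> c * (3 * M + 3) ^ c"
  proof -
    have "(tsize ?arg + 1) ^ c \<le> (3 * M + 3) ^ c" by (rule power_mono) (use arg in auto)
    then show ?thesis using 2(4) mult_le_mono2 le_trans by blast
  qed
  ultimately show ?case
    using 6 2(3) a' el arg
    by (intro exI[of _ "1 + ((1 + tsize ?arg) + (t + ((1 + tsize (enc ?a')) + (1 + tsize (enc l))))) + u"] exI[of _ S'])
      auto
qed

lemma length_le_tsize: "length l \<le> tsize (enc l)"
  by (induction l) auto

text \<open>The bound on all intermediate accumulators is essential: a cheap step that doubles its
  accumulator would reach exponential size.\<close>

lemma pt_foldl: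
  fixes step :: "'x::enc \<Rightarrow> 's::enc \<Rightarrow> 'e::enc \<Rightarrow> 's"
  assumes "pt (\<lambda>p. step (fst p) (fst (snd p)) (snd (snd p)))" "pt i" "pt l"
    and B: "polybd B" "\<And>x n. n \<le> length (l x) \<Longrightarrow> tsize (enc (foldl (step x) (i x) (take n (l x)))) \<le> B (tsize (enc x))"
  shows "pt (\<lambda>x. foldl (step x) (i x) (l x))"
proof (rule ptI)
  fix b
  obtain r c where r: "\<And>x a e. runs_at (b+3) r (enc (x, a, e)) (c * (tsize (enc (x, a, e)) + 1) ^ c) (enc (step x a e))"
    using ptE[OF assms(1), of "b+3"] by (metis fst_conv snd_conv)
  have "pt (\<lambda>x. (x, l x, i x))" by (intro pt_pair pt_id assms)
  then obtain p P where p: "polybd P" "\<And>x. runs_at b p (enc x) (P (tsize (enc x))) (enc (x, l x, i x))"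
    unfolding pt_def by blast
  obtain L where L: "polybd L" "\<And>x. tsize (enc (l x)) \<le> L (tsize (enc x))"
    using pt_size[OF assms(3)] by metis
  \<comment> \<open>The triple to be unpacked sits in \<open>b\<close>, so \<open>b\<close> is
    overwritten last.\<close>
  let ?q = "Seq (Assign (b+1) (Hd (Var b))) (Seq (Assign (b+2) (Hd (Tl (Var b)))) (Seq (Assign b (Tl (Tl (Var b)))) (fold_loop b r)))"
  let ?M = "\<lambda>n. n + L n + B n"
  let ?T = "\<lambda>n. 4 + 3 * ?M n + ?M n * (6 + 5 * ?M n + c * (3 * ?M n + 3) ^ c)"
  have q: "runs_at b ?q (enc (x, l x, i x)) (?T (tsize (enc x))) (enc (foldl (step x) (i x) (l x)))" for x
    unfolding runs_at_def
  proof (intro allI impI)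
    fix S :: store assume S: "S b = enc (x, l x, i x)"
    let ?S1 = "S(b+1 := enc x)"
    let ?S2 = "?S1(b+2 := enc (l x))"
    let ?S3 = "?S2(b := enc (i x))"
    let ?m = "?M (tsize (enc x))"
    have 1: "exec (Assign (b+1) (Hd (Var b))) S (1 + tsize (enc x)) ?S1"
      using exec.Assign[of "b+1" "Hd (Var b)" S] S by (simp add: enc_prod_def)
    have 2: "exec (Assign (b+2) (Hd (Tl (Var b)))) ?S1 (1 + tsize (enc (l x))) ?S2"
      using exec.Assign[of "b+2" "Hd (Tl (Var b))" ?S1] S by (simp add: enc_prod_def)
    have 3: "exec (Assign b (Tl (Tl (Var b)))) ?S2 (1 + tsize (enc (i x))) ?S3"
      using exec.Assign[of b "Tl (Tl (Var b))" ?S2] S by (simp add: enc_prod_def)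
    have i: "tsize (enc (i x)) \<le> ?m" using B(2)[of 0 x] by simp
    have "\<exists>t S'. exec (fold_loop b r) ?S3 t S' \<and> S' b = enc (foldl (step x) (i x) (l x)) \<and> (\<forall>j<b. S' j = ?S3 j) \<and>
      t \<le> 1 + length (l x) * (6 + 5 * ?m + c * (3 * ?m + 3) ^ c)"
      by (rule exec_fold_loop[OF r]) (use L(2)[of x] B(2)[of _ x] in \<open>auto intro: trans_le_add2\<close>)
    then obtain t S' where 4: "exec (fold_loop b r) ?S3 t S'" "S' b = enc (foldl (step x) (i x) (l x))"
      "\<forall>j<b. S' j = ?S3 j" "t \<le> 1 + length (l x) * (6 + 5 * ?m + c * (3 * ?m + 3) ^ c)" by blast
    have time: "t \<le> 1 + a \<Longrightarrow> a \<le> K \<Longrightarrow> X \<le> m \<Longrightarrow> Y \<le> m \<Longrightarrow> Z \<le> m \<Longrightarrow>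
      (1 + X) + ((1 + Y) + ((1 + Z) + t)) \<le> 4 + 3 * m + K" for t a K X Y Z m :: nat by simp
    have "length (l x) \<le> ?m" using length_le_tsize[of "l x"] L(2)[of x] by linarith
    then have "length (l x) * (6 + 5 * ?m + c * (3 * ?m + 3) ^ c) \<le> ?m * (6 + 5 * ?m + c * (3 * ?m + 3) ^ c)"
      by (rule mult_le_mono1)
    then have t: "(1 + tsize (enc x)) + ((1 + tsize (enc (l x))) + ((1 + tsize (enc (i x))) + t)) \<le> ?T (tsize (enc x))"
      by (intro time[OF 4(4) _ _ _ i]) (use L(2)[of x] in simp_all)
    show "\<exists>t S'. exec ?q S t S' \<and> S' b = enc (foldl (step x) (i x) (l x)) \<and> (\<forall>j<b. S' j = S j) \<and> t \<le> ?T (tsize (enc x))"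
      by (rule exI, rule exI, rule conjI, (rule exec.Seq 1 2 3 4(1))+) (use 4 t in auto)
  qed
  have "polybd (\<lambda>n. P n + ?T n)" by (intro polybd_intros p L B)
  moreover have "runs_at b (Seq p ?q) (enc x) (P (tsize (enc x)) + ?T (tsize (enc x))) (enc (foldl (step x) (i x) (l x)))" for x
    by (rule runs_at_comp[OF p(2) q])
  ultimately show "\<exists>p B. polybd B \<and> (\<forall>x. runs_at b p (enc x) (B (tsize (enc x))) (enc (foldl (step x) (i x) (l x))))"
    by (intro exI conjI allI)
qed

section \<open>List functions obtained from folds\<close>

lemma tsize_enc_list: "tsize (enc l) = Suc (sum_list (map (\<lambda>e. Suc (tsize (enc e))) l))"
  by (induction l) auto

lemma foldl_Cons: "foldl (\<lambda>a e. f e # a) i l = rev (map f l) @ i"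
  by (induction l arbitrary: i) auto

lemma tsize_enc_append: "tsize (enc (xs @ ys)) + 1 = tsize (enc xs) + tsize (enc ys)"
  by (induction xs) auto

lemma tsize_enc_rev: "tsize (enc (rev l)) = tsize (enc l)"
  by (simp add: tsize_enc_list rev_map[symmetric])

lemma tsize_enc_take: "tsize (enc (take n l)) \<le> tsize (enc l)"
  using tsize_enc_append[of "take n l" "drop n l"] tsize_ge_1[of "enc (drop n l)"] by simp

lemma pt_revapp: "pt f \<Longrightarrow> pt g \<Longrightarrow> pt (\<lambda>x. rev (f x) @ g x)"
proof -
  assume f: "pt f" and g: "pt g"
  obtain F where F: "polybd F" "\<And>x. tsize (enc (f x)) \<le> F (tsize (enc x))"
    using pt_size[OF f] by metis
  obtain G where G: "polybd G" "\<And>x. tsize (enc (g x)) \<le> G (tsize (enc x))"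
    using pt_size[OF g] by metis
  have "pt (\<lambda>x. foldl (\<lambda>a e. e # a) (g x) (f x))"
  proof (rule pt_foldl[OF _ g f])
    show "pt (\<lambda>p. snd (snd p) # fst (snd p))" by (intro pt_Cons pt_fst pt_snd pt_id)
    show "polybd (\<lambda>n. F n + G n)" by (intro polybd_intros F G)
    show "tsize (enc (foldl (\<lambda>a e. e # a) (g x) (take n (f x)))) \<le> F (tsize (enc x)) + G (tsize (enc x))" for x n
      using tsize_enc_append[of "rev (take n (f x))" "g x"] tsize_enc_take[of n "f x"] F(2)[of x] G(2)[of x]
      by (simp add: foldl_Cons[of "\<lambda>e. e"] tsize_enc_rev)
  qed
  then show ?thesis by (simp add: foldl_Cons[of "\<lambda>e. e"])
qed

lemma pt_rev: "pt f \<Longrightarrow> pt (\<lambda>x. rev (f x))"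
  using pt_revapp[of f "\<lambda>_. []"] pt_const[of "[]"] by simp

lemma pt_append: "pt f \<Longrightarrow> pt g \<Longrightarrow> pt (\<lambda>x. f x @ g x)"
  using pt_revapp[OF pt_rev, of f g] by simp

lemma tsize_enc_map_le:
  assumes "\<And>e. e \<in> set l \<Longrightarrow> tsize (enc (f e)) \<le> M"
  shows "tsize (enc (map f l)) \<le> 1 + length l * (1 + M)"
  using assms by (induction l) fastforce+

lemma elem_size: "e \<in> set l \<Longrightarrow> tsize (enc e) \<le> tsize (enc l)"
  by (induction l) auto

text \<open>The language has no closures, so the function on elements receives the whole input
  \<open>x\<close> as its first argument. The fold builds the image in reverse order, which a final
  \<open>rev\<close> repairs.\<close>

lemma pt_map:
  assumes f: "pt (\<lambda>p. f (fst p) (snd p))" and l: "pt l"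
  shows "pt (\<lambda>x. map (f x) (l x))"
proof -
  obtain F where F: "polybd F" "\<And>p. tsize (enc (f (fst p) (snd p))) \<le> F (tsize (enc p))" "mono F"
    using pt_size[OF f] by metis
  obtain L where L: "polybd L" "\<And>x. tsize (enc (l x)) \<le> L (tsize (enc x))"
    using pt_size[OF l] by metis
  let ?B = "\<lambda>n. 1 + L n * (1 + F (1 + n + L n))"
  have "pt (\<lambda>x. foldl (\<lambda>a e. f x e # a) [] (l x))"
  proof (rule pt_foldl[OF _ pt_const l])
    show "pt (\<lambda>p. f (fst p) (snd (snd p)) # fst (snd p))"
      using pt_comp[OF f, of "\<lambda>p. (fst p, snd (snd p))"]
      by (intro pt_Cons pt_fst pt_snd pt_id) (simp add: pt_pair pt_fst pt_snd pt_id)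
    show "polybd ?B" by (intro polybd_intros L polybd_comp[OF F(1)])
    show "tsize (enc (foldl (\<lambda>a e. f x e # a) [] (take n (l x)))) \<le> ?B (tsize (enc x))" for x n
    proof -
      let ?t = "take n (l x)"
      have "tsize (enc (map (f x) ?t)) \<le> 1 + length ?t * (1 + F (1 + tsize (enc x) + L (tsize (enc x))))"
      proof (rule tsize_enc_map_le)
        fix e assume "e \<in> set ?t"
        then have "tsize (enc e) \<le> L (tsize (enc x))"
          using elem_size[OF in_set_takeD] L(2)[of x] le_trans by blast
        then have *: "tsize (enc (x, e)) \<le> 1 + tsize (enc x) + L (tsize (enc x))"
          by (simp add: enc_prod_def)
        from monoD[OF F(3) this] show "tsize (enc (f x e)) \<le> F (1 + tsize (enc x) + L (tsize (enc x)))"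
          using F(2)[of "(x, e)"] by simp
      qed
      also have "\<dots> \<le> ?B (tsize (enc x))"
        using length_le_tsize[of "l x"] L(2)[of x] by (intro add_left_mono mult_le_mono1) simp
      finally show ?thesis by (simp add: foldl_Cons[of "f x"] tsize_enc_rev)
    qed
  qed
  from pt_rev[OF this] show ?thesis by (simp add: foldl_Cons)
qed

lemma tsize_enc_concat: "tsize (enc (concat l)) \<le> tsize (enc l)"
proof (induction l)
  case (Cons a l)
  then show ?case using tsize_enc_append[of a "concat l"] by simp
qed simp

lemma foldl_append: "foldl (@) i l = i @ concat l"
  by (induction l arbitrary: i) auto

lemma pt_concat: "pt f \<Longrightarrow> pt (\<lambda>x. concat (f x))"
proof -
  assume f: "pt f"
  obtain F where F: "polybd F" "\<And>x. tsize (enc (f x)) \<le> F (tsize (enc x))"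
    using pt_size[OF f] by metis
  have "pt (\<lambda>x. foldl (@) [] (f x))"
  proof (rule pt_foldl[OF _ pt_const f])
    show "pt (\<lambda>p. fst (snd p) @ snd (snd p))" by (intro pt_append pt_fst pt_snd pt_id)
    show "polybd F" by (rule F)
    show "tsize (enc (foldl (@) [] (take n (f x)))) \<le> F (tsize (enc x))" for x n
      using tsize_enc_concat[of "take n (f x)"] tsize_enc_take[of n "f x"] F(2)[of x]
      by (simp add: foldl_append)
  qed
  then show ?thesis by (simp add: foldl_append)
qed

lemma pt_bool_not: "pt P \<Longrightarrow> pt (\<lambda>x. \<not> P x)"
  using pt_eq[OF _ pt_const[of False], of P] by simp

lemma pt_conj: "pt P \<Longrightarrow> pt Q \<Longrightarrow> pt (\<lambda>x. P x \<and> Q x)"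
proof -
  assume "pt P" "pt Q"
  then have "pt (\<lambda>x. if P x then Q x else False)" by (intro pt_if pt_const)
  moreover have "(\<lambda>x. if P x then Q x else False) = (\<lambda>x. P x \<and> Q x)" by auto
  ultimately show ?thesis by simp
qed

lemma pt_imp: "pt P \<Longrightarrow> pt Q \<Longrightarrow> pt (\<lambda>x. P x \<longrightarrow> Q x)"
proof -
  assume "pt P" "pt Q"
  then have "pt (\<lambda>x. if P x then Q x else True)" by (intro pt_if pt_const)
  moreover have "(\<lambda>x. if P x then Q x else True) = (\<lambda>x. P x \<longrightarrow> Q x)" by auto
  ultimately show ?thesis by simp
qed

lemma pt_filter:
  assumes P: "pt (\<lambda>p. P (fst p) (snd p))" and l: "pt l"
  shows "pt (\<lambda>x. filter (P x) (l x))"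
proof -
  have "pt (\<lambda>x. concat (map (\<lambda>e. if P x e then [e] else []) (l x)))"
    by (intro pt_concat pt_map pt_if P l pt_Cons pt_const pt_snd pt_id)
  moreover have "concat (map (\<lambda>e. if Q e then [e] else []) l) = filter Q l" for l :: "'b list" and Q
    by (induction l) auto
  ultimately show ?thesis by simp
qed

lemma pt_ball:
  assumes P: "pt (\<lambda>p. P (fst p) (snd p))" and l: "pt l"
  shows "pt (\<lambda>x. \<forall>e\<in>set (l x). P x e)"
proof -
  have "pt (\<lambda>x. filter (\<lambda>e. \<not> P x e) (l x) = [])"
    by (intro pt_eq pt_filter pt_bool_not P l pt_const)
  then show ?thesis by (simp add: filter_empty_conv)
qed

text \<open>A number is encoded like a list of leaves of that length.\<close>

lemma enc_replicate_Leaf: "enc (replicate n Leaf) = enc n"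
  by (induction n) (auto simp: enc_simps)

lemma pt_of_nat_list: "pt f \<Longrightarrow> pt (\<lambda>x. replicate (f x) Leaf)"
  by (erule pt_coerce) (rule enc_replicate_Leaf)

lemma pt_nat_of_list: "pt (\<lambda>x. replicate (f x) Leaf) \<Longrightarrow> pt f"
  by (erule pt_coerce) (rule enc_replicate_Leaf[symmetric])

lemma tsize_enc_nat: "tsize (enc (n::nat)) = 2 * n + 1"
  by (induction n) (auto simp: enc_nat_def)

lemma pt_length: "pt f \<Longrightarrow> pt (\<lambda>x. length (f x))"
proof (rule pt_nat_of_list)
  assume "pt f"
  then have "pt (\<lambda>x. map (\<lambda>_. Leaf) (f x))" by (intro pt_map pt_const)
  then show "pt (\<lambda>x. replicate (length (f x)) Leaf)" by (simp add: map_replicate_const)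
qed

lemma pt_add: "pt f \<Longrightarrow> pt g \<Longrightarrow> pt (\<lambda>x. f x + g x :: nat)"
  by (rule pt_nat_of_list) (simp add: replicate_add pt_append pt_of_nat_list)

lemma pt_Suc: "pt f \<Longrightarrow> pt (\<lambda>x. Suc (f x))"
  using pt_add[OF pt_const[of 1], of f] by simp

lemma pt_sum_list: "pt f \<Longrightarrow> pt (\<lambda>x. sum_list (f x) :: nat)"
proof (rule pt_nat_of_list)
  assume "pt f"
  then have "pt (\<lambda>x. concat (map (\<lambda>n. replicate n Leaf) (f x)))"
    by (intro pt_concat pt_map pt_of_nat_list pt_snd pt_id)
  moreover have "concat (map (\<lambda>n. replicate n Leaf) l) = replicate (sum_list l) Leaf" for l
    by (induction l) (auto simp: replicate_add)
  ultimately show "pt (\<lambda>x. replicate (sum_list (f x)) Leaf)" by simp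
qed

lemma pt_mult: "pt f \<Longrightarrow> pt g \<Longrightarrow> pt (\<lambda>x. f x * g x :: nat)"
proof -
  assume "pt f" "pt g"
  then have "pt (\<lambda>x. sum_list (map (\<lambda>_. g x) (replicate (f x) Leaf)))"
    by (intro pt_sum_list pt_map pt_of_nat_list pt_comp[of g fst] pt_fst pt_id)
  then show ?thesis by (simp add: map_replicate_const sum_list_replicate)
qed

lemma pt_power: "pt f \<Longrightarrow> pt (\<lambda>x. f x ^ k :: nat)"
  by (induction k) (auto intro: pt_const pt_mult)

lemma foldl_tl: "foldl (\<lambda>a _. tl a) l (replicate n c) = drop n l"
  by (induction n arbitrary: l) (auto simp: drop_Suc)

lemma tsize_enc_drop: "tsize (enc (drop n l)) \<le> tsize (enc l)"
  using tsize_enc_append[of "take n l" "drop n l"] tsize_ge_1[of "enc (take n l)"] by simp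

text \<open>A unary number is a list to loop over: one \<open>tl\<close> is executed per
  leaf.\<close>

lemma pt_drop: "pt f \<Longrightarrow> pt g \<Longrightarrow> pt (\<lambda>x. drop (f x) (g x))"
proof -
  assume f: "pt f" and g: "pt g"
  obtain G where G: "polybd G" "\<And>x. tsize (enc (g x)) \<le> G (tsize (enc x))"
    using pt_size[OF g] by metis
  have "pt (\<lambda>x. foldl (\<lambda>a _. tl a) (g x) (replicate (f x) Leaf))"
  proof (rule pt_foldl[OF _ g pt_of_nat_list[OF f] G(1)])
    show "pt (\<lambda>p. tl (fst (snd p)))" by (intro pt_tl pt_fst pt_snd pt_id)
    show "tsize (enc (foldl (\<lambda>a _. tl a) (g x) (take n (replicate (f x) Leaf)))) \<le> G (tsize (enc x))" for x n
      using tsize_enc_drop[of "min n (f x)" "g x"] G(2)[of x] by (simp add: take_replicate foldl_tl)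
  qed
  then show ?thesis by (simp add: foldl_tl)
qed

lemma pt_diff: "pt f \<Longrightarrow> pt g \<Longrightarrow> pt (\<lambda>x. f x - g x :: nat)"
  using pt_length[OF pt_drop[OF _ pt_of_nat_list], of g f] by simp

lemma pt_le: "pt f \<Longrightarrow> pt g \<Longrightarrow> pt (\<lambda>x. f x \<le> (g x :: nat))"
  using pt_eq[OF pt_diff pt_const[of 0], of f g] by simp

lemma pt_less: "pt f \<Longrightarrow> pt g \<Longrightarrow> pt (\<lambda>x. f x < (g x :: nat))"
  using pt_bool_not[OF pt_le, of g f] by (simp add: not_le)

lemma pt_min: "pt f \<Longrightarrow> pt g \<Longrightarrow> pt (\<lambda>x. min (f x) (g x) :: nat)"
  unfolding min_def by (intro pt_if pt_le)

text \<open>The length of the accumulator is the next number to append, so no separate counter is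
  kept.\<close>

lemma foldl_upt: "foldl (\<lambda>a _. a @ [length a]) [] (replicate n c) = [0..<n]"
proof (induction n)
  case (Suc n)
  show ?case unfolding replicate_Suc replicate_app_Cons_same[symmetric] foldl_append
    using Suc by (simp add: replicate_append_same[symmetric] del: replicate_Suc)
qed simp

lemma pt_upt: "pt f \<Longrightarrow> pt (\<lambda>x. [0..<f x])"
proof -
  assume f: "pt f"
  obtain F where F: "polybd F" "\<And>x. tsize (enc (f x)) \<le> F (tsize (enc x))"
    using pt_size[OF f] by metis
  have "pt (\<lambda>x. foldl (\<lambda>a _. a @ [length a]) [] (replicate (f x) Leaf))"
  proof (rule pt_foldl[OF _ pt_const pt_of_nat_list[OF f]])
    show "pt (\<lambda>p. fst (snd p) @ [length (fst (snd p))])"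
      by (intro pt_append pt_Cons pt_length pt_const pt_fst pt_snd pt_id)
    show "polybd (\<lambda>n. 1 + F n * (1 + F n))" by (intro polybd_intros F)
    show "tsize (enc (foldl (\<lambda>a _. a @ [length a]) [] (take n (replicate (f x) Leaf))))
      \<le> 1 + F (tsize (enc x)) * (1 + F (tsize (enc x)))" for x n
    proof -
      let ?m = "min n (f x)"
      have fx: "2 * f x \<le> F (tsize (enc x))" using F(2)[of x] by (simp add: tsize_enc_nat)
      have "tsize (enc (map (\<lambda>e. e) [0..<?m])) \<le> 1 + length [0..<?m] * (1 + F (tsize (enc x)))"
        by (rule tsize_enc_map_le) (use F(2)[of x] in \<open>auto simp: tsize_enc_nat\<close>)
      also have "\<dots> \<le> 1 + F (tsize (enc x)) * (1 + F (tsize (enc x)))"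
        using fx by (intro add_left_mono mult_le_mono1) auto
      finally show ?thesis by (simp add: take_replicate foldl_upt)
    qed
  qed
  then show ?thesis by (simp add: foldl_upt)
qed

text \<open>The explicit default makes list access total; the values of \<open>nth\<close> beyond
  the end are unspecified, so no program for them could be exhibited.\<close>

definition hdd :: "'a \<Rightarrow> 'a list \<Rightarrow> 'a" where
  "hdd d l = (case l of [] \<Rightarrow> d | y # _ \<Rightarrow> y)"

lemma hdd_simps [simp]: "hdd d [] = d" "hdd d (y # l) = y"
  by (simp_all add: hdd_def)

lemma pt_hdd: "pt d \<Longrightarrow> pt l \<Longrightarrow> pt (\<lambda>x. hdd (d x) (l x))"
proof -
  assume d: "pt d" and l: "pt l"
  have *: "pt (\<lambda>p. hdd (fst p) (snd p) :: 'b)"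
  proof (rule ptI)
    fix b
    \<comment> \<open>The encoded list is \<open>Leaf\<close> exactly when it is empty, so it serves
      as the test itself.\<close>
    let ?q = "Cond (Tl (Var b)) (Assign b (Hd (Tl (Var b)))) (Assign b (Hd (Var b)))"
    have "runs_at b ?q (enc p) (2 + tsize (enc p)) (enc (hdd (fst p) (snd p)))" for p :: "'b \<times> 'b list"
      unfolding runs_at_def
    proof (intro allI impI)
      fix S :: store assume S: "S b = enc p"
      show "\<exists>t S'. exec ?q S t S' \<and> S' b = enc (hdd (fst p) (snd p)) \<and> (\<forall>j<b. S' j = S j) \<and> t \<le> 2 + tsize (enc p)"
      proof (cases "snd p")
        case Nil
        have e: "exec ?q S (1 + (1 + tsize (aval (Hd (Var b)) S))) (S(b := aval (Hd (Var b)) S))"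
          by (rule exec.CondFalse[OF _ exec.Assign]) (use S Nil in \<open>simp add: enc_prod_def\<close>)
        show ?thesis by (rule exI, rule exI, rule conjI, rule e) (use S Nil in \<open>auto simp: enc_prod_def\<close>)
      next
        case (Cons y ys)
        have e: "exec ?q S (1 + (1 + tsize (aval (Hd (Tl (Var b))) S))) (S(b := aval (Hd (Tl (Var b))) S))"
          by (rule exec.CondTrue[OF _ exec.Assign]) (use S Cons in \<open>simp add: enc_prod_def\<close>)
        show ?thesis by (rule exI, rule exI, rule conjI, rule e) (use S Cons in \<open>auto simp: enc_prod_def\<close>)
      qed
    qed
    moreover have "polybd (\<lambda>n. 2 + n)" by (intro polybd_intros)
    ultimately show "\<exists>q B. polybd B \<and> (\<forall>p :: 'b \<times> 'b list. runs_at b q (enc p) (B (tsize (enc p))) (enc (hdd (fst p) (snd p))))"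
      by (intro exI conjI allI)
  qed
  from pt_comp[OF this pt_pair[OF d l]] show ?thesis by simp
qed

definition nthd :: "'a \<Rightarrow> 'a list \<Rightarrow> nat \<Rightarrow> 'a" where
  "nthd d l i = hdd d (drop i l)"

lemma nthd_nth: "i < length l \<Longrightarrow> nthd d l i = l ! i"
  by (simp add: nthd_def Cons_nth_drop_Suc[symmetric])

lemma pt_nthd: "pt d \<Longrightarrow> pt l \<Longrightarrow> pt i \<Longrightarrow> pt (\<lambda>x. nthd (d x) (l x) (i x))"
  unfolding nthd_def by (intro pt_hdd pt_drop)


section \<open>Decoding of trees, numbers and gates\<close>

lemma pt_enc: "pt f \<Longrightarrow> pt (\<lambda>x. enc (f x))"
  by (erule pt_coerce) (simp add: enc_tree_def)

lemma pt_left: "pt f \<Longrightarrow> pt (\<lambda>x. left (f x))"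
proof (rule pt_comp[where f = left], rule pt_expr[where e = "\<lambda>b. Hd (Var b)" and B = "\<lambda>n. n"])
  show "tsize (enc (left t)) \<le> tsize (enc t)" for t by (cases t) (auto simp: enc_tree_def)
qed (auto simp: enc_tree_def polybd_id)

lemma pt_right: "pt f \<Longrightarrow> pt (\<lambda>x. right (f x))"
  by (rule pt_comp[where f = right], rule pt_expr[where e = "\<lambda>b. Tl (Var b)" and B = "\<lambda>n. n"])
    (auto simp: enc_tree_def polybd_id tsize_right_le)

text \<open>Every tree encodes the list of left subtrees along its right spine. An arbitrary input
  can therefore be read as a list at no cost and without a validity check.\<close>

fun spine :: "tree \<Rightarrow> tree list" where
  "spine Leaf = []"
| "spine (Node a b) = a # spine b"

lemma enc_spine: "enc (spine t) = t"
  by (induction t) (auto simp: enc_tree_def)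

lemma pt_spine: "pt f \<Longrightarrow> pt (\<lambda>x. spine (f x))"
  by (erule pt_coerce) (simp add: enc_spine enc_tree_def)

text \<open>The numbers are those of \<open>enc_gate\<close>, so the tag is the left subtree of the
  encoded gate.\<close>

fun tag :: "gate \<Rightarrow> nat" where
  "tag Input = 0"
| "tag (Neg j) = 1"
| "tag (And js) = 2"
| "tag (Or js) = 3"

lemma pt_tag: "pt f \<Longrightarrow> pt (\<lambda>x. tag (f x))"
proof (rule pt_coerce[OF pt_left[OF pt_enc]])
  show "enc (tag (f x)) = enc (left (enc (f x)))" for x
    by (cases "f x") (auto simp: enc_nat_def enc_gate_def enc_tree_def)
qed

lemma pt_Neg: "pt f \<Longrightarrow> pt (\<lambda>x. Neg (f x))"
  by (rule pt_coerce[OF pt_pair[OF pt_const[of "1::nat"]]], assumption) (simp_all add: enc_prod_def enc_nat_def enc_gate_def)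

lemma enc_nat_list: "enc_list enc_unary = enc"
  by (rule ext) (simp add: enc_list_def enc_nat_def[abs_def])

lemma pt_And: "pt f \<Longrightarrow> pt (\<lambda>x. And (f x))"
  by (rule pt_coerce[OF pt_pair[OF pt_const[of "2::nat"]]], assumption)
    (simp_all add: enc_prod_def enc_nat_def enc_gate_def enc_nat_list)

lemma pt_Or: "pt f \<Longrightarrow> pt (\<lambda>x. Or (f x))"
  by (rule pt_coerce[OF pt_pair[OF pt_const[of "3::nat"]]], assumption)
    (simp_all add: enc_prod_def enc_nat_def enc_gate_def enc_nat_list)

definition unary_of :: "tree \<Rightarrow> nat" where
  "unary_of t = length (spine t)"

lemma unary_of_simps [simp]: "unary_of Leaf = 0" "unary_of (Node a b) = Suc (unary_of b)"
  by (simp_all add: unary_of_def)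

lemma unary_of_enc [simp]: "unary_of (enc_unary n) = n"
  by (induction n) auto

lemma pt_unary_of: "pt f \<Longrightarrow> pt (\<lambda>x. unary_of (f x))"
  unfolding unary_of_def by (intro pt_length pt_spine)

lemma spine_enc_list: "spine (enc_list f l) = map f l"
  by (induction l) auto

text \<open>\<open>Neg\<close> stores a single number where \<open>And\<close> and \<open>Or\<close>
  store a list, hence the case distinction; the \<open>Leaf\<close> stored by \<open>Input\<close>
  reads as the empty list.\<close>

lemma preds_decode:
  "preds g = (if tag g = 1 then [unary_of (right (enc g))] else map unary_of (spine (right (enc g))))"
  by (cases g) (auto simp: enc_gate_def spine_enc_list comp_def)

lemma pt_preds: "pt f \<Longrightarrow> pt (\<lambda>x. preds (f x))"
  unfolding preds_decode
  by (intro pt_if pt_eq pt_tag pt_Cons pt_map pt_unary_of pt_spine pt_right pt_enc pt_const pt_snd pt_id)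

text \<open>A total decoder that turns malformed trees into some gate. They are detected later by
  encoding the result again and comparing, see \<open>input_ok\<close>.\<close>

definition gate_of :: "tree \<Rightarrow> gate" where
  "gate_of t = (let c = unary_of (left t) in
     if c = 0 then Input
     else if c = 1 then Neg (unary_of (right t))
     else if c = 2 then And (map unary_of (spine (right t)))
     else Or (map unary_of (spine (right t))))"

lemma gate_of_enc [simp]: "gate_of (enc_gate g) = g"
  by (cases g) (auto simp: gate_of_def spine_enc_list comp_def)

lemma pt_gate_of: "pt f \<Longrightarrow> pt (\<lambda>x. gate_of (f x))"
  unfolding gate_of_def Let_def
  by (intro pt_if pt_eq pt_Neg pt_And pt_Or pt_map pt_unary_of pt_spine pt_right pt_left pt_const pt_snd pt_id)

text \<open>The two components are the halves rounded down and up. One more unit makes the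
  rounded-up half the new lower one, and the old lower half plus one the new upper one.\<close>

lemma foldl_half:
  "foldl (\<lambda>a _. (snd a, Suc (fst a))) (0, 0) (replicate n c) = (n div 2, Suc n div 2)"
proof (induction n)
  case (Suc n)
  show ?case unfolding replicate_Suc replicate_append_same[symmetric] List.foldl_append
    by (simp add: Suc)
qed simp

lemma pt_half: "pt f \<Longrightarrow> pt (\<lambda>x. f x div 2 :: nat)"
proof -
  assume f: "pt f"
  obtain F where F: "polybd F" "\<And>x. tsize (enc (f x)) \<le> F (tsize (enc x))"
    using pt_size[OF f] by metis
  have "pt (\<lambda>x. foldl (\<lambda>a _. (snd a, Suc (fst a))) (0, 0) (replicate (f x) Leaf))"
  proof (rule pt_foldl[OF _ pt_const pt_of_nat_list[OF f]])
    show "pt (\<lambda>p. (snd (fst (snd p)), Suc (fst (fst (snd p)))))"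
      by (intro pt_pair pt_Suc pt_fst pt_snd pt_id)
    show "polybd (\<lambda>n. 5 + 2 * F n)" by (intro polybd_intros F)
    show "tsize (enc (foldl (\<lambda>a _. (snd a, Suc (fst a))) (0, 0) (take n (replicate (f x) Leaf))))
      \<le> 5 + 2 * F (tsize (enc x))" for x n
      using F(2)[of x] by (simp add: take_replicate foldl_half enc_prod_def tsize_enc_nat)
  qed
  from pt_fst[OF this] show ?thesis by (simp add: foldl_half)
qed

lemma pt_odd: "pt f \<Longrightarrow> pt (\<lambda>x. odd (f x :: nat))"
proof -
  assume "pt f"
  then have "pt (\<lambda>x. f x div 2 + f x div 2 \<noteq> f x)" by (intro pt_bool_not pt_eq pt_add pt_half)
  moreover have "n div 2 + n div 2 \<noteq> n \<longleftrightarrow> odd n" for n :: nat by presburger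
  ultimately show ?thesis by simp
qed

text \<open>The loop runs as many rounds as the number has units, far more than it has bits, so a
  step must be idle once the number is 0.\<close>

definition bit_step :: "nat \<times> bool list \<Rightarrow> nat \<times> bool list" where
  "bit_step a = (if fst a = 0 then a else (fst a div 2, odd (fst a) # snd a))"

text \<open>Loop invariant: the bits collected so far, followed by those of the remaining number,
  never change. The second part shows that nothing remains after \<open>m\<close> rounds, the third
  bounds the accumulator.\<close>

lemma foldl_bit_step:
  fixes m :: nat and c :: 'c
  defines "r \<equiv> \<lambda>j m acc. foldl (\<lambda>a _. bit_step a) (m, acc) (replicate j c)"
  shows "rev (snd (r j m acc)) @ bits (fst (r j m acc)) = rev acc @ bits m \<and>
     fst (r j m acc) \<le> m - j \<and> length (snd (r j m acc)) \<le> length acc + j"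
proof (induction j arbitrary: m acc)
  case 0
  then show ?case by (simp add: r_def)
next
  case (Suc j)
  have *: "r (Suc j) m acc = (if m = 0 then r j m acc else r j (m div 2) (odd m # acc))"
    by (simp add: r_def bit_step_def)
  show ?case
  proof (cases "m = 0")
    case True
    then show ?thesis using Suc[of m acc] * bits.simps[of 0] by auto
  next
    case False
    then show ?thesis using Suc[of "m div 2" "odd m # acc"] bits.simps[of m] by (auto simp: *)
  qed
qed

lemma pt_bits: "pt f \<Longrightarrow> pt (\<lambda>x. bits (f x))"
proof -
  assume f: "pt f"
  obtain F where F: "polybd F" "\<And>x. tsize (enc (f x)) \<le> F (tsize (enc x))"
    using pt_size[OF f] by metis
  let ?r = "\<lambda>x. foldl (\<lambda>a _. bit_step a) (f x, []) (replicate (f x) Leaf)"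
  have "pt ?r"
  proof (rule pt_foldl[OF _ pt_pair[OF f pt_const] pt_of_nat_list[OF f]])
    show "pt (\<lambda>p. bit_step (fst (snd p)))"
      unfolding bit_step_def by (intro pt_if pt_eq pt_pair pt_half pt_Cons pt_odd pt_fst pt_snd pt_id pt_const)
    show "polybd (\<lambda>n. 2 + F n + F n * 4)" by (intro polybd_intros F)
    show "tsize (enc (foldl (\<lambda>a _. bit_step a) (f x, []) (take n (replicate (f x) Leaf))))
      \<le> 2 + F (tsize (enc x)) + F (tsize (enc x)) * 4" for x n
    proof -
      let ?j = "min n (f x)"
      let ?s = "foldl (\<lambda>a _. bit_step a) (f x, []) (replicate ?j Leaf)"
      have s: "fst ?s \<le> f x" "length (snd ?s) \<le> f x"
        using foldl_bit_step[where j = ?j and c = Leaf and m = "f x" and acc = "[]"] by auto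
      have "tsize (enc (map (\<lambda>b. b) (snd ?s))) \<le> 1 + length (snd ?s) * (1 + 3)"
        by (rule tsize_enc_map_le) (auto simp: enc_bool_def tree_of_bool_def)
      then have "tsize (enc ?s) \<le> 2 + tsize (enc (f x)) + f x * 4"
        using s by (simp add: enc_prod_def tsize_enc_nat)
      then show ?thesis using F(2)[of x] by (simp add: take_replicate tsize_enc_nat)
    qed
  qed
  then have "pt (\<lambda>x. rev (snd (?r x)))" by (intro pt_rev pt_snd)
  moreover have "rev (snd (foldl (\<lambda>a _. bit_step a) (n, []) (replicate n Leaf))) = bits n" for n
    using foldl_bit_step[where j = n and c = Leaf and m = n and acc = "[]"] bits.simps[of 0] by auto
  ultimately show ?thesis by simp
qed

lemma enc_binary_eq: "enc_binary n = enc (bits n)"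
  by (simp add: enc_binary_def enc_list_def enc_bool_def[abs_def])

lemmas pt_intros =
  pt_const pt_id pt_pair pt_if pt_eq pt_fst pt_snd pt_Cons pt_tl pt_rev pt_append pt_map pt_concat
  pt_bool_not pt_conj pt_imp pt_filter pt_ball pt_length pt_add pt_Suc pt_sum_list pt_mult pt_power
  pt_drop pt_diff pt_le pt_less pt_min pt_upt pt_hdd pt_nthd pt_enc pt_left pt_right pt_spine pt_tag
  pt_preds pt_unary_of pt_gate_of pt_bits

section \<open>Composing an fpt-reduction with a polynomial-time reduction\<close>

fun expr_bound :: "expr \<Rightarrow> nat" where
  "expr_bound (Var i) = Suc i"
| "expr_bound (Lit t) = 0"
| "expr_bound (Pr a b) = max (expr_bound a) (expr_bound b)"
| "expr_bound (Hd a) = expr_bound a"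
| "expr_bound (Tl a) = expr_bound a"
| "expr_bound (Eq a b) = max (expr_bound a) (expr_bound b)"

fun com_bound :: "com \<Rightarrow> nat" where
  "com_bound (Assign i a) = max (Suc i) (expr_bound a)"
| "com_bound (Seq p q) = max (com_bound p) (com_bound q)"
| "com_bound (Cond a p q) = max (expr_bound a) (max (com_bound p) (com_bound q))"
| "com_bound (While a p) = max (expr_bound a) (com_bound p)"

lemma aval_frame: "expr_bound a \<le> n \<Longrightarrow> aval a (s(n := v)) = aval a s"
  by (induction a) auto

lemma exec_frame:
  "exec p s t s' \<Longrightarrow> com_bound p \<le> n \<Longrightarrow> exec p (s(n := v)) t (s'(n := v))"
proof (induction rule: exec.induct)
  case (Assign i a s)
  have "s(n := v, i := aval a s) = s(i := aval a s, n := v)"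
    using Assign by (intro fun_upd_twist) simp
  then show ?case using exec.Assign[of i a "s(n := v)"] Assign by (simp add: aval_frame del: fun_upd_apply)
next
  case (Seq p s t s' q u s'')
  then show ?case by (auto intro: exec.Seq)
next
  case (CondTrue a s p t s' q)
  then show ?case using exec.CondTrue[of a "s(n := v)" p t "s'(n := v)" q]
    by (simp add: aval_frame del: fun_upd_apply)
next
  case (CondFalse a s q t s' p)
  then show ?case using exec.CondFalse[of a "s(n := v)" q t "s'(n := v)" p]
    by (simp add: aval_frame del: fun_upd_apply)
next
  case (WhileTrue a s p t s' u s'')
  then show ?case using exec.WhileTrue[of a "s(n := v)" p t "s'(n := v)" u "s''(n := v)"]
    by (simp add: aval_frame del: fun_upd_apply)
next
  case (WhileFalse a s p)
  then show ?case using exec.WhileFalse[of a "s(n := v)" p]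
    by (simp add: aval_frame del: fun_upd_apply)
qed

text \<open>A program witnessing \<open>computable f\<close> obeys no stack discipline and may
  destroy its input. The copy of the input survives in a variable that the program does not mention,
  by \<open>exec_frame\<close>.\<close>

lemma computable_comp:
  assumes "computable f" and "pt P"
  shows "computable (\<lambda>k. P (k, f k))"
proof -
  obtain p where p: "\<And>n. \<exists>t. runs p (enc_unary n) t (enc_unary (f n))"
    using assms(1) unfolding computable_def by blast
  obtain q c where q: "\<And>x. runs_at 0 q (enc x) (c * (tsize (enc x) + 1) ^ c) (enc (P x))"
    using ptE[OF assms(2)] by metis
  \<comment> \<open>Beyond all variables of \<open>p\<close>, and by the successor also different
    from variable 0.\<close>
  let ?N = "Suc (com_bound p)"
  have "\<exists>t. runs (Seq (Assign ?N (Var 0)) (Seq p (Seq (Assign 0 (Pr (Var ?N) (Var 0))) q)))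
    (enc_unary n) t (enc_unary (P (n, f n)))" for n
  proof -
    let ?x = "enc_unary n"
    let ?S = "(\<lambda>_. Leaf)(0 := ?x)"
    obtain t S' where 1: "exec p ?S t S'" "S' 0 = enc_unary (f n)"
      using p[of n] unfolding runs_def by blast
    have 2: "exec p (?S(?N := ?x)) t (S'(?N := ?x))"
      using exec_frame[OF 1(1), of ?N] by simp
    let ?y = "Node ?x (enc_unary (f n))"
    have 3: "exec (Assign 0 (Pr (Var ?N) (Var 0))) (S'(?N := ?x)) (1 + tsize ?y) (S'(?N := ?x, 0 := ?y))"
      using exec.Assign[of 0 "Pr (Var ?N) (Var 0)" "S'(?N := ?x)"] 1(2) by simp
    have "enc (n, f n) = ?y" by (simp add: enc_simps)
    then obtain u S'' where 4: "exec q (S'(?N := ?x, 0 := ?y)) u S''" "S'' 0 = enc_unary (P (n, f n))"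
      using runs_atE[OF q[of "(n, f n)"], of "S'(?N := ?x, 0 := ?y)"] by (metis enc_nat_def fun_upd_same)
    have 5: "exec (Assign ?N (Var 0)) ?S (1 + tsize ?x) (?S(?N := ?x))"
      using exec.Assign[of ?N "Var 0" ?S] by simp
    show ?thesis unfolding runs_def
      using exec.Seq[OF 5 exec.Seq[OF 2 exec.Seq[OF 3 4(1)]]] 4(2) by blast
  qed
  then show ?thesis unfolding computable_def by blast
qed

text \<open>A first run takes time \<open>a * n ^ c\<close> and enlarges its input, of size 2 * k +
  2 + n, by at most that much; the second run is polynomial of degree \<open>d\<close> in the
  result. The lemma separates the dependence on \<open>k\<close> and \<open>a\<close> from a fixed
  power of \<open>n\<close>, as an fpt bound requires.\<close>

lemma pow_bound:
  fixes a b c d k n :: nat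
  assumes "1 \<le> n"
  shows "a * n ^ c + d * (2 * k + 3 + n + a * n ^ c) ^ d \<le> (a + d * (2 * k + 4 + a) ^ d) * n ^ ((c + 1) * (d + 1))"
proof -
  let ?E = "(c + 1) * (d + 1)"
  have n: "n ^ i \<le> n ^ j" if "i \<le> j" for i j using assms that by (intro power_increasing)
  have "2 * k + 3 + n + a * n ^ c \<le> (2 * k + 3) * n ^ (c + 1) + n ^ (c + 1) + a * n ^ (c + 1)"
    using n[of 0 "c + 1"] n[of 1 "c + 1"] n[of c "c + 1"]
    by (intro add_mono mult_le_mono2) (auto intro: order_trans[OF _ mult_le_mono2[of 1]])
  also have "\<dots> = (2 * k + 4 + a) * n ^ (c + 1)" by (simp add: algebra_simps)
  finally have "(2 * k + 3 + n + a * n ^ c) ^ d \<le> ((2 * k + 4 + a) * n ^ (c + 1)) ^ d"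
    by (rule power_mono) simp
  also have "\<dots> = (2 * k + 4 + a) ^ d * n ^ ((c + 1) * d)"
    unfolding power_mult_distrib power_mult ..
  also have "\<dots> \<le> (2 * k + 4 + a) ^ d * n ^ ?E"
    by (intro mult_le_mono2 n) simp
  finally have "d * (2 * k + 3 + n + a * n ^ c) ^ d \<le> d * (2 * k + 4 + a) ^ d * n ^ ?E"
    by (simp add: mult.assoc)
  moreover have "a * n ^ c \<le> a * n ^ ?E" by (intro mult_le_mono2 n) simp
  ultimately show ?thesis unfolding distrib_right by (rule add_mono[rotated])
qed

lemma tsize_enc_unary: "tsize (enc_unary n) = 2 * n + 1"
  by (induction n) auto

text \<open>The intermediate parameter is only known to be at most \<open>g k\<close>, so
  \<open>G\<close> has to be monotone.\<close>

theorem fpt_reducible_pt: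
  assumes "fpt_reducible A B" and R: "pt R" and "\<And>x k. (x, k) \<in> B \<longleftrightarrow> R (x, k) \<in> C"
    and G: "\<And>x k. snd (R (x, k)) \<le> G k" "mono G" "pt G"
  shows "fpt_reducible A C"
proof -
  obtain p f g c where f: "computable f" and g: "computable g" and
    p: "\<And>x k. \<exists>t x' k'. runs p (Node x (enc_unary k)) t (Node x' (enc_unary k')) \<and>
        t \<le> f k * tsize x ^ c \<and> k' \<le> g k \<and> ((x, k) \<in> A \<longleftrightarrow> (x', k') \<in> B)"
    using assms(1) unfolding fpt_reducible_def by blast
  \<comment> \<open>Base 0 matches the convention of \<open>runs\<close>, and \<open>runs_at\<close>
    tolerates whatever the first program leaves in the variables above.\<close>
  obtain q d where q: "\<And>x. runs_at 0 q (enc x) (d * (tsize (enc x) + 1) ^ d) (enc (R x))"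
    using ptE[OF R] by metis
  define F where "F = (\<lambda>k. f k + d * (2 * k + 4 + f k) ^ d)"
  have "pt (\<lambda>x. snd x + d * (2 * fst x + 4 + snd x) ^ d)" by (intro pt_intros)
  from computable_comp[OF f this] have F: "computable F" by (simp add: F_def)
  have "pt (\<lambda>x. G (snd x))" by (intro pt_comp[OF G(3)] pt_intros)
  from computable_comp[OF g this] have g': "computable (\<lambda>k. G (g k))" by simp
  have "\<exists>t x' k'. runs (Seq p q) (Node x (enc_unary k)) t (Node x' (enc_unary k')) \<and>
        t \<le> F k * tsize x ^ ((c + 1) * (d + 1)) \<and> k' \<le> G (g k) \<and> ((x, k) \<in> A \<longleftrightarrow> (x', k') \<in> C)" for x k
  proof -
    let ?in = "Node x (enc_unary k)"
    obtain t x' k' where 1: "runs p ?in t (Node x' (enc_unary k'))" "t \<le> f k * tsize x ^ c" "k' \<le> g k"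
      "(x, k) \<in> A \<longleftrightarrow> (x', k') \<in> B" using p by blast
    have e: "Node x' (enc_unary k') = enc (x', k')" by (simp add: enc_simps)
    obtain S where S: "exec p ((\<lambda>_. Leaf)(0 := ?in)) t S" "S 0 = enc (x', k')"
      using 1(1) unfolding runs_def e by blast
    obtain u S' where S': "exec q S u S'" "S' 0 = enc (R (x', k'))"
      "u \<le> d * (tsize (enc (x', k')) + 1) ^ d"
      using runs_atE[OF q, of S] S(2) by metis
    have "tsize (enc (x', k')) \<le> tsize ?in + t"
      using exec_size[OF S(1), of 0] S(2) by auto
    then have "tsize (enc (x', k')) + 1 \<le> 2 * k + 3 + tsize x + f k * tsize x ^ c"
      using 1(2) by (simp add: tsize_enc_unary)
    then have "d * (tsize (enc (x', k')) + 1) ^ d \<le> d * (2 * k + 3 + tsize x + f k * tsize x ^ c) ^ d"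
      by (intro mult_le_mono2 power_mono) auto
    then have "t + u \<le> f k * tsize x ^ c + d * (2 * k + 3 + tsize x + f k * tsize x ^ c) ^ d"
      using 1(2) S'(3) by linarith
    also have "\<dots> \<le> F k * tsize x ^ ((c + 1) * (d + 1))"
      unfolding F_def by (rule pow_bound) (simp add: tsize_ge_1)
    finally have time: "t + u \<le> F k * tsize x ^ ((c + 1) * (d + 1))" .
    have "runs (Seq p q) ?in (t + u) (Node (fst (R (x', k'))) (enc_unary (snd (R (x', k')))))"
      unfolding runs_def using exec.Seq[OF S(1) S'(1)] S'(2) by (auto simp: enc_simps)
    moreover have "snd (R (x', k')) \<le> G (g k)"
      using G(1)[of x' k'] monoD[OF G(2) 1(3)] by linarith
    moreover have "(x, k) \<in> A \<longleftrightarrow> (fst (R (x', k')), snd (R (x', k'))) \<in> C"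
      using 1(4) assms(3) by simp
    ultimately show ?thesis using time by blast
  qed
  then show ?thesis using F g' unfolding fpt_reducible_def by blast
qed

section \<open>Unsplittable flow on a line\<close>

definition line_edges :: "nat \<Rightarrow> nat set set" where
  "line_edges n = (\<lambda>p. {p, Suc p}) ` {..<n}"

text \<open>\<open>Min e\<close> is the left endpoint, by which edges are numbered; the length bound
  \<open>n\<close> admits every path of the line.\<close>

definition line_instance :: "nat \<Rightarrow> (nat \<Rightarrow> nat) \<Rightarrow> task set \<Rightarrow> nat \<Rightarrow> uf_instance" where
  "line_instance n cap ts tgt = \<lparr>graph = ({..n}, line_edges n), capacity = (\<lambda>e. cap (Min e)),
     tasks = ts, target = tgt, length_bound = int n\<rparr>"

fun src :: "task \<Rightarrow> nat" where "src (s, t, d, w) = s"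
fun dst :: "task \<Rightarrow> nat" where "dst (s, t, d, w) = t"

definition load :: "task set \<Rightarrow> nat \<Rightarrow> nat" where
  "load T q = (\<Sum>\<theta>\<in>T. demand \<theta> * of_bool (src \<theta> \<le> q \<and> q < dst \<theta>))"

section \<open>Paths on a line and the interval form of the problem\<close>

lemma path_edges_simps [simp]:
  "path_edges [] = {}" "path_edges [a] = {}"
  "path_edges (a # b # r) = insert {a, b} (path_edges (b # r))"
proof -
  show "path_edges (a # b # r) = insert {a, b} (path_edges (b # r))"
    unfolding path_edges_def
  proof (intro set_eqI iffI)
    fix e assume "e \<in> {{(a # b # r) ! i, (a # b # r) ! Suc i} |i. Suc i < length (a # b # r)}"
    then obtain i where "e = {(a # b # r) ! i, (a # b # r) ! Suc i}" "Suc i < length (a # b # r)" by blast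
    then show "e \<in> insert {a, b} {{(b # r) ! i, (b # r) ! Suc i} |i. Suc i < length (b # r)}"
      by (cases i) auto
  next
    fix e assume e: "e \<in> insert {a, b} {{(b # r) ! i, (b # r) ! Suc i} |i. Suc i < length (b # r)}"
    show "e \<in> {{(a # b # r) ! i, (a # b # r) ! Suc i} |i. Suc i < length (a # b # r)}"
    proof (cases "e = {a, b}")
      case True
      then show ?thesis by (intro CollectI exI[of _ 0]) simp
    next
      case False
      then obtain i where "e = {(b # r) ! i, (b # r) ! Suc i}" "Suc i < length (b # r)" using e by blast
      then show ?thesis by (intro CollectI exI[of _ "Suc i"]) simp
    qed
  qed
qed (auto simp: path_edges_def)

lemma path_edges_upt: "path_edges [s..<Suc t] = (\<lambda>p. {p, Suc p}) ` {s..<t}"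
proof (induction "t - s" arbitrary: s)
  case 0
  then show ?case by (cases "s = t") auto
next
  case (Suc k)
  then have s: "s < t" by simp
  then have "[s..<Suc t] = s # Suc s # [Suc (Suc s)..<Suc t]" by (simp add: upt_rec)
  moreover have "[Suc s..<Suc t] = Suc s # [Suc (Suc s)..<Suc t]" using s by (simp add: upt_rec)
  moreover have "{s..<t} = insert s {Suc s..<t}" using s by auto
  ultimately show ?case using Suc(1)[of "Suc s"] Suc(2) by simp
qed

text \<open>A discrete intermediate value argument: edges join consecutive numbers, so a walk from
  at most \<open>p\<close> to beyond \<open>p\<close> must step from \<open>p\<close> to
  \<open>Suc p\<close>.\<close>

lemma crossing_edge:
  assumes "q \<noteq> []" "hd q \<le> p" "p < last q" "path_edges q \<subseteq> line_edges n"
  shows "{p, Suc p} \<in> path_edges q"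
  using assms
proof (induction q)
  case (Cons a q)
  show ?case
  proof (cases q)
    case Nil
    with Cons show ?thesis by simp
  next
    case (Cons b r)
    then have e: "{a, b} \<in> line_edges n" using Cons.prems(4) by simp
    show ?thesis
    proof (cases "b \<le> p")
      case True
      then show ?thesis using Cons.IH Cons.prems Cons by auto
    next
      case False
      then have "b = Suc p" "a = p"
        using e Cons.prems(2) by (auto simp: line_edges_def doubleton_eq_iff)
      then show ?thesis using Cons by simp
    qed
  qed
qed simp

lemma path_graph_line: "path_graph ({..n}, line_edges n)"
  unfolding path_graph_def prod.case
  by (rule exI[of _ "[0..<Suc n]"]) (auto simp: path_edges_upt line_edges_def atLeast0LessThan simp del: upt_Suc)

lemma valid_line_instance:
  assumes "finite ts" "\<And>\<theta>. \<theta> \<in> ts \<Longrightarrow> src \<theta> < dst \<theta> \<and> dst \<theta> \<le> n"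
  shows "valid_instance (line_instance n cap ts tgt)"
proof -
  have "simple_graph ({..n}, line_edges n)"
    unfolding simple_graph_def prod.case
  proof (intro conjI ballI)
    fix e assume "e \<in> line_edges n"
    then obtain p where "p < n" "e = {p, Suc p}" by (auto simp: line_edges_def)
    then show "\<exists>u\<in>{..n}. \<exists>v\<in>{..n}. u \<noteq> v \<and> e = {u, v}"
      by (intro bexI[of _ p] bexI[of _ "Suc p"]) auto
  qed simp
  moreover have "s \<le> n \<and> t \<le> n" if "(s, t, d, w) \<in> ts" for s t d w
    using assms(2)[OF that] by simp
  ultimately show ?thesis
    using assms(1) by (auto simp: valid_instance_def line_instance_def)
qed

lemma max_capacity_line:
  "max_capacity (line_instance n cap ts tgt) = Max (insert 0 (cap ` {..<n}))"
proof -
  have "(\<lambda>e. cap (Min e)) ` line_edges n = cap ` {..<n}"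
    unfolding line_edges_def image_image by (intro image_cong) auto
  then show ?thesis by (simp add: max_capacity_def line_instance_def)
qed

text \<open>Routing disappears on a line. Any path from source to destination uses all edges of the
  interval between them, so loads bound the capacities from below; conversely the straight path uses
  no other edge.\<close>

lemma yes_line_instance:
  assumes ts: "finite ts" "\<And>\<theta>. \<theta> \<in> ts \<Longrightarrow> src \<theta> < dst \<theta> \<and> dst \<theta> \<le> n"
  shows "yes_instance (line_instance n cap ts tgt) \<longleftrightarrow>
    (\<exists>T\<subseteq>ts. (\<forall>q<n. load T q \<le> cap q) \<and> tgt \<le> (\<Sum>\<theta>\<in>T. profit \<theta>))"
proof -
  have load: "load T q = (\<Sum>\<theta>\<in>{\<theta>\<in>T. src \<theta> \<le> q \<and> q < dst \<theta>}. demand \<theta>)" if "T \<subseteq> ts" for T q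
    using finite_subset[OF that ts(1)] unfolding load_def
    by (intro sum.mono_neutral_cong_right) auto
  let ?I = "line_instance n cap ts tgt"
  have "(\<exists>R. flow_routing ?I T R) \<longleftrightarrow> (\<forall>q<n. load T q \<le> cap q)" if T: "T \<subseteq> ts" for T
  proof
    assume "\<exists>R. flow_routing ?I T R"
    then obtain R where R: "flow_routing ?I T R" ..
    show "\<forall>q<n. load T q \<le> cap q"
    proof (intro allI impI)
      fix q assume q: "q < n"
      have "{\<theta>\<in>T. src \<theta> \<le> q \<and> q < dst \<theta>} \<subseteq> {\<theta>\<in>T. {q, Suc q} \<in> path_edges (R \<theta>)}"
      proof clarify
        fix s t d w assume "(s, t, d, w) \<in> T" "src (s, t, d, w) \<le> q" "q < dst (s, t, d, w)"
        moreover from this have "is_path ({..n}, line_edges n) s t (R (s, t, d, w))"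
          using R unfolding flow_routing_def line_instance_def by auto
        ultimately show "{q, Suc q} \<in> path_edges (R (s, t, d, w))"
          unfolding is_path_def by (auto intro!: crossing_edge)
      qed
      then have "load T q \<le> (\<Sum>\<theta>\<in>{\<theta>\<in>T. {q, Suc q} \<in> path_edges (R \<theta>)}. demand \<theta>)"
        unfolding load[OF T] using finite_subset[OF T ts(1)] by (intro sum_mono2) auto
      also have "\<dots> \<le> capacity ?I {q, Suc q}"
        using R q unfolding flow_routing_def line_instance_def line_edges_def by auto
      finally show "load T q \<le> cap q" by (simp add: line_instance_def)
    qed
  next
    assume L: "\<forall>q<n. load T q \<le> cap q"
    define R where "R = (\<lambda>\<theta>. [src \<theta>..<Suc (dst \<theta>)])"
    have "flow_routing ?I T R"
      unfolding flow_routing_def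
    proof (intro conjI ballI)
      fix \<theta> assume "\<theta> \<in> T"
      then have *: "src \<theta> < dst \<theta>" "dst \<theta> \<le> n" using ts(2)[OF subsetD[OF T]] by blast+
      have "is_path ({..n}, line_edges n) (src \<theta>) (dst \<theta>) (R \<theta>)"
        using * unfolding is_path_def prod.case R_def path_edges_upt line_edges_def
        by (auto simp del: upt_Suc)
      moreover have "int (length (R \<theta>) - 1) \<le> int n" using * by (simp add: R_def)
      ultimately show "case \<theta> of (s, t, d, w) \<Rightarrow> is_path (graph ?I) s t (R (s, t, d, w)) \<and>
          int (length (R (s, t, d, w)) - 1) \<le> length_bound ?I"
        by (cases \<theta>) (simp add: line_instance_def)
    next
      fix e assume "e \<in> snd (graph ?I)"
      then obtain q where q: "q < n" "e = {q, Suc q}" by (auto simp: line_instance_def line_edges_def)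
      have "{\<theta>\<in>T. e \<in> path_edges (R \<theta>)} = {\<theta>\<in>T. src \<theta> \<le> q \<and> q < dst \<theta>}"
        unfolding R_def path_edges_upt q(2) by (auto simp: doubleton_eq_iff)
      then show "(\<Sum>\<theta>\<in>{\<theta>\<in>T. e \<in> path_edges (R \<theta>)}. demand \<theta>) \<le> capacity ?I e"
        using L[rule_format, OF q(1)] unfolding load[OF T] by (simp add: line_instance_def q(2))
    qed
    then show "\<exists>R. flow_routing ?I T R" by blast
  qed
  then show ?thesis unfolding yes_instance_def by (auto simp: line_instance_def)
qed

text \<open>Flow conservation at vertex \<open>Suc q\<close>, written without subtraction: what ends
  there leaves the load, what starts there joins it.\<close>

lemma load_step:
  assumes "\<And>\<theta>. \<theta> \<in> T \<Longrightarrow> src \<theta> < dst \<theta>"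
  shows "load T (Suc q) + (\<Sum>\<theta>\<in>T. demand \<theta> * of_bool (dst \<theta> = Suc q)) =
     load T q + (\<Sum>\<theta>\<in>T. demand \<theta> * of_bool (src \<theta> = Suc q))"
  unfolding load_def sum.distrib[symmetric]
proof (rule sum.cong[OF refl])
  fix \<theta> assume "\<theta> \<in> T"
  then have "src \<theta> < dst \<theta>" by (rule assms)
  then have "of_bool (src \<theta> \<le> Suc q \<and> Suc q < dst \<theta>) + of_bool (dst \<theta> = Suc q) =
    (of_bool (src \<theta> \<le> q \<and> q < dst \<theta>) + of_bool (src \<theta> = Suc q) :: nat)"
    by (auto simp: of_bool_def)
  then show "demand \<theta> * of_bool (src \<theta> \<le> Suc q \<and> Suc q < dst \<theta>) + demand \<theta> * of_bool (dst \<theta> = Suc q) =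
    demand \<theta> * of_bool (src \<theta> \<le> q \<and> q < dst \<theta>) + demand \<theta> * of_bool (src \<theta> = Suc q)"
    unfolding distrib_left[symmetric] by (rule arg_cong)
qed

lemma load_0:
  assumes "\<And>\<theta>. \<theta> \<in> T \<Longrightarrow> src \<theta> < dst \<theta>"
  shows "load T 0 = (\<Sum>\<theta>\<in>T. demand \<theta> * of_bool (src \<theta> = 0))"
  unfolding load_def
proof (rule sum.cong[OF refl])
  fix \<theta> assume "\<theta> \<in> T"
  then have "src \<theta> < dst \<theta>" by (rule assms)
  then show "demand \<theta> * of_bool (src \<theta> \<le> 0 \<and> 0 < dst \<theta>) = demand \<theta> * of_bool (src \<theta> = 0)" by simp
qed

text \<open>Double counting of pairs of a task and an edge. It turns earnings per edge and unit of
  demand into the total load.\<close>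

lemma sum_load:
  assumes "\<And>\<theta>. \<theta> \<in> T \<Longrightarrow> src \<theta> < dst \<theta> \<and> dst \<theta> \<le> n"
  shows "(\<Sum>q<n. load T q) = (\<Sum>\<theta>\<in>T. demand \<theta> * (dst \<theta> - src \<theta>))"
proof -
  have "(\<Sum>q<n. load T q) = (\<Sum>\<theta>\<in>T. \<Sum>q<n. demand \<theta> * of_bool (src \<theta> \<le> q \<and> q < dst \<theta>))"
    unfolding load_def by (rule sum.swap)
  also have "\<dots> = (\<Sum>\<theta>\<in>T. demand \<theta> * (dst \<theta> - src \<theta>))"
  proof (rule sum.cong[OF refl])
    fix \<theta> assume "\<theta> \<in> T"
    then have "src \<theta> < dst \<theta>" "dst \<theta> \<le> n" using assms by blast+
    then have "{..<n} \<inter> {q. src \<theta> \<le> q \<and> q < dst \<theta>} = {src \<theta>..<dst \<theta>}" by auto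
    then show "(\<Sum>q<n. demand \<theta> * of_bool (src \<theta> \<le> q \<and> q < dst \<theta>)) = demand \<theta> * (dst \<theta> - src \<theta>)"
      unfolding sum_distrib_left[symmetric] by (subst sum_of_bool_eq) simp_all
  qed
  finally show ?thesis .
qed

lemma disjointI:
  assumes "\<And>x. x \<in> A \<Longrightarrow> f x < (n::nat)" "\<And>x. x \<in> B \<Longrightarrow> n \<le> f x"
  shows "A \<inter> B = {}"
  using assms by (meson disjoint_iff leD)

lemma concat_map_product:
  "concat (map (\<lambda>a. map (h a) ys) xs) = map (case_prod h) (List.product xs ys)"
  by (induction xs) auto

text \<open>
  \<open>Bl\<close> lists the blocks, each a tuple of variables \<open>i < V\<close>; a pair \<open>(m, y)\<close> in \<open>L\<close> is an option of
  block \<open>m\<close>, with values \<open>< Dm\<close> for its variables.  On the line come first one position per block, then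
  one position per option (\<open>posP\<close>), then one position per variable and value (\<open>posA\<close>).  A \<open>main\<close> task
  leads from a block to an option, its \<open>unit\<close> tasks lead on to the values that the option prescribes, and
  a \<open>final\<close> task leads from a value to the end.  The capacities force one main task per block.  Every
  task earns \<open>price\<close> per edge and unit of demand; \<open>price\<close> exceeds the sum of all other earnings, so
  reaching the goal requires every edge to be saturated.  Then the unit tasks ending at a value are
  either none or all those of its variable.  The summand \<open>l\<close> in the profit of a unit task only keeps
  tasks distinct that would otherwise coincide.
\<close>

locale tile_data =
  fixes r :: nat and Bl :: "nat list list" and V Dm :: nat
    and L :: "(nat \<times> nat list) list" and w :: "nat list \<Rightarrow> nat" and W tgt :: nat
begin

definition "B = length Bl"
definition "K = length L"
definition "mOf p = fst (nthd (0, []) L p)"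
definition "yOf p = snd (nthd (0, []) L p)"
definition "posP p = B + p"
definition "posA i v = B + K + (i * Dm + v)"
definition "E = B + K + V * Dm"
text \<open>The number of units of flow that must arrive at the value chosen for \<open>i\<close>,
  one per occurrence of \<open>i\<close> in the blocks.\<close>

definition "deg i = length (filter (\<lambda>j. i = j) (concat Bl))"
text \<open>At most \<open>K\<close> main tasks earn at most \<open>W\<close> extra each, and at
  most \<open>K * r\<close> unit tasks earn less than \<open>r\<close> extra each.\<close>

definition "price = 1 + K * (W + r * r)"
definition main :: "nat \<Rightarrow> task" where
  "main p = (mOf p, posP p, r, price * (r * (posP p - mOf p)) + w (yOf p))"
definition zone :: "nat \<Rightarrow> nat \<Rightarrow> nat" where
  "zone p l = posA (nthd 0 (nthd [] Bl (mOf p)) l) (nthd 0 (yOf p) l)"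
definition unit :: "nat \<Rightarrow> nat \<Rightarrow> task" where
  "unit p l = (posP p, zone p l, 1, price * (zone p l - posP p) + l)"
definition final :: "nat \<Rightarrow> nat \<Rightarrow> task" where
  "final i v = (posA i v, E, deg i, price * (deg i * (E - posA i v)))"
definition task_list :: "task list" where
  "task_list = map main [0..<K] @ concat (map (\<lambda>p. map (unit p) [0..<r]) [0..<K]) @
     concat (map (\<lambda>i. map (final i) [0..<Dm]) [0..<V])"
text \<open>Block \<open>m\<close> is meant to contribute \<open>r\<close> units of flow from vertex
  \<open>m\<close> through to the end \<open>E\<close>; edge \<open>q\<close> is reached by the
  blocks up to \<open>q\<close>.\<close>

definition "cap q = r * min (Suc q) B"
text \<open>Full saturation at \<open>price\<close>, then the target, then the summands
  \<open>l\<close> that the unit tasks of \<open>B\<close> chosen options collect in any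
  case.\<close>

definition "goal = price * sum_list (map cap [0..<E]) + (tgt + B * sum_list [0..<r])"

definition "instance_of = line_instance E cap (set task_list) goal"

definition "TS M U F = main ` M \<union> case_prod unit ` U \<union> case_prod final ` F"

end

text \<open>The assumptions are kept apart from \<open>tile_data\<close>, whose constructions thus
  remain plain functions of their parameters; the running time proof treats them as such.\<close>

locale tiles = tile_data +
  assumes r_pos: "0 < r"
    and Bl: "\<And>s. s \<in> set Bl \<Longrightarrow> length s = r \<and> set s \<subseteq> {..<V}"
    and cover: "\<And>i. i < V \<Longrightarrow> \<exists>s\<in>set Bl. i \<in> set s"
    and L: "\<And>m y. (m, y) \<in> set L \<Longrightarrow> m < length Bl \<and> length y = r \<and> set y \<subseteq> {..<Dm}"
    and dist: "distinct L"
    and w: "\<And>y. w y \<le> W"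
begin

section \<open>Positions on the line and selections of tasks\<close>

abbreviation "sc m l \<equiv> Bl ! m ! l"

lemma sc: "m < B \<Longrightarrow> l < r \<Longrightarrow> sc m l < V" "m < B \<Longrightarrow> length (Bl ! m) = r"
proof -
  assume "m < B"
  then have "length (Bl ! m) = r \<and> set (Bl ! m) \<subseteq> {..<V}" by (intro Bl nth_mem) (simp add: B_def)
  then show "length (Bl ! m) = r" "l < r \<Longrightarrow> sc m l < V" using nth_mem by blast+
qed

lemma L_nth: "p < K \<Longrightarrow> L ! p = (mOf p, yOf p)"
  by (simp add: mOf_def yOf_def nthd_nth K_def)

lemma opt:
  assumes "p < K"
  shows "mOf p < B" "length (yOf p) = r" "l < r \<Longrightarrow> yOf p ! l < Dm"
proof -
  have "(mOf p, yOf p) \<in> set L" using L_nth[OF assms] assms nth_mem[of p L] by (simp add: K_def)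
  from L[OF this] show "mOf p < B" "length (yOf p) = r" "l < r \<Longrightarrow> yOf p ! l < Dm"
    using nth_mem by (auto simp: B_def)
qed

lemma zone: "p < K \<Longrightarrow> l < r \<Longrightarrow> zone p l = posA (sc (mOf p) l) (yOf p ! l)"
  using opt(1,2)[of p] sc(2)[of "mOf p"] by (simp add: zone_def nthd_nth B_def)

lemma posA_eq_iff: "v < Dm \<Longrightarrow> v' < Dm \<Longrightarrow> posA i v = posA i' v' \<longleftrightarrow> i = i' \<and> v = v'"
proof
  assume *: "v < Dm" "v' < Dm" "posA i v = posA i' v'"
  then have "i * Dm + v = i' * Dm + v'" by (simp add: posA_def)
  then have "(i * Dm + v) div Dm = (i' * Dm + v') div Dm" by simp
  then have "i = i'" using * by simp
  then show "i = i' \<and> v = v'" using * by (simp add: posA_def)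
qed simp

lemma posA_less: "i < V \<Longrightarrow> v < Dm \<Longrightarrow> posA i v < E"
proof -
  assume "i < V" "v < Dm"
  then have "Suc i * Dm \<le> V * Dm" by (intro mult_le_mono1) simp
  then show ?thesis using \<open>v < Dm\<close> by (simp add: posA_def E_def)
qed

lemma zone_less: "p < K \<Longrightarrow> l < r \<Longrightarrow> zone p l < E"
  using zone opt sc posA_less by simp

lemma inj_main: "inj_on main {..<K}"
  by (rule inj_onI) (simp add: main_def posP_def)

lemma inj_unit: "inj_on (case_prod unit) ({..<K} \<times> {..<r})"
  by (rule inj_onI) (auto simp: unit_def posP_def)

lemma inj_final: "inj_on (case_prod final) ({..<V} \<times> {..<Dm})"
  by (rule inj_onI) (auto simp: final_def posA_eq_iff)

definition "sel_ok M U F \<longleftrightarrow> M \<subseteq> {..<K} \<and> U \<subseteq> {..<K} \<times> {..<r} \<and> F \<subseteq> {..<V} \<times> {..<Dm}"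

text \<open>The three kinds of tasks start in three disjoint stretches of the line, and within each
  kind a task determines its indices.\<close>

lemma sum_TS:
  assumes "sel_ok M U F"
  shows "(\<Sum>\<theta>\<in>TS M U F. f \<theta>) = (\<Sum>p\<in>M. f (main p)) + (\<Sum>(p, l)\<in>U. f (unit p l)) + (\<Sum>(i, v)\<in>F. f (final i v))"
proof -
  have fin: "finite M" "finite U" "finite F"
    using assms finite_subset[of M "{..<K}"] finite_subset[of U "{..<K} \<times> {..<r}"]
      finite_subset[of F "{..<V} \<times> {..<Dm}"] by (simp_all add: sel_ok_def)
  have inj: "inj_on main M" "inj_on (case_prod unit) U" "inj_on (case_prod final) F"
    using assms inj_on_subset[OF inj_main] inj_on_subset[OF inj_unit] inj_on_subset[OF inj_final]
    by (simp_all add: sel_ok_def)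
  have 1: "src \<theta> < B" if "\<theta> \<in> main ` M" for \<theta>
    using that assms opt(1) by (auto simp: main_def sel_ok_def)
  have 2: "B \<le> src \<theta>" "src \<theta> < B + K" if "\<theta> \<in> case_prod unit ` U" for \<theta>
    using that assms by (auto simp: unit_def posP_def sel_ok_def)
  have 3: "B + K \<le> src \<theta>" if "\<theta> \<in> case_prod final ` F" for \<theta>
    using that by (auto simp: final_def posA_def)
  have d1: "main ` M \<inter> case_prod unit ` U = {}" by (rule disjointI[OF 1 2(1)])
  have 4: "src \<theta> < B + K" if "\<theta> \<in> main ` M" for \<theta> using 1[OF that] by simp
  have d2: "(main ` M \<union> case_prod unit ` U) \<inter> case_prod final ` F = {}"
  proof -
    have "main ` M \<inter> case_prod final ` F = {}" by (rule disjointI[OF 4 3])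
    moreover have "case_prod unit ` U \<inter> case_prod final ` F = {}" by (rule disjointI[OF 2(2) 3])
    ultimately show ?thesis unfolding Int_Un_distrib2 by simp
  qed
  have "(\<Sum>\<theta>\<in>TS M U F. f \<theta>) = (\<Sum>\<theta>\<in>main ` M. f \<theta>) + (\<Sum>\<theta>\<in>case_prod unit ` U. f \<theta>) + (\<Sum>\<theta>\<in>case_prod final ` F. f \<theta>)"
    unfolding TS_def using fin d1 d2 by (simp add: sum.union_disjoint)
  also have "(\<Sum>\<theta>\<in>main ` M. f \<theta>) = (\<Sum>p\<in>M. f (main p))"
    by (simp add: sum.reindex[OF inj(1)])
  also have "(\<Sum>\<theta>\<in>case_prod unit ` U. f \<theta>) = (\<Sum>(p, l)\<in>U. f (unit p l))"
    by (subst sum.reindex[OF inj(2)]) (simp add: case_prod_unfold)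
  also have "(\<Sum>\<theta>\<in>case_prod final ` F. f \<theta>) = (\<Sum>(i, v)\<in>F. f (final i v))"
    by (subst sum.reindex[OF inj(3)]) (simp add: case_prod_unfold)
  finally show ?thesis .
qed

lemma set_task_list: "set task_list = TS {..<K} ({..<K} \<times> {..<r}) ({..<V} \<times> {..<Dm})"
  unfolding task_list_def concat_map_product TS_def by (simp add: atLeast0LessThan Un_assoc)

lemma TS_subset: "sel_ok M U F \<Longrightarrow> TS M U F \<subseteq> set task_list"
  unfolding set_task_list TS_def sel_ok_def by blast

lemma subset_TS:
  assumes "T \<subseteq> set task_list"
  obtains M U F where "sel_ok M U F" "T = TS M U F"
proof (rule that)
  let ?M = "{p. p < K \<and> main p \<in> T}" and ?U = "{x \<in> {..<K} \<times> {..<r}. case_prod unit x \<in> T}"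
    and ?F = "{x \<in> {..<V} \<times> {..<Dm}. case_prod final x \<in> T}"
  show "sel_ok ?M ?U ?F" unfolding sel_ok_def by auto
  show "T = TS ?M ?U ?F"
    using assms unfolding set_task_list TS_def by blast
qed

lemma tasks_wf: "\<theta> \<in> set task_list \<Longrightarrow> src \<theta> < dst \<theta> \<and> dst \<theta> \<le> E"
proof -
  have "src (main p) < dst (main p) \<and> dst (main p) \<le> E" if "p < K" for p
    using opt(1)[OF that] that by (simp add: main_def posP_def E_def)
  moreover have "src (unit p l) < dst (unit p l) \<and> dst (unit p l) \<le> E" if "p < K" "l < r" for p l
    using zone_less[OF that] that zone[OF that] by (simp add: unit_def posP_def posA_def)
  moreover have "src (final i v) < dst (final i v) \<and> dst (final i v) \<le> E" if "i < V" "v < Dm" for i v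
    using posA_less[OF that] by (simp add: final_def)
  ultimately show "\<theta> \<in> set task_list \<Longrightarrow> src \<theta> < dst \<theta> \<and> dst \<theta> \<le> E"
    unfolding set_task_list TS_def by auto
qed

lemma distinct_task_list: "distinct task_list"
proof -
  have 1: "src \<theta> < B" if "\<theta> \<in> main ` {..<K}" for \<theta>
    using that opt(1) by (auto simp: main_def)
  have 2: "B \<le> src \<theta>" "src \<theta> < B + K" if "\<theta> \<in> case_prod unit ` ({..<K} \<times> {..<r})" for \<theta>
    using that by (auto simp: unit_def posP_def)
  have 3: "B + K \<le> src \<theta>" if "\<theta> \<in> case_prod final ` ({..<V} \<times> {..<Dm})" for \<theta>
    using that by (auto simp: final_def posA_def)
  have 4: "src \<theta> < B + K" if "\<theta> \<in> main ` {..<K}" for \<theta> using 1[OF that] by simp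
  have "distinct (map main [0..<K])"
    using inj_main by (simp add: distinct_map atLeast0LessThan)
  moreover have "distinct (map (case_prod unit) (List.product [0..<K] [0..<r]))"
    using inj_unit by (simp add: distinct_map distinct_product atLeast0LessThan)
  moreover have "distinct (map (case_prod final) (List.product [0..<V] [0..<Dm]))"
    using inj_final by (simp add: distinct_map distinct_product atLeast0LessThan)
  moreover have "main ` {..<K} \<inter> case_prod unit ` ({..<K} \<times> {..<r}) = {}"
    by (rule disjointI[OF 1 2(1)])
  moreover have "main ` {..<K} \<inter> case_prod final ` ({..<V} \<times> {..<Dm}) = {}"
    by (rule disjointI[OF 4 3])
  moreover have "case_prod unit ` ({..<K} \<times> {..<r}) \<inter> case_prod final ` ({..<V} \<times> {..<Dm}) = {}"
    by (rule disjointI[OF 2(2) 3])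
  ultimately show ?thesis
    unfolding task_list_def concat_map_product by (simp add: atLeast0LessThan Int_Un_distrib)
qed

text \<open>Double counting of occurrences. It distributes the demand of a final task over the block
  entries that it serves.\<close>

lemma deg_sum: "(\<Sum>i<V. deg i * g i) = (\<Sum>m<B. \<Sum>l<r. g (sc m l))"
proof -
  have "set (concat Bl) \<subseteq> {..<V}" using Bl by auto
  then have "(\<Sum>i<V. count_list (concat Bl) i * g i) = (\<Sum>i\<in>set (concat Bl). count_list (concat Bl) i * g i)"
    by (intro sum.mono_neutral_right) (auto simp: count_list_0_iff)
  also have "\<dots> = sum_list (map g (concat Bl))"
    by (rule sum_list_map_eq_sum_count[symmetric])
  also have "\<dots> = sum_list (map (\<lambda>s. sum_list (map g s)) Bl)"
    by (induction Bl) auto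
  also have "\<dots> = (\<Sum>m<B. sum_list (map g (Bl ! m)))"
    by (simp add: sum_list_sum_nth B_def atLeast0LessThan)
  also have "\<dots> = (\<Sum>m<B. \<Sum>l<r. g (sc m l))"
    by (intro sum.cong) (auto simp: sum_list_sum_nth sc atLeast0LessThan)
  finally show ?thesis by (simp add: deg_def count_list_eq_length_filter)
qed

lemma deg_eq: "i < V \<Longrightarrow> deg i = (\<Sum>m<B. \<Sum>l<r. of_bool (sc m l = i))"
  using deg_sum[of "\<lambda>j. of_bool (j = i)"] by (simp add: if_distrib sum.delta of_bool_def cong: if_cong)

lemma profit_TS:
  assumes ok: "sel_ok M U F"
  shows "(\<Sum>\<theta>\<in>TS M U F. profit \<theta>) = price * (\<Sum>q<E. load (TS M U F) q) +
    ((\<Sum>p\<in>M. w (yOf p)) + (\<Sum>(p, l)\<in>U. l))"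
proof -
  have "(\<Sum>q<E. load (TS M U F) q) = (\<Sum>\<theta>\<in>TS M U F. demand \<theta> * (dst \<theta> - src \<theta>))"
    by (rule sum_load) (use tasks_wf TS_subset[OF ok] in blast)
  then show ?thesis
    unfolding sum_TS[OF ok]
    by (simp add: main_def unit_def final_def sum.distrib distrib_left sum_distrib_left case_prod_unfold)
qed

lemma sum_list_upt: "sum_list (map f [0..<n]) = (\<Sum>q<n. f q)" for f :: "nat \<Rightarrow> nat"
  by (simp add: sum_list_distinct_conv_sum_set atLeast0LessThan)

lemma goal_eq: "goal = price * (\<Sum>q<E. cap q) + (tgt + B * (\<Sum>l<r. l))"
  using sum_list_upt[of "\<lambda>l. l" r] by (simp add: goal_def sum_list_upt)

section \<open>Solutions of the tuple problem and saturating task sets\<close>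

lemma yes_iff_TS:
  "yes_instance instance_of \<longleftrightarrow> (\<exists>M U F. sel_ok M U F \<and> (\<forall>q<E. load (TS M U F) q \<le> cap q) \<and>
     goal \<le> (\<Sum>\<theta>\<in>TS M U F. profit \<theta>))" (is "?l \<longleftrightarrow> ?r")
proof -
  have "?l \<longleftrightarrow> (\<exists>T\<subseteq>set task_list. (\<forall>q<E. load T q \<le> cap q) \<and> goal \<le> (\<Sum>\<theta>\<in>T. profit \<theta>))"
    unfolding instance_of_def by (rule yes_line_instance) (auto dest: tasks_wf)
  also have "\<dots> \<longleftrightarrow> ?r"
    using subset_TS TS_subset by (metis (no_types, lifting))
  finally show ?thesis .
qed

text \<open>Each entry of a block becomes one unit of flow, carried in turn by a main task, a unit
  task and a final task, without gap or overlap.\<close>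

lemma yes_if_solution:
  assumes x: "\<And>i. i < V \<Longrightarrow> x i < Dm" "\<And>m. m < B \<Longrightarrow> (m, map x (Bl ! m)) \<in> set L"
    and t: "tgt \<le> (\<Sum>m<B. w (map x (Bl ! m)))"
  shows "yes_instance instance_of"
proof -
  have "\<forall>m<B. \<exists>p<K. L ! p = (m, map x (Bl ! m))"
    using x(2) by (metis K_def in_set_conv_nth)
  then obtain sel where sel: "\<And>m. m < B \<Longrightarrow> sel m < K \<and> L ! (sel m) = (m, map x (Bl ! m))" by metis
  have s: "mOf (sel m) = m" "yOf (sel m) = map x (Bl ! m)" "sel m < K" if "m < B" for m
    using sel[OF that] L_nth[of "sel m"] by auto
  have inj: "inj_on sel {..<B}" using s(1) by (metis inj_onI lessThan_iff)
  define M where "M = sel ` {..<B}"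
  define U where "U = M \<times> {..<r}"
  define F where "F = (\<lambda>i. (i, x i)) ` {..<V}"
  have ok: "sel_ok M U F" using s(3) x(1) unfolding sel_ok_def M_def U_def F_def by auto
  have M: "(\<Sum>p\<in>M. f p) = (\<Sum>m<B. f (sel m))" for f :: "nat \<Rightarrow> nat"
    unfolding M_def by (subst sum.reindex[OF inj]) simp
  have U: "(\<Sum>(p, l)\<in>U. f p l) = (\<Sum>m<B. \<Sum>l<r. f (sel m) l)" for f :: "nat \<Rightarrow> nat \<Rightarrow> nat"
    unfolding U_def sum.cartesian_product[symmetric] by (rule M)
  have F: "(\<Sum>(i, v)\<in>F. f i v) = (\<Sum>i<V. f i (x i))" for f :: "nat \<Rightarrow> nat \<Rightarrow> nat"
    unfolding F_def by (subst sum.reindex) (auto simp: inj_on_def)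
  have load: "load (TS M U F) q = cap q" if q: "q < E" for q
  proof -
    have "load (TS M U F) q = (\<Sum>m<B. r * of_bool (m \<le> q \<and> q < posP (sel m))) +
      (\<Sum>m<B. \<Sum>l<r. of_bool (posP (sel m) \<le> q \<and> q < zone (sel m) l)) +
      (\<Sum>i<V. deg i * of_bool (posA i (x i) \<le> q \<and> q < E))"
      unfolding load_def sum_TS[OF ok] M U F
      by (intro arg_cong2[where f = "(+)"] sum.cong refl) (auto simp: main_def unit_def final_def s)
    \<comment> \<open>After \<open>deg_sum\<close> all three sums range over block entries, so the
      three intervals of one entry can be joined.\<close>
    also have "\<dots> = (\<Sum>m<B. \<Sum>l<r. of_bool (m \<le> q \<and> q < posP (sel m)) +
      of_bool (posP (sel m) \<le> q \<and> q < zone (sel m) l) + of_bool (posA (sc m l) (x (sc m l)) \<le> q \<and> q < E))"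
      unfolding deg_sum sum.distrib by simp
    also have "\<dots> = (\<Sum>m<B. \<Sum>l<r. of_bool (m \<le> q))"
    proof (intro sum.cong refl)
      fix m l assume "m \<in> {..<B}" "l \<in> {..<r}"
      then have ml: "m < B" "l < r" by auto
      then have z: "zone (sel m) l = posA (sc m l) (x (sc m l))"
        using zone[OF s(3), of m l] s sc by simp
      have "m \<le> posP (sel m)" "posP (sel m) \<le> zone (sel m) l"
        using ml s(3)[of m] unfolding z by (auto simp: posP_def posA_def)
      then show "of_bool (m \<le> q \<and> q < posP (sel m)) +
        of_bool (posP (sel m) \<le> q \<and> q < zone (sel m) l) + of_bool (posA (sc m l) (x (sc m l)) \<le> q \<and> q < E) =
        (of_bool (m \<le> q) :: nat)"
        using q unfolding z[symmetric] by (auto simp: of_bool_def)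
    qed
    also have "\<dots> = r * card ({..<B} \<inter> {..q})"
      by (simp add: sum_distrib_left[symmetric] atMost_def)
    also have "{..<B} \<inter> {..q} = {..<min (Suc q) B}" by auto
    finally show ?thesis by (simp add: cap_def)
  qed
  have "goal \<le> (\<Sum>\<theta>\<in>TS M U F. profit \<theta>)"
    unfolding profit_TS[OF ok] goal_eq M U using t load s(2) by simp
  then show ?thesis unfolding yes_iff_TS using ok load by (metis order_refl)
qed

text \<open>One missing unit on one edge loses \<open>price\<close>, more than all extra earnings
  together. With the priced part exactly used up, the extra earnings alone have to reach the rest of
  the goal.\<close>

lemma saturated:
  assumes ok: "sel_ok M U F" and cap: "\<forall>q<E. load (TS M U F) q \<le> cap q"
    and g: "goal \<le> (\<Sum>\<theta>\<in>TS M U F. profit \<theta>)"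
  shows "\<And>q. q < E \<Longrightarrow> load (TS M U F) q = cap q"
    and "tgt + B * (\<Sum>l<r. l) \<le> (\<Sum>p\<in>M. w (yOf p)) + (\<Sum>(p, l)\<in>U. l)"
proof -
  let ?S = "\<Sum>q<E. load (TS M U F) q" and ?C = "\<Sum>q<E. cap q"
  let ?b = "(\<Sum>p\<in>M. w (yOf p)) + (\<Sum>(p, l)\<in>U. l)"
  have M: "M \<subseteq> {..<K}" and U: "U \<subseteq> {..<K} \<times> {..<r}" using ok by (auto simp: sel_ok_def)
  have "(\<Sum>p\<in>M. w (yOf p)) \<le> card M * W" using sum_bounded_above[of M "\<lambda>p. w (yOf p)" W] w by simp
  also have "\<dots> \<le> K * W" using card_mono[OF _ M] by simp
  finally have 1: "(\<Sum>p\<in>M. w (yOf p)) \<le> K * W" .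
  have "(\<Sum>(p, l)\<in>U. l) \<le> card U * r"
    using sum_bounded_above[of U "\<lambda>x. snd x" r] U by (force simp: case_prod_unfold)
  also have "\<dots> \<le> K * r * r" using card_mono[OF _ U] by (simp add: card_cartesian_product)
  finally have b: "?b < price" using 1 by (simp add: price_def distrib_left mult.assoc)
  have SC: "?S \<le> ?C" using cap by (intro sum_mono) simp
  have le: "price * ?C + (tgt + B * (\<Sum>l<r. l)) \<le> price * ?S + ?b"
    using g unfolding profit_TS[OF ok] goal_eq .
  have "?S = ?C"
  proof (rule ccontr)
    assume "?S \<noteq> ?C"
    then have "Suc ?S \<le> ?C" using SC by simp
    then have "price * Suc ?S \<le> price * ?C" by (rule mult_le_mono2)
    then have "price * ?S + price \<le> price * ?C" by simp
    then show False using le b by linarith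
  qed
  then show "tgt + B * (\<Sum>l<r. l) \<le> ?b" using le by simp
  show "load (TS M U F) q = cap q" if "q < E" for q
  proof (rule ccontr)
    assume "load (TS M U F) q \<noteq> cap q"
    then have "?S < ?C" using cap that by (intro sum_strict_mono_ex1) (auto intro!: bexI[of _ q])
    then show False using \<open>?S = ?C\<close> by simp
  qed
qed

text \<open>Conservation at vertex \<open>q\<close> when every edge is full: what starts replaces
  what ends, plus the rise of the capacity by \<open>r\<close> at each of the first \<open>B\<close>
  vertices. Final tasks end at \<open>E\<close>, beyond \<open>q\<close>, so they appear among the
  starting tasks only.\<close>

lemma balance:
  assumes ok: "sel_ok M U F" and sat: "\<And>q. q < E \<Longrightarrow> load (TS M U F) q = cap q" and q: "q < E"
  shows "(\<Sum>p\<in>M. r * of_bool (mOf p = q)) + (\<Sum>(p, l)\<in>U. of_bool (posP p = q)) +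
      (\<Sum>(i, v)\<in>F. deg i * of_bool (posA i v = q)) =
     (\<Sum>p\<in>M. r * of_bool (posP p = q)) + (\<Sum>(p, l)\<in>U. of_bool (zone p l = q)) + r * of_bool (q < B)"
proof -
  let ?T = "TS M U F"
  have wf: "src \<theta> < dst \<theta>" if "\<theta> \<in> ?T" for \<theta> using tasks_wf TS_subset[OF ok] that by blast
  have start: "(\<Sum>\<theta>\<in>?T. demand \<theta> * of_bool (src \<theta> = q)) = (\<Sum>p\<in>M. r * of_bool (mOf p = q)) +
      (\<Sum>(p, l)\<in>U. of_bool (posP p = q)) + (\<Sum>(i, v)\<in>F. deg i * of_bool (posA i v = q))"
    unfolding sum_TS[OF ok] by (simp add: main_def unit_def final_def)
  have stop: "(\<Sum>\<theta>\<in>?T. demand \<theta> * of_bool (dst \<theta> = q)) = (\<Sum>p\<in>M. r * of_bool (posP p = q)) +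
      (\<Sum>(p, l)\<in>U. of_bool (zone p l = q))"
    unfolding sum_TS[OF ok] using q by (simp add: main_def unit_def final_def case_prod_unfold)
  have "(\<Sum>\<theta>\<in>?T. demand \<theta> * of_bool (src \<theta> = q)) = (\<Sum>\<theta>\<in>?T. demand \<theta> * of_bool (dst \<theta> = q)) + r * of_bool (q < B)"
  proof (cases q)
    case 0
    have "(\<Sum>\<theta>\<in>?T. demand \<theta> * of_bool (dst \<theta> = q)) = 0"
      using wf unfolding 0 by (intro sum.neutral ballI) (metis less_zeroE mult_zero_right of_bool_eq(1))
    then show ?thesis using load_0[OF wf, of ?T] sat[OF q] 0 by (cases B) (auto simp: cap_def)
  next
    case (Suc q')
    have "cap q = cap q' + r * of_bool (q < B)"
      unfolding Suc cap_def by (cases "Suc q' < B") (auto simp: min_def not_less)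
    then show ?thesis using load_step[OF wf, of ?T q'] sat[OF q] sat[of q'] q Suc by simp
  qed
  then show ?thesis unfolding start stop .
qed

text \<open>The balance is read in the three stretches in turn: it yields one option per block, then
  exactly the unit tasks of these options, and finally agreement of the options on common
  variables.\<close>

lemma solution_if_yes:
  assumes "yes_instance instance_of"
  obtains x where "\<And>i. i < V \<Longrightarrow> x i < Dm" "\<And>m. m < B \<Longrightarrow> (m, map x (Bl ! m)) \<in> set L"
    "tgt \<le> (\<Sum>m<B. w (map x (Bl ! m)))"
proof -
  obtain M U F where ok: "sel_ok M U F" and load: "\<forall>q<E. load (TS M U F) q \<le> cap q"
    and goal: "goal \<le> (\<Sum>\<theta>\<in>TS M U F. profit \<theta>)"
    using assms unfolding yes_iff_TS by blast
  note sat = saturated[OF ok load goal]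
  have bal: "(\<Sum>p\<in>M. r * of_bool (mOf p = q)) + (\<Sum>(p, l)\<in>U. of_bool (posP p = q)) +
      (\<Sum>(i, v)\<in>F. deg i * of_bool (posA i v = q)) =
     (\<Sum>p\<in>M. r * of_bool (posP p = q)) + (\<Sum>(p, l)\<in>U. of_bool (zone p l = q)) + r * of_bool (q < B)"
    if "q < E" for q using balance[OF ok sat(1) that] .
  have M: "M \<subseteq> {..<K}" and U: "U \<subseteq> {..<K} \<times> {..<r}" and F: "F \<subseteq> {..<V} \<times> {..<Dm}"
    using ok by (auto simp: sel_ok_def)
  have fin: "finite M" "finite U" "finite F"
    using M U F finite_subset[of M "{..<K}"] finite_subset[of U "{..<K} \<times> {..<r}"]
      finite_subset[of F "{..<V} \<times> {..<Dm}"] by simp_all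
  have zone_ge: "B + K \<le> zone p l" if "(p, l) \<in> U" for p l
    using zone[of p l] that U by (auto simp: posA_def)
  \<comment> \<open>At a vertex below \<open>B\<close> nothing ends and only main tasks start; they
    must supply the rise \<open>r\<close>, and each has demand \<open>r\<close>.\<close>
  have "card {p \<in> M. mOf p = m} = 1" if m: "m < B" for m
  proof -
    have "(\<Sum>(p, l)\<in>U. of_bool (posP p = m)) = (0::nat)" using m by (intro sum.neutral) (auto simp: posP_def)
    moreover have "(\<Sum>(i, v)\<in>F. deg i * of_bool (posA i v = m)) = 0"
      using m by (intro sum.neutral) (auto simp: posA_def)
    moreover have "(\<Sum>p\<in>M. r * of_bool (posP p = m)) = 0" using m by (intro sum.neutral) (auto simp: posP_def)
    moreover have "(\<Sum>(p, l)\<in>U. of_bool (zone p l = m)) = (0::nat)"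
      using m zone_ge by (intro sum.neutral) fastforce
    ultimately have "(\<Sum>p\<in>M. r * of_bool (mOf p = m)) = r"
      using bal[of m] m by (simp add: E_def)
    then have "r * card (M \<inter> {p. mOf p = m}) = r"
      using fin by (simp add: sum_distrib_left[symmetric])
    moreover have "M \<inter> {p. mOf p = m} = {p \<in> M. mOf p = m}" by blast
    ultimately show ?thesis using r_pos by simp
  qed
  then have "\<forall>m. m < B \<longrightarrow> (\<exists>p. {p \<in> M. mOf p = m} = {p})" by (metis card_1_singletonE)
  then obtain sel where sel: "\<And>m. m < B \<Longrightarrow> {p \<in> M. mOf p = m} = {sel m}" by metis
  have sel1: "sel m \<in> M" "mOf (sel m) = m" if "m < B" for m using sel[OF that] by blast+
  have sel2: "p = sel (mOf p)" "mOf p < B" if "p \<in> M" for p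
    using opt(1)[of p] that M sel[of "mOf p"] by blast+
  have bij: "bij_betw sel {..<B} M"
    by (rule bij_betw_byWitness[where f' = mOf]) (use sel1 sel2 in auto)
  \<comment> \<open>At \<open>posP p\<close> only \<open>main p\<close> can end and only unit tasks
    of \<open>p\<close> start. There are just \<open>r\<close> of these, so all are taken if
    \<open>main p\<close> is, and none otherwise.\<close>
  have UM: "U = M \<times> {..<r}"
  proof -
    have c: "card {l. (p, l) \<in> U} = r * of_bool (p \<in> M)" if p: "p < K" for p
    proof -
      have "{x \<in> U. fst x = p} = Pair p ` {l. (p, l) \<in> U}" by force
      then have "card {l. (p, l) \<in> U} = card {x \<in> U. fst x = p}" by (simp add: card_image inj_on_def)
      also have "\<dots> = (\<Sum>(p', l)\<in>U. of_bool (posP p' = posP p))"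
        using fin by (simp add: case_prod_unfold posP_def Int_def)
      also have "\<dots> = (\<Sum>p'\<in>M. r * of_bool (posP p' = posP p))"
      proof -
        have "mOf p' \<noteq> posP p" if "p' \<in> M" for p'
          using sel2(2)[OF that] by (simp add: posP_def)
        then have "(\<Sum>p'\<in>M. r * of_bool (mOf p' = posP p)) = 0"
          by (intro sum.neutral) simp
        moreover have "(\<Sum>(i, v)\<in>F. deg i * of_bool (posA i v = posP p)) = 0"
          using p by (intro sum.neutral) (auto simp: posA_def posP_def)
        moreover have "zone p' l \<noteq> posP p" if "(p', l) \<in> U" for p' l
          using zone_ge[OF that] p by (simp add: posP_def)
        then have "(\<Sum>(p', l)\<in>U. of_bool (zone p' l = posP p)) = (0::nat)"
          by (intro sum.neutral) auto
        ultimately show ?thesis using bal[of "posP p"] p by (simp add: E_def posP_def)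
      qed
      also have "\<dots> = r * card (M \<inter> {p'. p' = p})"
        using fin by (simp add: sum_distrib_left[symmetric] posP_def)
      also have "\<dots> = r * of_bool (p \<in> M)" by (cases "p \<in> M") auto
      finally show ?thesis .
    qed
    show ?thesis
    proof (intro set_eqI iffI)
      fix x assume x: "x \<in> U"
      then obtain p l where pl: "x = (p, l)" "p < K" "l < r" using U by (cases x) auto
      have "finite {l. (p, l) \<in> U}" using U by (auto intro: finite_subset[OF _ finite_lessThan[of r]])
      moreover have "{l. (p, l) \<in> U} \<noteq> {}" using x pl(1) by blast
      ultimately have "card {l. (p, l) \<in> U} \<noteq> 0" by simp
      then have "p \<in> M" using c[OF pl(2)] by (cases "p \<in> M") simp_all
      then show "x \<in> M \<times> {..<r}" using pl by simp
    next
      fix x assume "x \<in> M \<times> {..<r}"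
      then obtain p l where pl: "x = (p, l)" "p \<in> M" "l < r" by (cases x) auto
      have "p < K" using pl(2) M by auto
      then have "card {l. (p, l) \<in> U} = card {..<r}" using c[of p] pl(2) by simp
      moreover have "{l. (p, l) \<in> U} \<subseteq> {..<r}" using U by auto
      ultimately have "{l. (p, l) \<in> U} = {..<r}" by (intro card_subset_eq[OF finite_lessThan]) simp_all
      then have "l \<in> {l. (p, l) \<in> U}" using pl(3) by simp
      then show "x \<in> U" using pl(1) by simp
    qed
  qed
  let ?s = "\<lambda>p l. sc (mOf p) l" and ?y = "\<lambda>p l. yOf p ! l"
  have zone_iff: "zone p l = posA i v \<longleftrightarrow> ?s p l = i \<and> ?y p l = v" if "p \<in> M" "l < r" "v < Dm" for p l i v
  proof -
    have "p < K" using that M by auto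
    then show ?thesis using zone[of p l] posA_eq_iff[OF opt(3)[of p l] that(3)] that(2) by simp
  qed
  \<comment> \<open>At the position of a value only one final task starts, of demand
    \<open>deg ?i\<close>, so the number of units ending there is 0 or \<open>deg ?i\<close>. That
    is also the number of all units of the variable; since the entry \<open>(p, l)\<close> arrives
    there, they all do.\<close>
  have all_or_none: "?y p' l' = ?y p l"
    if pl: "p \<in> M" "l < r" "p' \<in> M" "l' < r" "?s p' l' = ?s p l" for p l p' l'
  proof -
    let ?i = "?s p l" and ?v = "?y p l"
    have pK: "p < K" using pl(1) M by auto
    have iv: "?i < V" "?v < Dm" using sc(1)[OF opt(1)[OF pK] pl(2)] opt(3)[OF pK pl(2)] .
    let ?A = "{x \<in> M \<times> {..<r}. ?s (fst x) (snd x) = ?i}"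
    let ?A' = "{x \<in> M \<times> {..<r}. ?s (fst x) (snd x) = ?i \<and> ?y (fst x) (snd x) = ?v}"
    have q: "posA ?i ?v < E" by (rule posA_less[OF iv])
    have "mOf p' \<noteq> posA ?i ?v" if "p' \<in> M" for p'
      using sel2(2)[OF that] by (simp add: posA_def)
    then have "(\<Sum>p\<in>M. r * of_bool (mOf p = posA ?i ?v)) = 0"
      by (intro sum.neutral) simp
    moreover have "(\<Sum>(p, l)\<in>U. of_bool (posP p = posA ?i ?v)) = (0::nat)"
      using U by (intro sum.neutral) (auto simp: posA_def posP_def)
    moreover have "(\<Sum>p\<in>M. r * of_bool (posP p = posA ?i ?v)) = 0"
      using M by (intro sum.neutral) (auto simp: posA_def posP_def)
    moreover have "\<not> posA ?i ?v < B" by (simp add: posA_def)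
    ultimately have 1: "(\<Sum>(i, v)\<in>F. deg i * of_bool (posA i v = posA ?i ?v)) =
        (\<Sum>(p, l)\<in>U. of_bool (zone p l = posA ?i ?v))"
      using bal[OF q] by simp
    have "(\<Sum>(p, l)\<in>U. of_bool (zone p l = posA ?i ?v)) =
       (\<Sum>x\<in>M \<times> {..<r}. of_bool (?s (fst x) (snd x) = ?i \<and> ?y (fst x) (snd x) = ?v) :: nat)"
      unfolding UM by (rule sum.cong) (simp_all add: zone_iff iv(2) case_prod_unfold mem_Times_iff)
    also have "\<dots> = card ?A'" using fin by (simp add: Int_def)
    finally have 2: "(\<Sum>(p, l)\<in>U. of_bool (zone p l = posA ?i ?v)) = card ?A'" .
    have "(\<Sum>(i, v)\<in>F. deg i * of_bool (posA i v = posA ?i ?v)) =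
       (\<Sum>x\<in>F. deg ?i * of_bool (x = (?i, ?v)))"
      using F iv by (intro sum.cong) (auto simp: posA_eq_iff)
    also have "\<dots> \<in> {0, deg ?i}" using fin by (auto simp: sum_distrib_left[symmetric])
    finally have 3: "card ?A' \<in> {0, deg ?i}" using 1 2 by simp
    have "deg ?i = (\<Sum>m<B. \<Sum>l<r. of_bool (sc m l = ?i))" by (rule deg_eq) (rule iv)
    also have "\<dots> = (\<Sum>m<B. \<Sum>l<r. of_bool (?s (sel m) l = ?i))"
      using sel1 by (intro sum.cong refl) simp
    also have "\<dots> = (\<Sum>p\<in>M. \<Sum>l<r. of_bool (?s p l = ?i))"
      by (rule sum.reindex_bij_betw[OF bij])
    also have "\<dots> = card ?A"
      unfolding sum.cartesian_product using fin by (simp add: case_prod_unfold Int_def)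
    finally have 4: "deg ?i = card ?A" .
    have finA: "finite ?A" using fin by simp
    have sub: "?A' \<subseteq> ?A" by auto
    have "(p, l) \<in> ?A'" using pl by simp
    then have "?A' \<noteq> {}" by (metis empty_iff)
    then have "card ?A' \<noteq> 0" by (simp only: card_0_eq[OF finite_subset[OF sub finA]] not_False_eq_True)
    then have "card ?A' = card ?A" using 3 4 by simp
    from card_subset_eq[OF finA sub this] have eq: "?A' = ?A" .
    have "(p', l') \<in> ?A" using pl by simp
    then have "(p', l') \<in> ?A'" unfolding eq .
    then show ?thesis by simp
  qed
  have "\<exists>v<Dm. \<forall>p\<in>M. \<forall>l<r. ?s p l = i \<longrightarrow> ?y p l = v" if i: "i < V" for i
  proof -
    obtain s where s: "s \<in> set Bl" "i \<in> set s" using cover[OF i] by blast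
    obtain m where m: "m < B" "Bl ! m = s" using s(1) by (auto simp: in_set_conv_nth B_def)
    obtain l where l: "l < length s" "s ! l = i" using s(2) by (auto simp: in_set_conv_nth)
    have lr: "l < r" using l(1) sc(2)[OF m(1)] m(2) by simp
    have pK: "sel m < K" using sel1(1)[OF m(1)] M by auto
    show ?thesis
    proof (intro exI[of _ "?y (sel m) l"] conjI ballI allI impI)
      show "?y (sel m) l < Dm" by (rule opt(3)[OF pK lr])
      fix p' l' assume "p' \<in> M" "l' < r" "?s p' l' = i"
      then show "?y p' l' = ?y (sel m) l"
        using all_or_none[OF sel1(1)[OF m(1)] lr] sel1(2)[OF m(1)] m(2) l(2) by simp
    qed
  qed
  then obtain x where x: "\<And>i. i < V \<Longrightarrow> x i < Dm \<and> (\<forall>p\<in>M. \<forall>l<r. ?s p l = i \<longrightarrow> ?y p l = x i)" by metis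
  have y: "yOf (sel m) = map x (Bl ! m)" if m: "m < B" for m
  proof (rule nth_equalityI)
    show "length (yOf (sel m)) = length (map x (Bl ! m))"
      using sel1[OF m] M opt(2)[of "sel m"] sc(2)[OF m] by auto
    fix l assume "l < length (yOf (sel m))"
    then have "l < r" using sel1[OF m] M opt(2)[of "sel m"] by auto
    then show "yOf (sel m) ! l = map x (Bl ! m) ! l"
      using x[OF sc(1)[OF m]] sel1[OF m] sc(2)[OF m] by simp
  qed
  show thesis
  proof (rule that)
    show "x i < Dm" if "i < V" for i using x[OF that] by blast
    show "(m, map x (Bl ! m)) \<in> set L" if m: "m < B" for m
    proof -
      have "sel m < K" using sel1[OF m] M by auto
      then show ?thesis using L_nth[of "sel m"] y[OF m] sel1(2)[OF m] nth_mem[of "sel m" L] by (simp add: K_def)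
    qed
    \<comment> \<open>One option per block fixes the sum of the summands \<open>l\<close>, so it
      cancels against the same sum in \<open>goal\<close>.\<close>
    have "card M = B" using bij_betw_same_card[OF bij] by simp
    then have "(\<Sum>(p, l)\<in>U. l) = B * (\<Sum>l<r. l)"
      unfolding UM sum.cartesian_product[symmetric] by simp
    moreover have "(\<Sum>p\<in>M. w (yOf p)) = (\<Sum>m<B. w (map x (Bl ! m)))"
      unfolding sum.reindex_bij_betw[OF bij, symmetric] using y by simp
    ultimately show "tgt \<le> (\<Sum>m<B. w (map x (Bl ! m)))" using sat(2) by simp
  qed
qed

theorem yes_iff:
  "yes_instance instance_of \<longleftrightarrow> (\<exists>x. (\<forall>i<V. x i < Dm) \<and> (\<forall>m<B. (m, map x (Bl ! m)) \<in> set L) \<and>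
     tgt \<le> (\<Sum>m<B. w (map x (Bl ! m))))"
proof
  assume "yes_instance instance_of"
  from solution_if_yes[OF this] show "\<exists>x. (\<forall>i<V. x i < Dm) \<and> (\<forall>m<B. (m, map x (Bl ! m)) \<in> set L) \<and>
     tgt \<le> (\<Sum>m<B. w (map x (Bl ! m)))" by metis
qed (use yes_if_solution in blast)

text \<open>The exact value and not only a bound, because the reduction has to output the parameter
  of its instance.\<close>

lemma max_capacity: "B > 0 \<Longrightarrow> max_capacity instance_of = r * B"
proof -
  assume B: "B > 0"
  have "cap ` {..<E} \<subseteq> {..r * B}" by (auto simp: cap_def)
  \<comment> \<open>The capacities stop rising at edge \<open>B - 1\<close>, where the last block
    starts.\<close>
  moreover have "r * B \<in> cap ` {..<E}"
    using B by (intro image_eqI[of _ _ "B - 1"]) (auto simp: cap_def E_def)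
  ultimately show ?thesis unfolding instance_of_def max_capacity_line
    by (intro Max_eqI) auto
qed

end

section \<open>Arithmetisation of circuits of bounded depth and weft one\<close>

definition gate_at :: "circuit \<Rightarrow> nat \<Rightarrow> gate" where
  "gate_at C i = nthd Input C i"

lemma gate_at [simp]: "i < length C \<Longrightarrow> gate_at C i = C ! i"
  by (simp add: gate_at_def nthd_nth)

text \<open>Depth and weft are defined through all paths, of which there may be exponentially many
  in an arbitrary circuit. For a fixed level these recursions are polynomial-time tests.\<close>

fun shallow :: "nat \<Rightarrow> circuit \<Rightarrow> nat \<Rightarrow> bool" where
  "shallow 0 C i = (preds (gate_at C i) = [])"
| "shallow (Suc e) C i = (\<forall>j\<in>set (preds (gate_at C i)). shallow e C j)"

text \<open>\<open>True\<close> at level 0 is adequate because \<open>light e\<close> is used for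
  gates with \<open>shallow e\<close>, so that the recursion arrives there at input gates
  only.\<close>

fun light :: "nat \<Rightarrow> nat \<Rightarrow> circuit \<Rightarrow> nat \<Rightarrow> bool" where
  "light 0 t C i = True"
| "light (Suc e) t C i = (if 2 < length (preds (gate_at C i))
     then 0 < t \<and> (\<forall>j\<in>set (preds (gate_at C i)). light e (t - 1) C j)
     else (\<forall>j\<in>set (preds (gate_at C i)). light e t C j))"

text \<open>Paths from an input gate are listed backwards here.\<close>

definition rpath :: "circuit \<Rightarrow> nat list \<Rightarrow> bool" where
  "rpath C q \<longleftrightarrow> q \<noteq> [] \<and> last q \<in> inputs C \<and> (\<forall>i\<in>set q. i < length C) \<and>
     successively (\<lambda>i j. j \<in> set (preds (C ! i))) q"

lemma input_output_path_rev:
  "input_output_path C (rev q) \<longleftrightarrow> rpath C q \<and> hd q = length C - 1"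
  unfolding input_output_path_def rpath_def
    successively_conv_nth[symmetric, where P = "\<lambda>i j. i \<in> set (preds (C ! j))"]
  by (auto simp: hd_rev last_rev successively_rev)

lemma all_io_paths:
  "(\<forall>p. input_output_path C p \<longrightarrow> P p) \<longleftrightarrow> (\<forall>q. rpath C ((length C - 1) # q) \<longrightarrow> P (rev ((length C - 1) # q)))"
proof -
  have "(\<forall>p. input_output_path C p \<longrightarrow> P p) \<longleftrightarrow> (\<forall>q. input_output_path C (rev q) \<longrightarrow> P (rev q))"
    by (metis rev_rev_ident)
  also have "\<dots> \<longleftrightarrow> (\<forall>q. rpath C q \<and> hd q = length C - 1 \<longrightarrow> P (rev q))"
    by (simp add: input_output_path_rev)
  also have "\<dots> \<longleftrightarrow> (\<forall>q. rpath C ((length C - 1) # q) \<longrightarrow> P (rev ((length C - 1) # q)))"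
    by (metis list.collapse list.sel(1) rpath_def)
  finally show ?thesis .
qed

lemma rpath_single: "rpath C [i] \<longleftrightarrow> i \<in> inputs C"
  by (auto simp: rpath_def inputs_def)

lemma rpath_Cons: "rpath C (i # j # q) \<longleftrightarrow> i < length C \<and> j \<in> set (preds (C ! i)) \<and> rpath C (j # q)"
  by (auto simp: rpath_def)

lemma wf_preds: "wf_circuit C \<Longrightarrow> i < length C \<Longrightarrow> j \<in> set (preds (C ! i)) \<Longrightarrow> j < i"
  by (simp add: wf_circuit_def)

lemma wf_no_preds:
  assumes "wf_circuit C" "i < length C"
  shows "preds (C ! i) = [] \<longleftrightarrow> C ! i = Input"
proof -
  have "wf_gate (C ! i)" using assms by (simp add: wf_circuit_def)
  then show ?thesis by (cases "C ! i") auto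
qed

text \<open>Gates other than inputs have predecessors, of smaller index, so walking back ends at an
  input. Hence no predecessor escapes the path conditions on depth and weft for want of a
  path.\<close>

lemma rpath_exists: "wf_circuit C \<Longrightarrow> i < length C \<Longrightarrow> \<exists>q. rpath C (i # q)"
proof (induction i rule: less_induct)
  case (less i)
  show ?case
  proof (cases "C ! i = Input")
    case True
    then have "rpath C [i]" using less by (simp add: rpath_single inputs_def)
    then show ?thesis ..
  next
    case False
    then obtain j where j: "j \<in> set (preds (C ! i))"
      using wf_no_preds less.prems by (metis last_in_set)
    then have "j < i" using wf_preds less.prems by blast
    then obtain q where "rpath C (j # q)" using less.IH[of j] less.prems by auto
    then have "rpath C (i # j # q)" using j less.prems by (simp add: rpath_Cons)
    then show ?thesis ..
  qed
qed

lemma rpath_cases: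
  assumes "wf_circuit C" "i < length C" "C ! i \<noteq> Input"
  shows "(\<forall>q. rpath C (i # q) \<longrightarrow> P q) \<longleftrightarrow> (\<forall>j\<in>set (preds (C ! i)). \<forall>q. rpath C (j # q) \<longrightarrow> P (j # q))"
proof -
  have "\<not> rpath C [i]" using assms by (simp add: rpath_single inputs_def)
  then show ?thesis using assms(2) by (metis neq_Nil_conv rpath_Cons)
qed

lemma rpath_Input:
  assumes "C ! i = Input" "i < length C"
  shows "rpath C (i # q) \<longleftrightarrow> q = []"
  using assms by (cases q) (auto simp: rpath_Cons rpath_single inputs_def)

lemma shallow_iff:
  assumes "wf_circuit C" "i < length C"
  shows "shallow e C i \<longleftrightarrow> (\<forall>q. rpath C (i # q) \<longrightarrow> length q \<le> e)"
  using assms(2)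
proof (induction e arbitrary: i)
  case 0
  show ?case
  proof (cases "C ! i = Input")
    case True
    then show ?thesis using 0 wf_no_preds[OF assms(1) 0] by (simp add: rpath_Input)
  next
    case False
    then have ne: "preds (C ! i) \<noteq> []" using wf_no_preds[OF assms(1) 0] by simp
    then have "hd (preds (C ! i)) \<in> set (preds (C ! i))" by simp
    moreover from this obtain q where "rpath C (hd (preds (C ! i)) # q)"
      using rpath_exists[OF assms(1)] wf_preds[OF assms(1) 0] 0 by (meson less_trans)
    ultimately show ?thesis using 0 ne unfolding rpath_cases[OF assms(1) 0 False] by auto
  qed
next
  case (Suc e)
  show ?case
  proof (cases "C ! i = Input")
    case True
    then show ?thesis using Suc wf_no_preds[OF assms(1) Suc.prems] by (simp add: rpath_Input)
  next
    case False
    have "shallow e C j \<longleftrightarrow> (\<forall>q. rpath C (j # q) \<longrightarrow> length q \<le> e)" if "j \<in> set (preds (C ! i))" for j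
      using Suc.IH[of j] wf_preds[OF assms(1) Suc.prems that] Suc.prems by simp
    then show ?thesis unfolding rpath_cases[OF assms(1) Suc.prems False] using Suc.prems by simp
  qed
qed

text \<open>A large gate uses up one unit of the allowance \<open>t\<close> for every path through
  it.\<close>

lemma light_iff:
  assumes "wf_circuit C" "i < length C" "shallow e C i"
  shows "light e t C i \<longleftrightarrow> (\<forall>q. rpath C (i # q) \<longrightarrow> length (filter (\<lambda>i. large (C ! i)) (i # q)) \<le> t)"
  using assms(2,3)
proof (induction e arbitrary: i t)
  case 0
  then have "C ! i = Input" using wf_no_preds[OF assms(1)] by simp
  then show ?case using 0 by (simp add: rpath_Input large_def)
next
  case (Suc e)
  show ?case
  proof (cases "C ! i = Input")
    case True
    then show ?thesis using Suc by (simp add: rpath_Input large_def)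
  next
    case False
    let ?n = "\<lambda>q. length (filter (\<lambda>i. large (C ! i)) q)"
    have IH: "light e t C j \<longleftrightarrow> (\<forall>q. rpath C (j # q) \<longrightarrow> ?n (j # q) \<le> t)" if "j \<in> set (preds (C ! i))" for j t
      using Suc.IH[of j t] wf_preds[OF assms(1) Suc.prems(1) that] Suc.prems that by simp
    have ne: "preds (C ! i) \<noteq> []" using wf_no_preds[OF assms(1) Suc.prems(1)] False by simp
    show ?thesis
    proof (cases "large (C ! i)")
      case True
      have "(\<forall>q. rpath C (i # q) \<longrightarrow> ?n (i # q) \<le> t) \<longleftrightarrow>
        (\<forall>j\<in>set (preds (C ! i)). \<forall>q. rpath C (j # q) \<longrightarrow> Suc (?n (j # q)) \<le> t)"
        unfolding rpath_cases[OF assms(1) Suc.prems(1) False] using True by simp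
      also have "\<dots> \<longleftrightarrow> 0 < t \<and> (\<forall>j\<in>set (preds (C ! i)). \<forall>q. rpath C (j # q) \<longrightarrow> ?n (j # q) \<le> t - 1)"
      proof (cases t)
        case 0
        \<comment> \<open>With no allowance left, the large gate itself is already too much; a path
          through any predecessor exhibits this.\<close>
        have h: "hd (preds (C ! i)) \<in> set (preds (C ! i))" using ne by simp
        then obtain q where "rpath C (hd (preds (C ! i)) # q)"
          using rpath_exists[OF assms(1)] wf_preds[OF assms(1) Suc.prems(1)] Suc.prems(1) by (meson less_trans)
        then show ?thesis using h 0 by auto
      qed simp
      also have "\<dots> \<longleftrightarrow> light (Suc e) t C i"
        using True Suc.prems(1) IH by (simp add: large_def)
      finally show ?thesis ..
    next
      case F: False
      have "(\<forall>q. rpath C (i # q) \<longrightarrow> ?n (i # q) \<le> t) \<longleftrightarrow>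
        (\<forall>j\<in>set (preds (C ! i)). \<forall>q. rpath C (j # q) \<longrightarrow> ?n (j # q) \<le> t)"
        unfolding rpath_cases[OF assms(1) Suc.prems(1) False] using F by simp
      also have "\<dots> \<longleftrightarrow> light (Suc e) t C i"
        using F Suc.prems(1) IH by (simp add: large_def)
      finally show ?thesis ..
    qed
  qed
qed

lemma depth_at_most_iff:
  assumes "wf_circuit C"
  shows "depth_at_most d C \<longleftrightarrow> shallow d C (length C - 1)"
  using assms unfolding depth_at_most_def all_io_paths
  by (subst shallow_iff) (auto simp: wf_circuit_def)

lemma weft_at_most_iff:
  assumes "wf_circuit C" "shallow d C (length C - 1)"
  shows "weft_at_most t C \<longleftrightarrow> light d t C (length C - 1)"
  using assms unfolding weft_at_most_def all_io_paths
  by (subst light_iff) (auto simp: wf_circuit_def rev_filter[symmetric])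

text \<open>
  A signed monomial is a sign together with a list of input gates; the dummy \<open>length C\<close>, which is
  always true, pads all monomials to the same length.
\<close>

type_synonym poly = "(bool \<times> nat list) list"

text \<open>Only the set of variables of a monomial counts, as variables are idempotent on 0 and 1.
  Repeated entries therefore lengthen monomials without changing values.\<close>

definition ev :: "nat set \<Rightarrow> poly \<Rightarrow> int" where
  "ev Y p = (\<Sum>m\<leftarrow>p. (if fst m then 1 else -1) * of_bool (set (snd m) \<subseteq> Y))"

definition negp :: "poly \<Rightarrow> poly" where
  "negp p = map (\<lambda>m. (\<not> fst m, snd m)) p"

text \<open>Brings a polynomial to the monomial length of a product of two such polynomials.\<close>

definition dblp :: "poly \<Rightarrow> poly" where
  "dblp p = map (\<lambda>m. (fst m, snd m @ snd m)) p"

definition mulp :: "poly \<Rightarrow> poly \<Rightarrow> poly" where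
  "mulp p q = concat (map (\<lambda>a. map (\<lambda>b. (fst a = fst b, snd a @ snd b)) q) p)"

section \<open>Polynomials of gates without large gates below\<close>

lemma ev_simps [simp]:
  "ev Y [] = 0"
  "ev Y (m # p) = (if fst m then 1 else -1) * of_bool (set (snd m) \<subseteq> Y) + ev Y p"
  "ev Y (p @ q) = ev Y p + ev Y q"
  by (simp_all add: ev_def)

lemma ev_negp [simp]: "ev Y (negp p) = - ev Y p"
  by (induction p) (auto simp: negp_def)

lemma ev_dblp [simp]: "ev Y (dblp p) = ev Y p"
  by (induction p) (auto simp: dblp_def)

lemma ev_mulp [simp]: "ev Y (mulp p q) = ev Y p * ev Y q"
proof (induction p)
  case Nil
  then show ?case by (simp add: mulp_def)
next
  case (Cons a p)
  have "ev Y (map (\<lambda>b. (fst a = fst b, snd a @ snd b)) q) =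
    (if fst a then 1 else -1) * of_bool (set (snd a) \<subseteq> Y) * ev Y q"
    by (induction q) (auto simp: algebra_simps)
  then show ?case using Cons by (simp add: mulp_def algebra_simps)
qed

text \<open>The usual arithmetisation 1 - a, a * b and a + b - a * b. The constant 1 is a monomial
  of dummies, and each level doubles the monomial length to keep it uniform.\<close>

fun pol :: "nat \<Rightarrow> circuit \<Rightarrow> nat \<Rightarrow> poly" where
  "pol 0 C i = [(True, [i])]"
| "pol (Suc e) C i = (let g = gate_at C i;
       a = pol e C (nthd 0 (preds g) 0); b = pol e C (nthd 0 (preds g) 1) in
     if tag g = 0 then [(True, replicate (2 ^ Suc e) i)]
     else if tag g = 1 then (True, replicate (2 ^ Suc e) (length C)) # negp (dblp a)
     else if tag g = 2 then mulp a b
     else dblp a @ dblp b @ negp (mulp a b))"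

definition padded :: "nat \<Rightarrow> nat \<Rightarrow> poly \<Rightarrow> bool" where
  "padded l n p \<longleftrightarrow> (\<forall>m\<in>set p. length (snd m) = l \<and> set (snd m) \<subseteq> {..n})"

lemma padded_simps [simp]:
  "padded l n []" "padded l n (m # p) \<longleftrightarrow> length (snd m) = l \<and> set (snd m) \<subseteq> {..n} \<and> padded l n p"
  "padded l n (p @ q) \<longleftrightarrow> padded l n p \<and> padded l n q"
  "padded l n (negp p) \<longleftrightarrow> padded l n p"
  by (auto simp: padded_def negp_def)

lemma padded_dblp: "padded l n p \<Longrightarrow> padded (2 * l) n (dblp p)"
  by (auto simp: padded_def dblp_def)

lemma padded_mulp: "padded l n p \<Longrightarrow> padded l n q \<Longrightarrow> padded (2 * l) n (mulp p q)"
  by (auto simp: padded_def mulp_def)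

definition consistent :: "circuit \<Rightarrow> nat set \<Rightarrow> (nat \<Rightarrow> bool) \<Rightarrow> bool" where
  "consistent C X v \<longleftrightarrow> (\<forall>i<length C. v i = gate_value (C ! i) (i \<in> X) v)"

lemma length_2_nth: "length js = 2 \<Longrightarrow> js = [nthd 0 js 0, nthd 0 js 1]"
  by (cases js; cases "tl js") (auto simp: nthd_def)

lemma padded_pol:
  assumes "wf_circuit C" "i < length C" "shallow e C i" "light e 0 C i"
  shows "padded (2 ^ e) (length C) (pol e C i)"
  using assms(2-)
proof (induction e arbitrary: i)
  case (Suc e)
  have wf: "wf_gate (C ! i)" using assms(1) Suc.prems by (simp add: wf_circuit_def)
  have *: "padded (2 ^ e) (length C) (pol e C j)" if "j \<in> set (preds (C ! i))" for j
    using Suc that wf_preds[OF assms(1) Suc.prems(1) that] by (auto split: if_splits)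
  show ?case
  proof (cases "C ! i")
    case Input
    then show ?thesis using Suc.prems by auto
  next
    case (Neg j)
    then show ?thesis using Suc.prems *[of j] padded_dblp by (auto simp: nthd_def Let_def)
  next
    case (And js)
    then have js: "js = [nthd 0 js 0, nthd 0 js 1]"
      using wf Suc.prems by (intro length_2_nth) (auto split: if_splits)
    then have "padded (2 ^ e) (length C) (pol e C (nthd 0 js 0))" "padded (2 ^ e) (length C) (pol e C (nthd 0 js 1))"
      using * And by (metis list.set_intros preds.simps(3))+
    then show ?thesis using Suc.prems And padded_mulp by (simp add: Let_def)
  next
    case (Or js)
    then have js: "js = [nthd 0 js 0, nthd 0 js 1]"
      using wf Suc.prems by (intro length_2_nth) (auto split: if_splits)
    then have "padded (2 ^ e) (length C) (pol e C (nthd 0 js 0))" "padded (2 ^ e) (length C) (pol e C (nthd 0 js 1))"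
      using * Or by (metis list.set_intros preds.simps(4))+
    then show ?thesis using Suc.prems Or padded_mulp padded_dblp by (simp add: Let_def)
  qed
qed simp

lemma ev_pol:
  assumes "wf_circuit C" "consistent C X v" "i < length C" "shallow e C i" "light e 0 C i"
  shows "ev (insert (length C) X) (pol e C i) = of_bool (v i)"
  using assms(3-)
proof (induction e arbitrary: i)
  case 0
  then have "C ! i = Input" using wf_no_preds[OF assms(1)] by simp
  then show ?case using 0 assms(2) by (auto simp: consistent_def)
next
  case (Suc e)
  have wf: "wf_gate (C ! i)" using assms(1) Suc.prems by (simp add: wf_circuit_def)
  have v: "v i = gate_value (C ! i) (i \<in> X) v" using assms(2) Suc.prems by (simp add: consistent_def)
  have *: "ev (insert (length C) X) (pol e C j) = of_bool (v j)" if "j \<in> set (preds (C ! i))" for j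
    using Suc that wf_preds[OF assms(1) Suc.prems(1) that] by (auto split: if_splits)
  show ?case
  proof (cases "C ! i")
    case Input
    then show ?thesis using Suc.prems v by auto
  next
    case (Neg j)
    then show ?thesis using Suc.prems *[of j] v by (auto simp: nthd_def Let_def)
  next
    case (And js)
    then have "length js = 2" using wf Suc.prems by (auto split: if_splits)
    then obtain a b where js: "js = [a, b]" "nthd 0 js 0 = a" "nthd 0 js (Suc 0) = b"
      using length_2_nth[of js] by simp
    then show ?thesis using Suc.prems(1) v And *[of a] *[of b] by (auto simp: Let_def)
  next
    case (Or js)
    then have "length js = 2" using wf Suc.prems by (auto split: if_splits)
    then obtain a b where js: "js = [a, b]" "nthd 0 js 0 = a" "nthd 0 js (Suc 0) = b"
      using length_2_nth[of js] by simp
    then show ?thesis using Suc.prems(1) v Or *[of a] *[of b] by (auto simp: Let_def)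
  qed
qed

text \<open>The indicator that the claim "gate \<open>i\<close> has value \<open>b\<close>" fails: 1
  minus the value, or the value itself.\<close>

definition viol :: "nat \<Rightarrow> circuit \<Rightarrow> bool \<Rightarrow> nat \<Rightarrow> poly" where
  "viol D C b i = (if b then (True, replicate (2 ^ D) (length C)) # negp (pol D C i) else pol D C i)"

text \<open>
  The claim that gate \<open>i\<close> has value \<open>b\<close> as a disjunction of conjunctions of claims about gates
  without large gates below; each conjunction is represented by the polynomial that counts its violations.
\<close>

fun certs :: "nat \<Rightarrow> nat \<Rightarrow> circuit \<Rightarrow> bool \<Rightarrow> nat \<Rightarrow> poly list" where
  "certs D 0 C b i = [viol D C b i]"
| "certs D (Suc e) C b i = (let g = gate_at C i; js = preds g in
     if light D 0 C i then [viol D C b i]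
     else if tag g = 1 then certs D e C (\<not> b) (nthd 0 js 0)
     else if 2 < length js then
       (if (tag g = 2) = b then [concat (map (viol D C b) js)] else map (viol D C b) js)
     else if (tag g = 2) = b then
       concat (map (\<lambda>p. map (\<lambda>q. p @ q) (certs D e C b (nthd 0 js 1))) (certs D e C b (nthd 0 js 0)))
     else certs D e C b (nthd 0 js 0) @ certs D e C b (nthd 0 js 1))"

section \<open>Counting violated claims above large gates\<close>

lemma shallow_mono:
  assumes "wf_circuit C" "i < length C" "shallow e C i" "e \<le> d"
  shows "shallow d C i"
  using assms by (simp add: shallow_iff) (meson le_trans)

text \<open>Both levels express the same condition on paths once the depth is at most
  \<open>e\<close>. So \<open>certs\<close> may test at its fixed level \<open>D\<close> while
  inductions argue at their own level.\<close>

lemma light_cong: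
  assumes "wf_circuit C" "i < length C" "shallow e C i" "e \<le> d"
  shows "light d t C i \<longleftrightarrow> light e t C i"
  using light_iff[OF assms(1,2) shallow_mono[OF assms]] light_iff[OF assms(1-3)] by simp

lemma viol:
  assumes "wf_circuit C" "i < length C" "shallow D C i" "light D 0 C i"
  shows "padded (2 ^ D) (length C) (viol D C b i)"
    and "consistent C X v \<Longrightarrow> ev (insert (length C) X) (viol D C b i) = of_bool (v i \<noteq> b)"
  using padded_pol[OF assms] ev_pol[OF assms(1) _ assms(2-4), of X v]
  by (auto simp: viol_def)

lemma ev_concat: "ev Y (concat ps) = (\<Sum>p\<leftarrow>ps. ev Y p)"
  by (induction ps) auto

lemma sum_list_of_bool_0: "(\<Sum>j\<leftarrow>js. of_bool (P j) :: int) = 0 \<longleftrightarrow> (\<forall>j\<in>set js. \<not> P j)"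
proof (induction js)
  case (Cons j js)
  have "0 \<le> (\<Sum>j\<leftarrow>js. of_bool (P j) :: int)" by (rule sum_list_nonneg) auto
  then show ?case using Cons by auto
qed simp

text \<open>Concatenation adds violation counts, and a sum of nonnegative numbers is 0 iff both are;
  without the sign condition violations could cancel.\<close>

lemma ev_conj:
  assumes A: "\<forall>p\<in>A. 0 \<le> ev Y p \<and> padded l n p" "(\<exists>p\<in>A. ev Y p = 0) \<longleftrightarrow> P"
    and B: "\<forall>p\<in>B. 0 \<le> ev Y p \<and> padded l n p" "(\<exists>p\<in>B. ev Y p = 0) \<longleftrightarrow> Q"
  shows "(\<forall>p\<in>{p @ q | p q. p \<in> A \<and> q \<in> B}. 0 \<le> ev Y p \<and> padded l n p) \<and>
    ((\<exists>p\<in>{p @ q | p q. p \<in> A \<and> q \<in> B}. ev Y p = 0) \<longleftrightarrow> P \<and> Q)"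
proof
  show "\<forall>p\<in>{p @ q | p q. p \<in> A \<and> q \<in> B}. 0 \<le> ev Y p \<and> padded l n p"
    using A(1) B(1) by auto
  have "ev Y (p @ q) = 0 \<longleftrightarrow> ev Y p = 0 \<and> ev Y q = 0" if "p \<in> A" "q \<in> B" for p q
    using A(1) B(1) that by (simp add: add_nonneg_eq_0_iff)
  moreover have "(\<exists>p\<in>{p @ q | p q. p \<in> A \<and> q \<in> B}. ev Y p = 0) \<longleftrightarrow> (\<exists>p\<in>A. \<exists>q\<in>B. ev Y (p @ q) = 0)"
    by blast
  ultimately show "(\<exists>p\<in>{p @ q | p q. p \<in> A \<and> q \<in> B}. ev Y p = 0) \<longleftrightarrow> P \<and> Q"
    unfolding A(2)[symmetric] B(2)[symmetric] by blast
qed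

text \<open>The test \<open>(tag g = 2) = b\<close> singles out true conjunctions and false
  disjunctions, where all claims about predecessors must hold; otherwise one suffices. A large gate
  exhausts the weft, so its predecessors are covered by single polynomials and no expansion
  continues below it. Nonnegativity is part of the induction for the sake of
  \<open>ev_conj\<close>.\<close>

lemma certs:
  assumes "wf_circuit C" "consistent C X v" "i < length C" "shallow e C i" "light e 1 C i" "e \<le> D"
  shows "(\<forall>p\<in>set (certs D e C b i). 0 \<le> ev (insert (length C) X) p \<and> padded (2 ^ D) (length C) p) \<and>
    ((\<exists>p\<in>set (certs D e C b i). ev (insert (length C) X) p = 0) \<longleftrightarrow> v i = b)"
  using assms(3-)
proof (induction e arbitrary: i b)
  case 0
  have "shallow D C i" "light D 0 C i"
    using shallow_mono[OF assms(1) 0(1,2,4)] light_cong[OF assms(1) 0(1,2,4), of 0] by simp_all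
  then show ?case using viol[OF assms(1) 0(1)] assms(2) by auto
next
  case (Suc e)
  let ?Y = "insert (length C) X" and ?js = "preds (C ! i)"
  have D: "shallow D C i" "light D 0 C i \<longleftrightarrow> light (Suc e) 0 C i"
    using shallow_mono[OF assms(1) Suc.prems(1,2,4)] light_cong[OF assms(1) Suc.prems(1,2,4)] by simp_all
  show ?case
  proof (cases "light D 0 C i")
    case True
    then have "certs D (Suc e) C b i = [viol D C b i]" by (simp add: Let_def)
    then show ?thesis using viol[OF assms(1) Suc.prems(1) D(1) True] assms(2) by auto
  next
    case False
    have wf: "wf_gate (C ! i)" using assms(1) Suc.prems by (simp add: wf_circuit_def)
    have v: "v i = gate_value (C ! i) (i \<in> X) v" using assms(2) Suc.prems by (simp add: consistent_def)
    have j: "j < length C" "shallow e C j" if "j \<in> set ?js" for j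
      using wf_preds[OF assms(1) Suc.prems(1) that] Suc.prems that by auto
    show ?thesis
    proof (cases "2 < length ?js")
      case large: True
      have l: "light e 0 C j" if "j \<in> set ?js" for j
        using Suc.prems large that by simp
      have sl: "shallow D C j" "light D 0 C j" if "j \<in> set ?js" for j
        using shallow_mono[OF assms(1) j[OF that], of D] light_cong[OF assms(1) j[OF that], of D 0] l[OF that]
          Suc.prems(4) by simp_all
      have vi: "padded (2 ^ D) (length C) (viol D C b j)" "ev ?Y (viol D C b j) = of_bool (v j \<noteq> b)"
        if "j \<in> set ?js" for j b
        using viol(1)[OF assms(1) j(1)[OF that] sl[OF that]] viol(2)[OF assms(1) j(1)[OF that] sl[OF that] assms(2)]
        by simp_all
      have tag: "tag (C ! i) = 2 \<or> tag (C ! i) = 3" using large by (cases "C ! i") auto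
      show ?thesis
      proof (cases "(tag (C ! i) = 2) = b")
        case True
        then have c: "certs D (Suc e) C b i = [concat (map (viol D C b) ?js)]"
          using Suc.prems(1) False large tag by (auto simp: Let_def)
        have "ev ?Y (concat (map (viol D C b) ?js)) = (\<Sum>j\<leftarrow>?js. of_bool (v j \<noteq> b))"
          using vi(2) by (simp add: ev_concat comp_def cong: map_cong)
        moreover have "0 \<le> (\<Sum>j\<leftarrow>?js. of_bool (v j \<noteq> b) :: int)" by (rule sum_list_nonneg) auto
        moreover have "(\<forall>j\<in>set ?js. v j = b) \<longleftrightarrow> v i = b"
          using v True tag by (cases "C ! i") auto
        moreover have "padded (2 ^ D) (length C) (concat (map (viol D C b) ?js))"
          using vi(1) by (auto simp: padded_def)
        ultimately show ?thesis unfolding c using sum_list_of_bool_0[of "\<lambda>j. v j \<noteq> b" ?js] by simp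
      next
        case F: False
        then have c: "certs D (Suc e) C b i = map (viol D C b) ?js"
          using Suc.prems(1) False large tag by (auto simp: Let_def)
        have "(\<exists>j\<in>set ?js. v j = b) \<longleftrightarrow> v i = b"
          using v F tag by (cases "C ! i") auto
        then show ?thesis unfolding c using vi by auto
      qed
    next
      case small: False
      have IH: "(\<forall>p\<in>set (certs D e C b j). 0 \<le> ev ?Y p \<and> padded (2 ^ D) (length C) p) \<and>
          ((\<exists>p\<in>set (certs D e C b j). ev ?Y p = 0) \<longleftrightarrow> v j = b)" if "j \<in> set ?js" for j b
      proof (rule Suc.IH[OF j[OF that]])
        show "light e 1 C j" using Suc.prems(1,3) small that by simp
        show "e \<le> D" using Suc.prems(4) by simp
      qed
      show ?thesis
      proof (cases "C ! i")
        case Input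
        then have "light D 0 C i" using D(2) Suc.prems(1) by simp
        then show ?thesis using False by simp
      next
        case (Neg a)
        then have "certs D (Suc e) C b i = certs D e C (\<not> b) a"
          using Suc.prems(1) False by (simp add: Let_def nthd_def)
        then show ?thesis using IH[of a "\<not> b"] v Neg by auto
      next
        case (And js)
        then have "length js = 2" using wf small by auto
        then obtain a c where js: "js = [a, c]" "nthd 0 js 0 = a" "nthd 0 js (Suc 0) = c"
          using length_2_nth[of js] by simp
        have IHa: "\<forall>p\<in>set (certs D e C b a). 0 \<le> ev ?Y p \<and> padded (2 ^ D) (length C) p"
            "(\<exists>p\<in>set (certs D e C b a). ev ?Y p = 0) \<longleftrightarrow> v a = b"
          and IHc: "\<forall>p\<in>set (certs D e C b c). 0 \<le> ev ?Y p \<and> padded (2 ^ D) (length C) p"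
            "(\<exists>p\<in>set (certs D e C b c). ev ?Y p = 0) \<longleftrightarrow> v c = b"
          using IH[of a b] IH[of c b] And js(1) by auto
        show ?thesis
        proof (cases b)
          case True
          then have "set (certs D (Suc e) C b i) =
            {p @ q | p q. p \<in> set (certs D e C b a) \<and> q \<in> set (certs D e C b c)}"
            using Suc.prems(1) False small And js(2,3) by (auto simp: Let_def)
          moreover have "v i = b \<longleftrightarrow> v a = b \<and> v c = b" using v And js(1) True by simp
          ultimately show ?thesis using ev_conj[OF IHa IHc] by simp
        next
          case F: False
          then have "certs D (Suc e) C b i = certs D e C b a @ certs D e C b c"
            using Suc.prems(1) False small And js(2,3) by (simp add: Let_def)
          moreover have "v i = b \<longleftrightarrow> v a = b \<or> v c = b" using v And js(1) F by auto
          ultimately show ?thesis using IHa IHc by auto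
        qed
      next
        case (Or js)
        then have "length js = 2" using wf small by auto
        then obtain a c where js: "js = [a, c]" "nthd 0 js 0 = a" "nthd 0 js (Suc 0) = c"
          using length_2_nth[of js] by simp
        have IHa: "\<forall>p\<in>set (certs D e C b a). 0 \<le> ev ?Y p \<and> padded (2 ^ D) (length C) p"
            "(\<exists>p\<in>set (certs D e C b a). ev ?Y p = 0) \<longleftrightarrow> v a = b"
          and IHc: "\<forall>p\<in>set (certs D e C b c). 0 \<le> ev ?Y p \<and> padded (2 ^ D) (length C) p"
            "(\<exists>p\<in>set (certs D e C b c). ev ?Y p = 0) \<longleftrightarrow> v c = b"
          using IH[of a b] IH[of c b] Or js(1) by auto
        show ?thesis
        proof (cases b)
          case F: False
          then have "set (certs D (Suc e) C b i) =
            {p @ q | p q. p \<in> set (certs D e C b a) \<and> q \<in> set (certs D e C b c)}"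
            using Suc.prems(1) False small Or js(2,3) by (auto simp: Let_def)
          moreover have "v i = b \<longleftrightarrow> v a = b \<and> v c = b" using v Or js(1) F by simp
          ultimately show ?thesis using ev_conj[OF IHa IHc] by simp
        next
          case True
          then have "certs D (Suc e) C b i = certs D e C b a @ certs D e C b c"
            using Suc.prems(1) False small Or js(2,3) by (simp add: Let_def)
          moreover have "v i = b \<longleftrightarrow> v a = b \<or> v c = b" using v Or js(1) True by auto
          ultimately show ?thesis using IHa IHc by auto
        qed
      qed
    qed
  qed
qed

text \<open>Evaluation with fuel: predecessors have smaller indices, so gate \<open>i\<close> has
  its final value after \<open>i + 1\<close> rounds.\<close>

fun value_upto :: "circuit \<Rightarrow> nat set \<Rightarrow> nat \<Rightarrow> nat \<Rightarrow> bool" where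
  "value_upto C X 0 i = False"
| "value_upto C X (Suc n) i = gate_value (C ! i) (i \<in> X) (value_upto C X n)"

lemma gate_value_cong: "(\<And>j. j \<in> set (preds g) \<Longrightarrow> v j = u j) \<Longrightarrow> gate_value g b v = gate_value g b u"
  by (cases g) auto

lemma value_upto_stable:
  assumes "wf_circuit C"
  shows "i < length C \<Longrightarrow> i < n \<Longrightarrow> i < m \<Longrightarrow> value_upto C X n i = value_upto C X m i"
proof (induction i arbitrary: n m rule: less_induct)
  case (less i)
  obtain n' where n: "n = Suc n'" using less.prems(2) by (cases n) auto
  obtain m' where m: "m = Suc m'" using less.prems(3) by (cases m) auto
  have "value_upto C X n' j = value_upto C X m' j" if "j \<in> set (preds (C ! i))" for j
  proof -
    have "j < i" by (rule wf_preds[OF assms less.prems(1) that])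
    then show ?thesis using less.prems n m by (intro less.IH) auto
  qed
  then show ?case unfolding n m value_upto.simps by (rule gate_value_cong)
qed

lemma consistent_exists: "wf_circuit C \<Longrightarrow> \<exists>v. consistent C X v"
proof (rule exI)
  assume wf: "wf_circuit C"
  show "consistent C X (value_upto C X (length C))"
    unfolding consistent_def
  proof (intro allI impI)
    fix i assume i: "i < length C"
    have "value_upto C X (length C) i = value_upto C X (Suc (length C)) i"
      by (rule value_upto_stable[OF wf i]) (use i in simp_all)
    then show "value_upto C X (length C) i = gate_value (C ! i) (i \<in> X) (value_upto C X (length C))"
      unfolding value_upto.simps .
  qed
qed

text \<open>Stated with \<open>\<le> 0\<close>, the form that a profit goal can test; it means
  \<open>= 0\<close> because the counts are nonnegative.\<close>

lemma satisfies_iff: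
  assumes "wf_circuit C" "shallow D C (length C - 1)" "light D 1 C (length C - 1)"
  shows "satisfies X C \<longleftrightarrow> (\<exists>p\<in>set (certs D D C True (length C - 1)). ev (insert (length C) X) p \<le> 0)"
    (is "_ \<longleftrightarrow> ?r")
proof -
  have n: "length C - 1 < length C" using assms(1) by (simp add: wf_circuit_def)
  have *: "?r \<longleftrightarrow> v (length C - 1)" if "consistent C X v" for v
  proof -
    let ?S = "set (certs D D C True (length C - 1))" and ?Y = "insert (length C) X"
    note c = certs[OF assms(1) that n assms(2,3) order_refl, of True]
    have "ev ?Y p \<le> 0 \<longleftrightarrow> ev ?Y p = 0" if "p \<in> ?S" for p
      using bspec[OF conjunct1[OF c] that] by linarith
    then have "?r \<longleftrightarrow> (\<exists>p\<in>?S. ev ?Y p = 0)" by (intro bex_cong refl)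
    with conjunct2[OF c] show ?thesis by simp
  qed
  have "satisfies X C \<longleftrightarrow> (\<exists>v. consistent C X v \<and> v (length C - 1))"
    by (simp add: satisfies_def consistent_def)
  then show ?thesis using * consistent_exists[OF assms(1), of X] by blast
qed

lemma certs_padded:
  assumes "wf_circuit C" "shallow D C (length C - 1)" "light D 1 C (length C - 1)"
    and "p \<in> set (certs D D C True (length C - 1))"
  shows "padded (2 ^ D) (length C) p"
proof -
  \<comment> \<open>Padding does not involve the inputs, so any input set does to read it off
    \<open>certs\<close>.\<close>
  obtain v where "consistent C {} v" using consistent_exists[OF assms(1)] by blast
  moreover have "length C - 1 < length C" using assms(1) by (simp add: wf_circuit_def)
  ultimately show ?thesis using certs[OF assms(1) _ _ assms(2,3) order_refl] assms(4) by blast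
qed

section \<open>Weighted satisfiability as a weighted tuple problem\<close>

fun tuples :: "nat \<Rightarrow> nat \<Rightarrow> nat list list" where
  "tuples 0 n = [[]]"
| "tuples (Suc r) n = concat (map (\<lambda>v. map (\<lambda>t. v # t) (tuples r n)) [0..<n])"

section \<open>Tuples of positions and their admissible values\<close>

lemma set_tuples: "set (tuples r n) = {s. length s = r \<and> set s \<subseteq> {..<n}}"
proof (induction r)
  case (Suc r)
  have "s \<in> set (tuples (Suc r) n) \<longleftrightarrow> length s = Suc r \<and> set s \<subseteq> {..<n}" for s
    using Suc by (cases s) auto
  then show ?case by blast
qed auto

lemma distinct_tuples: "distinct (tuples r n)"
proof (induction r)
  case (Suc r)
  have "tuples (Suc r) n = map (case_prod (#)) (List.product [0..<n] (tuples r n))"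
    by (simp add: concat_map_product)
  moreover have "inj_on (case_prod (#)) A" for A :: "(nat \<times> nat list) set" by (auto simp: inj_on_def)
  ultimately show ?case using Suc by (simp add: distinct_map distinct_product del: tuples.simps)
qed simp

lemma length_tuples: "length (tuples r n) = n ^ r"
  by (induction r) (simp_all add: length_concat comp_def sum_list_triv)

text \<open>Codes for the roles of values: 0 selects a polynomial, 1 is the dummy, 2 an input gate.
  The code 3 of the other gates is never asked for.\<close>

definition kind :: "circuit \<Rightarrow> nat \<Rightarrow> nat" where
  "kind C v = (if v < length C then if tag (gate_at C v) = 0 then 2 else 3
     else if v = length C then 1 else 0)"

text \<open>A block can only test its own entries: which of them coincide, and that position 0 holds
  a selector, position 1 the dummy and every other position an input gate, whence
  \<open>min _ 2\<close>.\<close>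

definition admissible :: "nat \<Rightarrow> circuit \<Rightarrow> nat list \<Rightarrow> nat list \<Rightarrow> bool" where
  "admissible r C s y \<longleftrightarrow> (\<forall>a\<in>set [0..<r].
     (\<forall>b\<in>set [0..<r]. (nthd 0 s a = nthd 0 s b) = (nthd 0 y a = nthd 0 y b)) \<and>
     kind C (nthd 0 y a) = min (nthd 0 s a) 2)"

text \<open>Profits are natural numbers, hence the offset \<open>length f\<close>.\<close>

definition wt :: "poly \<Rightarrow> nat list \<Rightarrow> nat" where
  "wt f y = length f + length (filter (\<lambda>m. \<not> fst m \<and> snd m = y) f) - length (filter (\<lambda>m. fst m \<and> snd m = y) f)"

definition choices :: "nat \<Rightarrow> nat \<Rightarrow> circuit \<Rightarrow> nat list list \<Rightarrow> (nat \<times> nat list) list" where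
  "choices r N C Bl = concat (map (\<lambda>m. map (\<lambda>y. (m, y)) (filter (admissible r C (nthd [] Bl m)) (tuples r N))) [0..<length Bl])"

text \<open>
  Value \<open>length C + 1 + c\<close> of a tuple entry stands for the choice of the \<open>c\<close>-th polynomial.
\<close>

definition flat :: "nat \<Rightarrow> poly list \<Rightarrow> poly" where
  "flat n ps = concat (map (\<lambda>c. map (\<lambda>m. (fst m, Suc (n + c) # snd m)) (nthd [] ps c)) [0..<length ps])"

lemma mem_choices:
  "(m, y) \<in> set (choices r N C Bl) \<longleftrightarrow>
     m < length Bl \<and> length y = r \<and> set y \<subseteq> {..<N} \<and> admissible r C (Bl ! m) y"
  by (auto simp: choices_def set_tuples nthd_nth)

lemma distinct_choices: "distinct (choices r N C Bl)"
proof -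
  have "distinct (concat (map (\<lambda>m. map (\<lambda>y. (m, y)) (f m)) xs))"
    if "distinct xs" "\<And>m. distinct (f m)" for f :: "nat \<Rightarrow> nat list list" and xs :: "nat list"
    using that by (induction xs) (auto simp: distinct_map inj_on_def)
  then show ?thesis unfolding choices_def by (simp add: distinct_tuples)
qed

lemma wt_le: "wt f y \<le> 2 * length f"
proof -
  have "length (filter (\<lambda>m. \<not> fst m \<and> snd m = y) f) \<le> length f" by (rule length_filter_le)
  then show ?thesis unfolding wt_def by linarith
qed

text \<open>The coefficient of the monomial listed as \<open>y\<close>.\<close>

definition sgn_count :: "poly \<Rightarrow> nat list \<Rightarrow> int" where
  "sgn_count f y = (\<Sum>m\<leftarrow>f. (if fst m then 1 else -1) * of_bool (snd m = y))"

lemma int_wt: "int (wt f y) = int (length f) - sgn_count f y"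
proof -
  have "length (filter (\<lambda>m. fst m \<and> snd m = y) f) \<le> length f" by (rule length_filter_le)
  then have "int (wt f y) = int (length f) + int (length (filter (\<lambda>m. \<not> fst m \<and> snd m = y) f)) -
      int (length (filter (\<lambda>m. fst m \<and> snd m = y) f))"
    unfolding wt_def by linarith
  moreover have "int (length (filter (\<lambda>m. fst m \<and> snd m = y) f)) -
      int (length (filter (\<lambda>m. \<not> fst m \<and> snd m = y) f)) = sgn_count f y"
    by (induction f) (auto simp: sgn_count_def)
  ultimately show ?thesis by simp
qed

text \<open>Injectivity of \<open>x\<close> makes the tuple of positions carrying \<open>u\<close>
  unique, and it exists iff all entries of \<open>u\<close> are values of \<open>x\<close>.\<close>

lemma card_preimages:
  assumes "inj_on x {..<V}" "length u = r"
  shows "card {s \<in> set (tuples r V). map x s = u} = of_bool (set u \<subseteq> x ` {..<V})"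
proof (cases "set u \<subseteq> x ` {..<V}")
  case True
  let ?s = "map (inv_into {..<V} x) u"
  have "{s \<in> set (tuples r V). map x s = u} = {?s}"
  proof (intro set_eqI iffI)
    fix s assume "s \<in> {s \<in> set (tuples r V). map x s = u}"
    then have s: "set s \<subseteq> {..<V}" "u = map x s" by (auto simp: set_tuples)
    have "map (inv_into {..<V} x) (map x s) = s"
      using s(1) assms(1) by (intro nth_equalityI) (auto simp: inv_into_f_f subset_iff)
    then show "s \<in> {?s}" using s(2) by simp
  next
    fix s assume "s \<in> {?s}"
    moreover have "map x ?s = u"
      using True by (intro nth_equalityI) (auto simp: f_inv_into_f subset_iff)
    moreover have "set ?s \<subseteq> {..<V}"
      using True inv_into_into[of _ x "{..<V}"] by fastforce
    ultimately show "s \<in> {s \<in> set (tuples r V). map x s = u}"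
      using assms(2) by (simp add: set_tuples)
  qed
  then show ?thesis using True by simp
next
  case False
  then have "{s \<in> set (tuples r V). map x s = u} = {}" by (fastforce simp: set_tuples)
  then show ?thesis using False by simp
qed

text \<open>The global value of the polynomial is split into contributions local to blocks: by
  \<open>card_preimages\<close> a monomial that is true is counted by one block and any other by
  none.\<close>

lemma sum_sgn_count:
  assumes "inj_on x {..<V}" "\<forall>m\<in>set f. length (snd m) = r"
  shows "(\<Sum>s\<in>set (tuples r V). sgn_count f (map x s)) = ev (x ` {..<V}) f"
  using assms(2)
proof (induction f)
  case Nil
  then show ?case by (simp add: sgn_count_def)
next
  case (Cons m f)
  have "(\<Sum>s\<in>set (tuples r V). of_bool (snd m = map x s) :: int) = int (card {s \<in> set (tuples r V). map x s = snd m})"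
    by (simp add: Int_def eq_commute conj_commute)
  also have "\<dots> = of_bool (set (snd m) \<subseteq> x ` {..<V})"
    using card_preimages[OF assms(1), of "snd m" r] Cons.prems by simp
  finally have *: "(\<Sum>s\<in>set (tuples r V). of_bool (snd m = map x s) :: int) = of_bool (set (snd m) \<subseteq> x ` {..<V})" .
  have "(\<Sum>s\<in>set (tuples r V). sgn_count (m # f) (map x s)) =
    (if fst m then 1 else -1) * (\<Sum>s\<in>set (tuples r V). of_bool (snd m = map x s)) +
    (\<Sum>s\<in>set (tuples r V). sgn_count f (map x s))"
    unfolding sum_distrib_left sum.distrib[symmetric] by (simp add: sgn_count_def)
  then show ?case unfolding * using Cons by simp
qed

text \<open>Exactly one selector belongs to the set, so only the monomials that carry it
  survive.\<close>

lemma ev_flat: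
  assumes "c < length ps" "\<And>p. p \<in> set ps \<Longrightarrow> padded l n p" "X \<subseteq> {..<n}"
  shows "ev (insert (Suc (n + c)) (insert n X)) (flat n ps) = ev (insert n X) (ps ! c)"
proof -
  let ?Y = "insert (Suc (n + c)) (insert n X)"
  have *: "ev ?Y (map (\<lambda>m. (fst m, Suc (n + d) # snd m)) p) = (if d = c then ev (insert n X) p else 0)"
    if "padded l n p" for d p
    using that
  proof (induction p)
    case (Cons m p)
    have "Suc (n + d) \<in> ?Y \<longleftrightarrow> d = c" using assms(3) by auto
    moreover have "set (snd m) \<subseteq> ?Y \<longleftrightarrow> set (snd m) \<subseteq> insert n X"
    proof -
      have "Suc (n + c) \<notin> set (snd m)" using Cons.prems by auto
      then show ?thesis by blast
    qed
    ultimately show ?case using Cons by simp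
  qed simp
  have "ev ?Y (flat n ps) = (\<Sum>d\<leftarrow>[0..<length ps]. ev ?Y (map (\<lambda>m. (fst m, Suc (n + d) # snd m)) (nthd [] ps d)))"
    unfolding flat_def ev_concat by (simp add: comp_def)
  also have "\<dots> = (\<Sum>d\<leftarrow>[0..<length ps]. if d = c then ev (insert n X) (ps ! d) else 0)"
    using assms(2) by (intro arg_cong[where f = sum_list] map_cong refl) (simp add: * nthd_nth)
  also have "\<dots> = ev (insert n X) (ps ! c)"
    using assms(1) by (simp add: sum_list_distinct_conv_sum_set)
  finally show ?thesis .
qed

lemma sum_nth_distinct:
  fixes f :: "'a \<Rightarrow> nat"
  assumes "distinct Bl"
  shows "(\<Sum>m<length Bl. f (Bl ! m)) = (\<Sum>s\<in>set Bl. f s)"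
proof -
  have "(\<Sum>m<length Bl. f (Bl ! m)) = sum_list (map f Bl)"
    by (simp add: sum_list_sum_nth atLeast0LessThan)
  then show ?thesis using assms by (simp add: sum_list_distinct_conv_sum_set)
qed

text \<open>Each block weighs \<open>length f\<close> minus a coefficient. The offsets add up to the
  left-hand side, and what is left to compare with 0 is the polynomial.\<close>

lemma weight_iff:
  assumes "inj_on x {..<V}" "\<forall>m\<in>set f. length (snd m) = r"
  defines "Bl \<equiv> tuples r V"
  shows "length Bl * length f \<le> (\<Sum>m<length Bl. wt f (map x (Bl ! m))) \<longleftrightarrow> ev (x ` {..<V}) f \<le> 0"
proof -
  have "int (\<Sum>m<length Bl. wt f (map x (Bl ! m))) = (\<Sum>s\<in>set Bl. int (length f) - sgn_count f (map x s))"
    unfolding sum_nth_distinct[OF distinct_tuples[of r V, folded Bl_def], of "\<lambda>s. wt f (map x s)"]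
    by (simp add: int_wt)
  also have "\<dots> = int (length Bl) * int (length f) - ev (x ` {..<V}) f"
    unfolding sum_subtractf Bl_def sum_sgn_count[OF assms(1,2)] by (simp add: distinct_card distinct_tuples)
  finally have "int (\<Sum>m<length Bl. wt f (map x (Bl ! m))) = int (length Bl * length f) - ev (x ` {..<V}) f" by simp
  then show ?thesis by linarith
qed

lemma admissible_map:
  assumes "length s = r"
  shows "admissible r C s (map x s) \<longleftrightarrow> inj_on x (set s) \<and> (\<forall>i\<in>set s. kind C (x i) = min i 2)"
proof -
  have "admissible r C s (map x s) \<longleftrightarrow> (\<forall>a<r. (\<forall>b<r. (s ! a = s ! b) = (x (s ! a) = x (s ! b))) \<and> kind C (x (s ! a)) = min (s ! a) 2)"
  proof -
    have upt: "(\<forall>a\<in>set [0..<r]. Q a) \<longleftrightarrow> (\<forall>a<r. Q a)" for Q by auto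
    show ?thesis unfolding admissible_def upt using assms by (simp add: nthd_nth)
  qed
  also have "\<dots> \<longleftrightarrow> (\<forall>i\<in>set s. (\<forall>j\<in>set s. (i = j) = (x i = x j)) \<and> kind C (x i) = min i 2)"
    unfolding all_set_conv_all_nth assms ..
  also have "\<dots> \<longleftrightarrow> inj_on x (set s) \<and> (\<forall>i\<in>set s. kind C (x i) = min i 2)"
    unfolding inj_on_def by blast
  finally show ?thesis .
qed

text \<open>Injectivity is a property of pairs, and \<open>2 \<le> r\<close> lets some block contain
  any given pair of positions.\<close>

lemma all_admissible_iff:
  assumes "2 \<le> r" "0 < V"
  shows "(\<forall>s\<in>set (tuples r V). admissible r C s (map x s)) \<longleftrightarrow>
    inj_on x {..<V} \<and> (\<forall>i<V. kind C (x i) = min i 2)" (is "?l \<longleftrightarrow> ?r")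
proof
  assume l: ?l
  have *: "inj_on x {i, j} \<and> kind C (x i) = min i 2" if "i < V" "j < V" for i j
  proof -
    obtain q where q: "r = Suc (Suc q)" using le_Suc_ex[OF assms(1)] by auto
    \<comment> \<open>A block with just the positions \<open>i\<close> and \<open>j\<close>, filled
      up by repetition.\<close>
    define s where "s = i # j # replicate q j"
    have len: "length s = r" by (simp add: s_def q)
    have set: "set s = {i, j}" by (auto simp: s_def)
    have "s \<in> set (tuples r V)" using len set that by (simp add: set_tuples)
    with l have "admissible r C s (map x s)" by (rule bspec)
    then show ?thesis unfolding admissible_map[OF len] set by simp
  qed
  have "inj_on x {..<V}"
  proof (rule inj_onI)
    fix i j assume ij: "i \<in> {..<V}" "j \<in> {..<V}" and eq: "x i = x j"
    from ij have "inj_on x {i, j}" using *[of i j] by blast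
    from inj_onD[OF this eq] show "i = j" by blast
  qed
  moreover have "kind C (x i) = min i 2" if "i < V" for i using *[OF that assms(2)] ..
  ultimately show ?r by blast
next
  assume r: ?r
  show ?l
  proof
    fix s assume "s \<in> set (tuples r V)"
    then have s: "length s = r" "set s \<subseteq> {..<V}" by (auto simp: set_tuples)
    have "inj_on x (set s)" using inj_on_subset[OF conjunct1[OF r] s(2)] .
    moreover have "\<forall>i\<in>set s. kind C (x i) = min i 2" using r s(2) by auto
    ultimately show "admissible r C s (map x s)" using admissible_map[OF s(1)] by simp
  qed
qed

lemma kind_iff:
  "kind C v = 0 \<longleftrightarrow> length C < v" "kind C v = 1 \<longleftrightarrow> v = length C" "kind C v = 2 \<longleftrightarrow> v \<in> inputs C"
proof -
  have "tag g = 0 \<longleftrightarrow> g = Input" for g by (cases g) auto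
  then show "kind C v = 0 \<longleftrightarrow> length C < v" "kind C v = 1 \<longleftrightarrow> v = length C" "kind C v = 2 \<longleftrightarrow> v \<in> inputs C"
    by (auto simp: kind_def inputs_def)
qed

text \<open>Position 0 selects the polynomial, position 1 holds the dummy, and the remaining
  \<open>k\<close> positions enumerate \<open>X\<close>. The values are the gates, the dummy and one
  selector per polynomial, which explains \<open>N\<close>.\<close>

lemma tuple_problem:
  fixes C :: circuit and k D :: nat
  defines "ps \<equiv> certs D D C True (length C - 1)"
  defines "f \<equiv> flat (length C) ps" and "r \<equiv> Suc (2 ^ D)" and "V \<equiv> k + 2" and "N \<equiv> Suc (length C + length ps)"
  defines "Bl \<equiv> tuples r V"
  assumes C: "wf_circuit C" "shallow D C (length C - 1)" "light D 1 C (length C - 1)"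
  shows "(\<exists>x. (\<forall>i<V. x i < N) \<and> (\<forall>m<length Bl. (m, map x (Bl ! m)) \<in> set (choices r N C Bl)) \<and>
      length Bl * length f \<le> (\<Sum>m<length Bl. wt f (map x (Bl ! m)))) \<longleftrightarrow>
    (\<exists>X\<subseteq>inputs C. card X = k \<and> satisfies X C)"
proof -
  let ?n = "length C"
  have r: "2 \<le> r" using one_le_power[of "2::nat" D] by (simp add: r_def)
  have pad: "padded (2 ^ D) ?n p" if "p \<in> set ps" for p
    using certs_padded[OF C] that by (simp add: ps_def)
  have f: "\<forall>m\<in>set f. length (snd m) = r"
  proof
    fix m assume "m \<in> set f"
    then obtain c m' where "c < length ps" "m' \<in> set (ps ! c)" "snd m = Suc (?n + c) # snd m'"
      by (auto simp: f_def flat_def nthd_nth)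
    then show "length (snd m) = r" using pad[of "ps ! c"] by (auto simp: padded_def r_def)
  qed
  have inp: "X \<subseteq> {..<?n}" if "X \<subseteq> inputs C" for X using that by (auto simp: inputs_def)
  have mem: "(\<forall>m<length Bl. (m, map x (Bl ! m)) \<in> set (choices r N C Bl)) \<longleftrightarrow>
      inj_on x {..<V} \<and> (\<forall>i<V. kind C (x i) = min i 2)" if x: "\<forall>i<V. x i < N" for x
  proof -
    have "(\<forall>m<length Bl. (m, map x (Bl ! m)) \<in> set (choices r N C Bl)) \<longleftrightarrow>
      (\<forall>s\<in>set Bl. length s = r \<and> x ` set s \<subseteq> {..<N} \<and> admissible r C s (map x s))"
      unfolding mem_choices all_set_conv_all_nth by simp
    also have "\<dots> \<longleftrightarrow> (\<forall>s\<in>set Bl. admissible r C s (map x s))"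
      using x by (intro ball_cong refl) (auto simp: Bl_def set_tuples)
    also have "\<dots> \<longleftrightarrow> inj_on x {..<V} \<and> (\<forall>i<V. kind C (x i) = min i 2)"
      unfolding Bl_def by (rule all_admissible_iff) (use r in \<open>simp_all add: V_def\<close>)
    finally show ?thesis .
  qed
  have img: "{..<V} = insert 0 (insert 1 ((\<lambda>i. i + 2) ` {..<k}))"
  proof (intro set_eqI iffI)
    fix i assume "i \<in> {..<V}"
    then show "i \<in> insert 0 (insert 1 ((\<lambda>i. i + 2) ` {..<k}))"
      by (cases "i < 2") (auto simp: V_def image_iff less_2_cases_iff intro!: bexI[of _ "i - 2"])
  qed (auto simp: V_def)
  show ?thesis
  proof
    assume "\<exists>x. (\<forall>i<V. x i < N) \<and> (\<forall>m<length Bl. (m, map x (Bl ! m)) \<in> set (choices r N C Bl)) \<and>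
      length Bl * length f \<le> (\<Sum>m<length Bl. wt f (map x (Bl ! m)))"
    then obtain x where x: "\<forall>i<V. x i < N" and inj: "inj_on x {..<V}" and kd: "\<And>i. i < V \<Longrightarrow> kind C (x i) = min i 2"
      and ev: "ev (x ` {..<V}) f \<le> 0"
      using mem weight_iff[OF _ f, of _ V] unfolding Bl_def by metis
    define X where "X = (\<lambda>i. x (i + 2)) ` {..<k}"
    have "x (i + 2) \<in> inputs C" if "i < k" for i
      using kd[of "i + 2"] kind_iff(3)[of C "x (i + 2)"] that by (simp add: V_def)
    then have "X \<subseteq> inputs C" by (auto simp: X_def)
    moreover have "card X = k"
      unfolding X_def using inj by (subst card_image) (auto simp: inj_on_def V_def)
    moreover have "satisfies X C"
    proof -
      \<comment> \<open>Kind 0 puts \<open>x 0\<close> above the dummy and the bound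
        \<open>N\<close> caps it, so it names an existing polynomial.\<close>
      have "?n < x 0" "x 1 = ?n" using kd[of 0] kd[of 1] kind_iff(1,2)[of C] by (auto simp: V_def)
      moreover have "x 0 < N" using x by (simp add: V_def)
      ultimately obtain c where c: "x 0 = Suc (?n + c)" "c < length ps"
        using less_imp_Suc_add[of ?n "x 0"] by (auto simp: N_def)
      have "x ` {..<V} = insert (Suc (?n + c)) (insert ?n X)"
        unfolding img X_def using c \<open>x 1 = ?n\<close> by (simp add: image_image)
      then have "ev (insert ?n X) (ps ! c) \<le> 0"
        using ev ev_flat[OF c(2) pad inp[OF \<open>X \<subseteq> inputs C\<close>]] by (simp add: f_def)
      then show ?thesis unfolding satisfies_iff[OF C] using c(2) nth_mem by (auto simp: ps_def)
    qed
    ultimately show "\<exists>X\<subseteq>inputs C. card X = k \<and> satisfies X C" by blast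
  next
    assume "\<exists>X\<subseteq>inputs C. card X = k \<and> satisfies X C"
    then obtain X where X: "X \<subseteq> inputs C" "card X = k" "satisfies X C" by blast
    then obtain p where "p \<in> set ps" "ev (insert ?n X) p \<le> 0" unfolding satisfies_iff[OF C] ps_def by blast
    then obtain c where c: "c < length ps" "ev (insert ?n X) (ps ! c) \<le> 0" by (metis in_set_conv_nth)
    have "finite X" using finite_subset[OF inp[OF X(1)]] by simp
    then obtain h where h: "bij_betw h {..<k} X"
      using ex_bij_betw_nat_finite[of X] X(2) by (auto simp: atLeast0LessThan)
    define x where "x = (\<lambda>i. if i = 0 then Suc (?n + c) else if i = 1 then ?n else h (i - 2))"
    have hX: "h i \<in> inputs C" "h i < ?n" if "i < k" for i
      using bij_betwE[OF h] that X(1) inp[OF X(1)] by blast+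
    have N: "\<forall>i<V. x i < N"
    proof (intro allI impI)
      fix i assume i: "i < V"
      consider "i = 0" | "i = 1" | "2 \<le> i" by linarith
      then show "x i < N"
      proof cases
        case 3
        then have "i - 2 < k" using i by (simp add: V_def)
        from hX(2)[OF this] show ?thesis using 3 by (simp add: x_def N_def)
      qed (use c(1) in \<open>simp_all add: x_def N_def\<close>)
    qed
    have "x ` {..<V} = insert (Suc (?n + c)) (insert ?n (h ` {..<k}))"
    proof -
      have "x 0 = Suc (?n + c)" "x 1 = ?n" "\<And>i. x (i + 2) = h i" by (simp_all add: x_def)
      then show ?thesis unfolding img image_insert image_image by (simp only:)
    qed
    then have im: "x ` {..<V} = insert (Suc (?n + c)) (insert ?n X)"
      using bij_betw_imp_surj_on[OF h] by simp
    \<comment> \<open>Selector, dummy and inputs lie in disjoint ranges, so the image has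
      \<open>V\<close> elements and injectivity follows by counting.\<close>
    have "card (insert (Suc (?n + c)) (insert ?n X)) = V"
      using \<open>finite X\<close> X(2) inp[OF X(1)] by (subst card_insert_disjoint) (auto simp: V_def card_insert_if)
    then have inj: "inj_on x {..<V}" by (intro eq_card_imp_inj_on) (simp_all add: im)
    have kd: "\<forall>i<V. kind C (x i) = min i 2"
    proof (intro allI impI)
      fix i assume i: "i < V"
      consider "i = 0" | "i = 1" | "2 \<le> i" by linarith
      then show "kind C (x i) = min i 2"
      proof cases
        case 3
        then have "i - 2 < k" using i by (simp add: V_def)
        then have "kind C (h (i - 2)) = 2" using hX(1) kind_iff(3) by blast
        then show ?thesis using 3 by (simp add: x_def)
      qed (use kind_iff[of C] in \<open>auto simp: x_def\<close>)
    qed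
    have "ev (x ` {..<V}) f \<le> 0"
      unfolding im f_def using ev_flat[OF c(1) pad inp[OF X(1)]] c(2) by simp
    then have "length Bl * length f \<le> (\<Sum>m<length Bl. wt f (map x (Bl ! m)))"
      unfolding Bl_def using weight_iff[OF inj f] by blast
    then show "\<exists>x. (\<forall>i<V. x i < N) \<and> (\<forall>m<length Bl. (m, map x (Bl ! m)) \<in> set (choices r N C Bl)) \<and>
      length Bl * length f \<le> (\<Sum>m<length Bl. wt f (map x (Bl ! m)))"
      using N mem[OF N] inj kd by blast
  qed
qed

section \<open>The reduction\<close>

lemma pt_comp2:
  assumes "pt (\<lambda>x. f (fst x) (snd x))" "pt a" "pt b"
  shows "pt (\<lambda>x. f (a x) (b x))"
  using pt_comp[OF assms(1) pt_pair[OF assms(2,3)]] by simp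

lemma pt_replicate: "pt f \<Longrightarrow> pt (\<lambda>x. replicate n (f x))"
  by (induction n) (auto intro: pt_intros)

lemma pt_gate_at: "pt C \<Longrightarrow> pt i \<Longrightarrow> pt (\<lambda>x. gate_at (C x) (i x))"
  unfolding gate_at_def by (intro pt_intros)

text \<open>The level \<open>e\<close> is not part of the input: the induction yields a different
  program for each \<open>e\<close>, with a bound that may grow with \<open>e\<close>. The same
  holds for \<open>light\<close>, \<open>pol\<close>, \<open>certs\<close> and
  \<open>tuples\<close>.\<close>

lemma pt_shallow_pair: "pt (\<lambda>x. shallow e (fst x) (snd x))"
proof (induction e)
  case 0
  show ?case unfolding shallow.simps by (intro pt_gate_at pt_intros)
next
  case (Suc e)
  show ?case unfolding shallow.simps by (intro pt_comp2[OF Suc] pt_gate_at pt_intros)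
qed

lemma pt_light_pair: "pt (\<lambda>x. light e t (fst x) (snd x))"
proof (induction e arbitrary: t)
  case 0
  show ?case unfolding light.simps by (intro pt_intros)
next
  case (Suc e)
  show ?case unfolding light.simps by (intro pt_comp2[OF Suc] pt_gate_at pt_intros)
qed

lemmas pt_shallow = pt_comp2[OF pt_shallow_pair] and pt_light = pt_comp2[OF pt_light_pair]

lemma pt_negp: "pt p \<Longrightarrow> pt (\<lambda>x. negp (p x))"
  unfolding negp_def by (intro pt_intros)

lemma pt_dblp: "pt p \<Longrightarrow> pt (\<lambda>x. dblp (p x))"
  unfolding dblp_def by (intro pt_intros)

lemma pt_mulp: "pt p \<Longrightarrow> pt q \<Longrightarrow> pt (\<lambda>x. mulp (p x) (q x))"
proof (rule pt_comp2[of mulp])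
  show "pt (\<lambda>x. mulp (fst x) (snd x))" unfolding mulp_def by (intro pt_intros)
qed

lemma pt_pol_pair: "pt (\<lambda>x. pol e (fst x) (snd x))"
proof (induction e)
  case 0
  show ?case unfolding pol.simps by (intro pt_intros)
next
  case (Suc e)
  show ?case unfolding pol.simps Let_def
    by (intro pt_comp2[OF Suc] pt_negp pt_dblp pt_mulp pt_gate_at pt_replicate pt_intros)
qed

lemma pt_viol: "pt b \<Longrightarrow> pt C \<Longrightarrow> pt i \<Longrightarrow> pt (\<lambda>x. viol D (C x) (b x) (i x))"
  unfolding viol_def by (intro pt_comp2[OF pt_pol_pair] pt_negp pt_replicate pt_intros)

lemma pt_certs_pair: "pt (\<lambda>x. certs D e (fst x) b (snd x))"
proof (induction e arbitrary: b)
  case 0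
  show ?case unfolding certs.simps by (intro pt_viol pt_intros)
next
  case (Suc e)
  have IH: "pt C \<Longrightarrow> pt i \<Longrightarrow> pt (\<lambda>x. certs D e (C x) b (i x))" for C i b
    by (rule pt_comp2[where f = "\<lambda>C i. certs D e C b i"]) (rule Suc)
  show ?case unfolding certs.simps Let_def
    by (intro IH pt_light pt_viol pt_gate_at pt_intros)
qed

lemma pt_certs: "pt C \<Longrightarrow> pt i \<Longrightarrow> pt (\<lambda>x. certs D e (C x) b (i x))"
  by (rule pt_comp2[where f = "\<lambda>C i. certs D e C b i"]) (rule pt_certs_pair)

lemma pt_tuples: "pt f \<Longrightarrow> pt (\<lambda>x. tuples r (f x))"
proof (rule pt_comp[of "tuples r"])
  show "pt (tuples r)"
  proof (induction r)
    case 0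
    show ?case unfolding tuples.simps by (intro pt_intros)
  next
    case (Suc r)
    show ?case unfolding tuples.simps by (intro pt_comp[OF Suc] pt_intros)
  qed
qed

lemma pt_admissible: "pt C \<Longrightarrow> pt s \<Longrightarrow> pt y \<Longrightarrow> pt (\<lambda>x. admissible r (C x) (s x) (y x))"
proof -
  have "pt (\<lambda>x. admissible r (fst x) (fst (snd x)) (snd (snd x)))"
    unfolding admissible_def kind_def by (intro pt_gate_at pt_intros)
  from pt_comp[OF this] show "pt C \<Longrightarrow> pt s \<Longrightarrow> pt y \<Longrightarrow> ?thesis"
    using pt_pair[of C "\<lambda>x. (s x, y x)"] pt_pair[of s y] by fastforce
qed

lemma pt_choices: "pt N \<Longrightarrow> pt C \<Longrightarrow> pt Bl \<Longrightarrow> pt (\<lambda>x. choices r (N x) (C x) (Bl x))"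
proof -
  have "pt (\<lambda>x. choices r (fst x) (fst (snd x)) (snd (snd x)))"
    unfolding choices_def by (intro pt_admissible pt_tuples pt_intros)
  from pt_comp[OF this] show "pt N \<Longrightarrow> pt C \<Longrightarrow> pt Bl \<Longrightarrow> ?thesis"
    using pt_pair[of N "\<lambda>x. (C x, Bl x)"] pt_pair[of C Bl] by fastforce
qed

lemma pt_flat: "pt n \<Longrightarrow> pt ps \<Longrightarrow> pt (\<lambda>x. flat (n x) (ps x))"
proof (rule pt_comp2[of flat])
  show "pt (\<lambda>x. flat (fst x) (snd x))" unfolding flat_def by (intro pt_intros)
qed

lemma pt_wt: "pt f \<Longrightarrow> pt y \<Longrightarrow> pt (\<lambda>x. wt (f x) (y x))"
proof (rule pt_comp2[of wt])
  show "pt (\<lambda>x. wt (fst x) (snd x))" unfolding wt_def by (intro pt_intros)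
qed

text \<open>One of the encodings of the instance, expressed through \<open>enc\<close> so that the
  rules for \<open>pt\<close> apply; \<open>(False, bits n)\<close> is the nonnegative length bound
  with its sign.\<close>

definition encode_line :: "nat \<Rightarrow> (nat \<Rightarrow> nat) \<Rightarrow> task list \<Rightarrow> nat \<Rightarrow> tree" where
  "encode_line n cap ts tgt = enc (map bits [0..<Suc n],
     map (\<lambda>q. ((bits q, bits (Suc q)), cap q)) [0..<n],
     map (\<lambda>\<theta>. ((bits (fst \<theta>), bits (fst (snd \<theta>))), (bits (fst (snd (snd \<theta>))), bits (snd (snd (snd \<theta>)))))) ts,
     bits tgt, (False, bits n))"

lemma pt_encode_tiles:
  assumes "pt r" "pt Bl" "pt V" "pt N" "pt L" "pt M" "pt tgt"
    and w: "pt (\<lambda>x. w (fst x) (snd x))"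
  shows "pt (\<lambda>x. encode_line (tile_data.E (Bl x) (V x) (N x) (L x)) (tile_data.cap (r x) (Bl x))
     (tile_data.task_list (r x) (Bl x) (V x) (N x) (L x) (w x) (M x))
     (tile_data.goal (r x) (Bl x) (V x) (N x) (L x) (M x) (tgt x)))"
  unfolding encode_line_def tile_data.task_list_def tile_data.goal_def tile_data.main_def tile_data.unit_def
    tile_data.final_def tile_data.zone_def tile_data.posA_def tile_data.posP_def tile_data.E_def tile_data.deg_def
    tile_data.price_def tile_data.cap_def tile_data.mOf_def tile_data.yOf_def tile_data.K_def tile_data.B_def
  \<comment> \<open>Inside maps and filters the input is a component of a nested pair, so each
    parameter is first composed with projections.\<close>
  by (intro assms(1-7)[THEN pt_comp] pt_comp2[OF w] pt_intros)

text \<open>A form of \<open>wf_circuit\<close> with quantifiers over lists and total access only,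
  to which the rules for \<open>pt\<close> apply.\<close>

definition well_formed :: "circuit \<Rightarrow> bool" where
  "well_formed C \<longleftrightarrow> C \<noteq> [] \<and> (\<forall>i\<in>set [0..<length C].
     (2 \<le> tag (gate_at C i) \<longrightarrow> 2 \<le> length (preds (gate_at C i)) \<and>
       (\<forall>a\<in>set [0..<length (preds (gate_at C i))]. \<forall>b\<in>set [0..<length (preds (gate_at C i))].
          nthd 0 (preds (gate_at C i)) a = nthd 0 (preds (gate_at C i)) b \<longrightarrow> a = b)) \<and>
     (\<forall>j\<in>set (preds (gate_at C i)). j < i))"

lemma pt_well_formed: "pt C \<Longrightarrow> pt (\<lambda>x. well_formed (C x))"
proof (rule pt_comp[of well_formed])
  show "pt well_formed" unfolding well_formed_def[abs_def] by (intro pt_gate_at pt_intros)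
qed

lemma well_formed_iff: "well_formed C \<longleftrightarrow> wf_circuit C"
proof -
  have upt: "(\<forall>a\<in>set [0..<n]. Q a) \<longleftrightarrow> (\<forall>a<n. Q a)" for Q n by auto
  have "(\<forall>a<length js. \<forall>b<length js. nthd 0 js a = nthd 0 js b \<longrightarrow> a = b) \<longleftrightarrow> distinct js" for js
    by (auto simp: distinct_conv_nth nthd_nth)
  then have "(2 \<le> tag g \<longrightarrow> 2 \<le> length (preds g) \<and>
      (\<forall>a<length (preds g). \<forall>b<length (preds g). nthd 0 (preds g) a = nthd 0 (preds g) b \<longrightarrow> a = b)) \<longleftrightarrow> wf_gate g" for g
    by (cases g) auto
  then show ?thesis unfolding well_formed_def wf_circuit_def upt by simp
qed

definition circuit_of :: "tree \<Rightarrow> circuit" where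
  "circuit_of x = map gate_of (spine x)"

lemma circuit_of_enc: "circuit_of (enc_list enc_gate C) = C"
  by (simp add: circuit_of_def spine_enc_list comp_def)

lemma pt_circuit_of: "pt f \<Longrightarrow> pt (\<lambda>x. circuit_of (f x))"
  unfolding circuit_of_def by (intro pt_intros)

text \<open>The decoder accepts every tree; encoding its result again exposes the trees that are no
  circuits.\<close>

definition input_ok :: "nat \<Rightarrow> tree \<Rightarrow> bool" where
  "input_ok D x \<longleftrightarrow> enc (circuit_of x) = x \<and> well_formed (circuit_of x) \<and>
     shallow D (circuit_of x) (length (circuit_of x) - 1) \<and> light D 1 (circuit_of x) (length (circuit_of x) - 1)"

definition arity :: "nat \<Rightarrow> nat" where
  "arity D = Suc (2 ^ D)"

definition polys :: "nat \<Rightarrow> tree \<Rightarrow> poly list" where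
  "polys D x = certs D D (circuit_of x) True (length (circuit_of x) - 1)"

definition monomials :: "nat \<Rightarrow> tree \<Rightarrow> poly" where
  "monomials D x = flat (length (circuit_of x)) (polys D x)"

definition blocks :: "nat \<Rightarrow> nat \<Rightarrow> nat list list" where
  "blocks D k = tuples (arity D) (k + 2)"

definition domain_size :: "nat \<Rightarrow> tree \<Rightarrow> nat" where
  "domain_size D x = Suc (length (circuit_of x) + length (polys D x))"

definition options_of :: "nat \<Rightarrow> tree \<Rightarrow> nat \<Rightarrow> (nat \<times> nat list) list" where
  "options_of D x k = choices (arity D) (domain_size D x) (circuit_of x) (blocks D k)"

text \<open>Inputs that are no circuits of the class are sent to \<open>Leaf\<close>, which encodes
  no instance. The second component is the maximum capacity, arity times number of blocks.\<close>

definition reduction :: "nat \<Rightarrow> tree \<times> nat \<Rightarrow> tree \<times> nat" where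
  "reduction D p = (if input_ok D (fst p)
     then (encode_line (tile_data.E (blocks D (snd p)) (snd p + 2) (domain_size D (fst p)) (options_of D (fst p) (snd p)))
        (tile_data.cap (arity D) (blocks D (snd p)))
        (tile_data.task_list (arity D) (blocks D (snd p)) (snd p + 2) (domain_size D (fst p))
           (options_of D (fst p) (snd p)) (wt (monomials D (fst p))) (2 * length (monomials D (fst p))))
        (tile_data.goal (arity D) (blocks D (snd p)) (snd p + 2) (domain_size D (fst p))
           (options_of D (fst p) (snd p)) (2 * length (monomials D (fst p)))
           (length (blocks D (snd p)) * length (monomials D (fst p)))),
       arity D * length (blocks D (snd p)))
     else (Leaf, 0))"

lemma pt_reduction: "pt (reduction D)"
proof -
  have polys: "pt f \<Longrightarrow> pt (\<lambda>x. polys D (f x))" for f :: "tree \<times> nat \<Rightarrow> tree"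
    unfolding polys_def by (intro pt_certs pt_circuit_of pt_intros)
  have monomials: "pt (\<lambda>x::tree \<times> nat. monomials D (fst x))"
    unfolding monomials_def by (intro pt_flat polys pt_circuit_of pt_intros)
  have blocks: "pt (\<lambda>x::tree \<times> nat. blocks D (snd x))"
    unfolding blocks_def by (intro pt_tuples pt_intros)
  have dom: "pt (\<lambda>x::tree \<times> nat. domain_size D (fst x))"
    unfolding domain_size_def by (intro polys pt_circuit_of pt_intros)
  have opt: "pt (\<lambda>x::tree \<times> nat. options_of D (fst x) (snd x))"
    unfolding options_of_def by (intro pt_choices dom blocks pt_circuit_of pt_intros)
  have ok: "pt (\<lambda>x::tree \<times> nat. input_ok D (fst x))"
    unfolding input_ok_def by (intro pt_well_formed pt_shallow pt_light pt_circuit_of pt_intros)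
  have w: "pt (\<lambda>x::(tree \<times> nat) \<times> nat list. wt (monomials D (fst (fst x))) (snd x))"
    by (intro pt_wt pt_comp[OF monomials] pt_intros)
  show ?thesis unfolding reduction_def[abs_def]
    by (intro pt_if pt_pair ok pt_encode_tiles w opt dom blocks monomials pt_intros)
qed

section \<open>The instance behind an encoding\<close>

lemma bits_inj: "bits m = bits n \<Longrightarrow> m = n"
proof (induction m arbitrary: n rule: less_induct)
  case (less m)
  show ?case
  proof (cases "m = 0 \<or> n = 0")
    case True
    then show ?thesis using less.prems bits.simps[of m] bits.simps[of n] by (auto split: if_splits)
  next
    case False
    then have "odd m = odd n" "bits (m div 2) = bits (n div 2)"
      using less.prems bits.simps[of m] bits.simps[of n] by simp_all
    moreover from this have "m div 2 = n div 2" using less.IH[of "m div 2"] False by simp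
    ultimately show ?thesis by presburger
  qed
qed

lemma enc_binary_inj: "enc_binary m = enc_binary n \<longleftrightarrow> m = n"
  using bits_inj by (auto simp: enc_binary_eq)

lemma enc_int_inj: "enc_int i = enc_int j \<Longrightarrow> i = j"
  by (auto simp: enc_int_def enc_binary_inj tree_of_bool_def split: if_splits)

lemma enc_list_eq_all2: "enc_list f xs = enc_list g ys \<Longrightarrow> list_all2 (\<lambda>x y. f x = g y) xs ys"
proof (induction xs arbitrary: ys)
  case Nil
  then show ?case by (cases ys) auto
next
  case (Cons x xs)
  then show ?case by (cases ys) auto
qed

text \<open>\<open>unsplittable_flow\<close> speaks of some instance encoded by \<open>x\<close>.
  Decoding is unique up to capacities outside the edge set, which no encoding records, so membership
  can be decided on one chosen instance.\<close>

lemma encodes_instance_unique: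
  assumes "encodes_instance x I" "encodes_instance x J"
  shows "graph I = graph J" "tasks I = tasks J" "target I = target J" "length_bound I = length_bound J"
    and "\<And>e. e \<in> snd (graph I) \<Longrightarrow> capacity I e = capacity J e"
proof -
  let ?fe = "\<lambda>I (u, v). Node (Node (enc_binary u) (enc_binary v)) (enc_unary (capacity I {u, v}))"
  let ?ft = "\<lambda>(s, t, d, w). Node (Node (enc_binary s) (enc_binary t)) (Node (enc_binary d) (enc_binary w))"
  obtain vs es ts where I: "set vs = fst (graph I)" "(\<lambda>(u, v). {u, v}) ` set es = snd (graph I)" "set ts = tasks I"
    "x = Node (enc_list enc_binary vs) (Node (enc_list (?fe I) es) (Node (enc_list ?ft ts)
       (Node (enc_binary (target I)) (enc_int (length_bound I)))))"
    using assms(1) unfolding encodes_instance_def by blast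
  obtain vs' es' ts' where J: "set vs' = fst (graph J)" "(\<lambda>(u, v). {u, v}) ` set es' = snd (graph J)" "set ts' = tasks J"
    "x = Node (enc_list enc_binary vs') (Node (enc_list (?fe J) es') (Node (enc_list ?ft ts')
       (Node (enc_binary (target J)) (enc_int (length_bound J)))))"
    using assms(2) unfolding encodes_instance_def by blast
  have eqs: "enc_list enc_binary vs = enc_list enc_binary vs'" "enc_list (?fe I) es = enc_list (?fe J) es'"
    "enc_list ?ft ts = enc_list ?ft ts'" "enc_binary (target I) = enc_binary (target J)"
    "enc_int (length_bound I) = enc_int (length_bound J)"
    using I(4) J(4) by simp_all
  have vs: "vs = vs'" by (rule enc_list_inj[OF _ eqs(1)]) (simp add: enc_binary_inj)
  have ts: "ts = ts'" by (rule enc_list_inj[OF _ eqs(3)]) (auto simp: enc_binary_inj split: prod.splits)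
  have all: "list_all2 (\<lambda>a b. a = b \<and> (case a of (u, v) \<Rightarrow> capacity I {u, v} = capacity J {u, v})) es es'"
    by (rule list_all2_mono[OF enc_list_eq_all2[OF eqs(2)]])
      (auto simp: enc_binary_inj dest: enc_unary_inj split: prod.splits)
  then have es: "es = es'" by (metis (mono_tags, lifting) list.rel_eq list_all2_mono)
  have cap: "case a of (u, v) \<Rightarrow> capacity I {u, v} = capacity J {u, v}" if "a \<in> set es" for a
    using all that unfolding es by (auto simp: list_all2_same)
  show "graph I = graph J" using I(1,2) J(1,2) vs es by (simp add: prod_eq_iff)
  show "tasks I = tasks J" using I(3) J(3) ts by simp
  show "target I = target J" using eqs(4) by (simp add: enc_binary_inj)
  show "length_bound I = length_bound J" by (rule enc_int_inj[OF eqs(5)])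
  show "capacity I e = capacity J e" if e: "e \<in> snd (graph I)" for e
  proof -
    obtain u v where "(u, v) \<in> set es" "e = {u, v}" using e unfolding I(2)[symmetric] by auto
    then show ?thesis using cap[of "(u, v)"] by simp
  qed
qed

lemma mem_unsplittable_flow:
  assumes x: "encodes_instance x I" and "valid_instance I" "\<G> (graph I)"
  shows "(x, k) \<in> unsplittable_flow \<G> \<longleftrightarrow> k = max_capacity I \<and> yes_instance I"
proof -
  have *: "max_capacity J = max_capacity I \<and> (yes_instance J \<longleftrightarrow> yes_instance I)" if "encodes_instance x J" for J
  proof -
    note u = encodes_instance_unique[OF that x]
    have "capacity J ` snd (graph I) = capacity I ` snd (graph I)"
      by (rule image_cong[OF refl]) (use u(1,5) in simp)
    then have "max_capacity J = max_capacity I" by (simp add: max_capacity_def u(1))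
    moreover have "flow_routing J T R \<longleftrightarrow> flow_routing I T R" for T R
      using u(5) by (simp add: flow_routing_def u(1,4))
    then have "yes_instance J \<longleftrightarrow> yes_instance I" by (simp add: yes_instance_def u(2,3))
    ultimately show ?thesis ..
  qed
  show ?thesis
  proof
    assume "(x, k) \<in> unsplittable_flow \<G>"
    then obtain J where "k = max_capacity J" "encodes_instance x J" "yes_instance J"
      unfolding unsplittable_flow_def by blast
    then show "k = max_capacity I \<and> yes_instance I" using * by simp
  next
    assume "k = max_capacity I \<and> yes_instance I"
    then show "(x, k) \<in> unsplittable_flow \<G>" using assms unfolding unsplittable_flow_def by blast
  qed
qed

lemma enc_map: "(\<And>a. f a = enc (h a)) \<Longrightarrow> enc (map h xs) = enc_list f xs"
  by (induction xs) simp_all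

lemma encodes_line:
  assumes "distinct ts"
  shows "encodes_instance (encode_line n cap ts tgt) (line_instance n cap (set ts) tgt)"
proof -
  let ?I = "line_instance n cap (set ts) tgt"
  let ?es = "map (\<lambda>q. (q, Suc q)) [0..<n]"
  have "distinct (map (\<lambda>(u, v). {u, v}) ?es)"
    by (auto simp: distinct_map inj_on_def doubleton_eq_iff)
  moreover have "(\<lambda>(u, v). {u, v}) ` set ?es = snd (graph ?I)"
    by (auto simp: line_instance_def line_edges_def)
  moreover have "distinct [0..<Suc n]" "set [0..<Suc n] = fst (graph ?I)"
    by (auto simp: line_instance_def)
  moreover have "encode_line n cap ts tgt = Node (enc_list enc_binary [0..<Suc n])
         (Node (enc_list (\<lambda>(u, v). Node (Node (enc_binary u) (enc_binary v))
                                         (enc_unary (capacity ?I {u, v}))) ?es)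
         (Node (enc_list (\<lambda>(s, t, d, w). Node (Node (enc_binary s) (enc_binary t))
                                               (Node (enc_binary d) (enc_binary w))) ts)
         (Node (enc_binary (target ?I))
               (enc_int (length_bound ?I)))))"
  proof -
    have "enc (map bits [0..<Suc n]) = enc_list enc_binary [0..<Suc n]"
      by (rule enc_map) (rule enc_binary_eq)
    moreover have "enc (map (\<lambda>q. ((bits q, bits (Suc q)), cap q)) [0..<n]) =
      enc_list (\<lambda>(u, v). Node (Node (enc_binary u) (enc_binary v)) (enc_unary (capacity ?I {u, v}))) ?es"
    proof -
      have "enc_list f (map h xs) = enc_list (\<lambda>a. f (h a)) xs" for f :: "nat \<times> nat \<Rightarrow> tree" and h and xs :: "nat list"
        by (induction xs) simp_all
      then show ?thesis
        by (simp only:) (rule enc_map, simp add: enc_prod_def enc_nat_def enc_binary_eq line_instance_def)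
    qed
    moreover have "enc (map (\<lambda>\<theta>. ((bits (fst \<theta>), bits (fst (snd \<theta>))), (bits (fst (snd (snd \<theta>))), bits (snd (snd (snd \<theta>)))))) ts) =
      enc_list (\<lambda>(s, t, d, w). Node (Node (enc_binary s) (enc_binary t)) (Node (enc_binary d) (enc_binary w))) ts"
      by (rule enc_map) (simp add: enc_prod_def enc_binary_eq case_prod_unfold)
    moreover have "enc (False, bits n) = enc_int (length_bound ?I)"
      by (simp add: enc_prod_def enc_bool_def enc_int_def enc_binary_eq line_instance_def)
    ultimately show ?thesis
      unfolding encode_line_def by (simp add: enc_prod_def enc_binary_eq line_instance_def)
  qed
  moreover have "set ts = tasks ?I" by (simp add: line_instance_def)
  ultimately show ?thesis using assms unfolding encodes_instance_def by blast
qed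

section \<open>Correctness of the reduction\<close>

lemma tiles_reduction:
  "tiles (arity D) (blocks D k) (k + 2) (domain_size D x) (options_of D x k) (wt f) (2 * length f)"
proof (unfold_locales)
  show "0 < arity D" by (simp add: arity_def)
  show "length s = arity D \<and> set s \<subseteq> {..<k + 2}" if "s \<in> set (blocks D k)" for s
    using that by (simp add: blocks_def set_tuples)
  show "\<exists>s\<in>set (blocks D k). i \<in> set s" if "i < k + 2" for i
  proof (rule bexI)
    \<comment> \<open>The constant tuple is among the blocks, so every position is covered.\<close>
    show "i \<in> set (replicate (arity D) i)" by (simp add: arity_def)
    show "replicate (arity D) i \<in> set (blocks D k)"
      using that by (auto simp: blocks_def set_tuples)
  qed
  show "m < length (blocks D k) \<and> length y = arity D \<and> set y \<subseteq> {..<domain_size D x}"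
    if "(m, y) \<in> set (options_of D x k)" for m y
    using that by (simp add: options_of_def mem_choices)
  show "distinct (options_of D x k)" by (simp add: options_of_def distinct_choices)
  show "wt f y \<le> 2 * length f" for y by (rule wt_le)
qed

lemma length_blocks: "length (blocks D k) = (k + 2) ^ arity D"
  by (simp add: blocks_def length_tuples)

lemma enc_circuit: "enc_list enc_gate = (enc :: circuit \<Rightarrow> tree)"
  by (rule ext) (simp add: enc_list_def enc_gate_def[abs_def])

lemma weighted_circuit_sat_iff:
  "(x, k) \<in> weighted_circuit_sat 1 D \<longleftrightarrow> input_ok D x \<and>
     (\<exists>X\<subseteq>inputs (circuit_of x). card X = k \<and> satisfies X (circuit_of x))"
proof
  assume "(x, k) \<in> weighted_circuit_sat 1 D"
  then obtain C where C: "x = enc_list enc_gate C" "wf_circuit C" "weft_at_most 1 C" "depth_at_most D C"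
    "\<exists>X\<subseteq>inputs C. card X = k \<and> satisfies X C" unfolding weighted_circuit_sat_def by blast
  have "circuit_of (enc C) = C" using circuit_of_enc[of C] by (simp only: enc_circuit)
  then show "input_ok D x \<and> (\<exists>X\<subseteq>inputs (circuit_of x). card X = k \<and> satisfies X (circuit_of x))"
    using C depth_at_most_iff[OF C(2)] weft_at_most_iff[OF C(2)]
    by (simp add: input_ok_def enc_circuit well_formed_iff)
next
  assume *: "input_ok D x \<and> (\<exists>X\<subseteq>inputs (circuit_of x). card X = k \<and> satisfies X (circuit_of x))"
  then have wf: "wf_circuit (circuit_of x)" and d: "shallow D (circuit_of x) (length (circuit_of x) - 1)"
    and l: "light D 1 (circuit_of x) (length (circuit_of x) - 1)" and x: "x = enc_list enc_gate (circuit_of x)"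
    by (simp_all add: input_ok_def well_formed_iff enc_circuit)
  have "weft_at_most 1 (circuit_of x)" "depth_at_most D (circuit_of x)"
    using depth_at_most_iff[OF wf] weft_at_most_iff[OF wf d] d l by blast+
  then show "(x, k) \<in> weighted_circuit_sat 1 D"
    unfolding weighted_circuit_sat_def using x wf * by blast
qed

text \<open>Stated for any graph class that contains the lines built here, so that arbitrary graphs
  and paths are handled at once.\<close>

lemma reduction_correct:
  assumes "\<And>n. \<G> ({..n}, line_edges n)"
  shows "(x, k) \<in> weighted_circuit_sat 1 D \<longleftrightarrow> reduction D (x, k) \<in> unsplittable_flow \<G>"
proof (cases "input_ok D x")
  case False
  then have "reduction D (x, k) = (Leaf, 0)" by (simp add: reduction_def)
  moreover have "(Leaf, 0) \<notin> unsplittable_flow \<G>"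
    by (auto simp: unsplittable_flow_def encodes_instance_def)
  ultimately show ?thesis using False unfolding weighted_circuit_sat_iff by simp
next
  case True
  let ?C = "circuit_of x" and ?f = "monomials D x"
  let ?Bl = "blocks D k" and ?N = "domain_size D x" and ?L = "options_of D x k"
  interpret T: tiles "arity D" ?Bl "k + 2" ?N ?L "wt ?f" "2 * length ?f" "length ?Bl * length ?f"
    by (rule tiles_reduction)
  have wf: "wf_circuit ?C" "shallow D ?C (length ?C - 1)" "light D 1 ?C (length ?C - 1)"
    using True by (simp_all add: input_ok_def well_formed_iff)
  have red: "reduction D (x, k) = (encode_line T.E T.cap T.task_list T.goal, arity D * T.B)"
    using True by (simp add: reduction_def T.B_def)
  have enc: "encodes_instance (encode_line T.E T.cap T.task_list T.goal) T.instance_of"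
    unfolding T.instance_of_def by (rule encodes_line) (rule T.distinct_task_list)
  have valid: "valid_instance T.instance_of"
    unfolding T.instance_of_def by (rule valid_line_instance[OF finite_set T.tasks_wf])
  have graph: "\<G> (graph T.instance_of)"
    unfolding T.instance_of_def line_instance_def by (simp add: assms)
  have "max_capacity T.instance_of = arity D * T.B"
    by (rule T.max_capacity) (simp add: T.B_def length_blocks)
  then have "reduction D (x, k) \<in> unsplittable_flow \<G> \<longleftrightarrow> yes_instance T.instance_of"
    unfolding red mem_unsplittable_flow[where \<G> = \<G>, OF enc valid graph] by simp
  also have "\<dots> \<longleftrightarrow> (\<exists>X\<subseteq>inputs ?C. card X = k \<and> satisfies X ?C)"
    unfolding T.yes_iff T.B_def
    using tuple_problem[OF wf, of k, folded arity_def]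
    by (simp add: blocks_def options_of_def domain_size_def monomials_def polys_def)
  finally show ?thesis using True unfolding weighted_circuit_sat_iff by simp
qed

lemma W_hard_unsplittable_flow:
  assumes "\<And>n. \<G> ({..n}, line_edges n)"
  shows "W_hard 1 (unsplittable_flow \<G>)"
  unfolding W_hard_def
proof
  fix A assume "A \<in> W 1"
  then obtain D where A: "fpt_reducible A (weighted_circuit_sat 1 D)" unfolding W_def by blast
  let ?G = "\<lambda>k. arity D * (k + 2) ^ arity D"
  show "fpt_reducible A (unsplittable_flow \<G>)"
  proof (rule fpt_reducible_pt[OF A pt_reduction])
    show "(x, k) \<in> weighted_circuit_sat 1 D \<longleftrightarrow> reduction D (x, k) \<in> unsplittable_flow \<G>" for x k
      by (rule reduction_correct) (rule assms)
    show "snd (reduction D (x, k)) \<le> ?G k" for x k by (simp add: reduction_def length_blocks)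
    show "mono ?G" by (intro monoI mult_le_mono2 power_mono) auto
    show "pt ?G" by (intro pt_intros)
  qed
qed

theorem theorem2:
  shows "W_hard 1 (unsplittable_flow (\<lambda>G. True)) \<and> W_hard 1 (unsplittable_flow path_graph)"
  using W_hard_unsplittable_flow[of "\<lambda>G. True"] W_hard_unsplittable_flow[of path_graph] path_graph_line
  by blast

end
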